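(* Let $\mathcal{N}\to\mathcal{G}_6$ be an $n$-fold covering over $\mathcal{G}_6$ with $\mathcal{N}$ connected. Then $\mathcal{N}$ is homeomorphic to one of $\mathcal{G}_6$, $\mathcal{G}_2$ or $\mathcal{G}_1$. For every positive integer $n$ the corresponding numbers of nonequivalent coverings are given by the following formulas: (i) $c_{\mathcal{G}_1,\mathcal{G}_6}(n)=\frac14\omega\left(\frac n4\right)+\frac34\sigma_2\left(\frac n4\right)+\frac94\sigma_2\left(\frac n8\right)$, (ii) $c_{\mathcal{G}_2,\mathcal{G}_6}(n)=\frac32\Big(\sigma_2\left(\frac n2\right)+2\sigma_2\left(\frac n4\right)-3\sigma_2\left(\frac n8\right)+d_3\left(\frac n2\right)-d_3\left(\frac n4\right)-3d_3\left(\frac n8\right)+5d_3\left(\frac n{16}\right)-2d_3\left(\frac n{32}\right)\Big)$, (iii) $c_{\mathcal{G}_6,\mathcal{G}_6}(n)=d_3(n)-3d_3\left(\frac n2\right)+3d_3\left(\frac n4\right)-d_3\left(\frac n8\right)$.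
   Context: $\mathcal{G}_1,\mathcal{G}_2,\mathcal{G}_6$ are the closed orientable flat (Euclidean) 3-manifolds, each a quotient of $\mathbb{R}^3$ by a discrete, cocompact, torsion-free group of isometries, with the following fundamental groups (with $u^v$ denoting $vuv^{-1}$), which determine them up to homeomorphism: $\pi_1(\mathcal{G}_1)=\mathbb{Z}^3$ (the 3-torus); $\pi_1(\mathcal{G}_2)=\langle x,y,z : xyx^{-1}y^{-1}=1,\ x^z=x^{-1},\ y^z=y^{-1}\rangle$; $\pi_1(\mathcal{G}_6)=\langle x,y,z : xy^2x^{-1}y^2=yx^2y^{-1}x^2=xyz=1\rangle$. Concretely, the Hantzsche–Wendt manifold is $\mathcal{G}_6=\mathbb{R}^3/\langle S_1,S_2,S_3\rangle$ with $S_1(x,y,z)=(x+1,-y,-z+1)$, $S_2(x,y,z)=(-x+1,y+1,-z)$, $S_3(x,y,z)=(-x,-y+1,z+1)$. Two coverings $p_1:\mathcal{M}_1\to\mathcal{M}$ and $p_2:\mathcal{M}_2\to\mathcal{M}$ are equivalent if there is a homeomorphism $h:\mathcal{M}_1\to\mathcal{M}_2$ with $p_1=p_2\circ h$. $c_{\mathcal{G}_i,\mathcal{G}_6}(n)$ denotes the number of equivalence classes of $n$-fold (connected) coverings $\mathcal{N}\to\mathcal{G}_6$ with $\pi_1(\mathcal{N})\cong\pi_1(\mathcal{G}_i)$; equivalently, the number of conjugacy classes of subgroups of index $n$ in $\pi_1(\mathcal{G}_6)$ isomorphic to $\pi_1(\mathcal{G}_i)$. Number-theoretic functions: for a positive integer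 $n$, $\omega(n)=\sum_{abc=n}a^2b$, $\sigma_2(n)=\sum_{abc=n}a$, and $d_3(n)=\sum_{abc=n}1$, the sums being over all ordered triples of positive integers $(a,b,c)$ with $abc=n$. (Note that $\sigma_2$ is not the sum of squares of divisors.) By convention these functions take the value $0$ when the argument is not an integer. *)

theory Defs
  imports "HOL-Analysis.Analysis" "HOL-Algebra.Bij" "HOL-Algebra.Generated_Groups"
begin

section \<open>Coverings and their equivalence\<close>

text \<open>The analogue, for abstract topologies, of \<^const>\<open>covering_space\<close>.\<close>

definition covering_map :: "'a topology \<Rightarrow> 'b topology \<Rightarrow> ('a \<Rightarrow> 'b) \<Rightarrow> bool" where
  "covering_map N M p \<longleftrightarrow>
     continuous_map N M p \<and> p ` topspace N = topspace M \<and>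
     (\<forall>y \<in> topspace M. \<exists>U. y \<in> U \<and> openin M U \<and>
        (\<exists>\<V>. \<Union>\<V> = {x \<in> topspace N. p x \<in> U} \<and>
             (\<forall>V\<in>\<V>. openin N V) \<and>
             pairwise disjnt \<V> \<and>
             (\<forall>V\<in>\<V>. homeomorphic_map (subtopology N V) (subtopology M U) p)))"

text \<open>Since \<^const>\<open>card\<close> is 0 on infinite sets, this notion is meant for positive \<open>n\<close>.\<close>

definition fold_covering :: "nat \<Rightarrow> 'a topology \<Rightarrow> 'b topology \<Rightarrow> ('a \<Rightarrow> 'b) \<Rightarrow> bool" where
  "fold_covering n N M p \<longleftrightarrow>
     covering_map N M p \<and> (\<forall>y \<in> topspace M. card {x \<in> topspace N. p x = y} = n)"

definition equivalent_coverings ::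
    "'a topology \<times> ('a \<Rightarrow> 'b) \<Rightarrow> 'c topology \<times> ('c \<Rightarrow> 'b) \<Rightarrow> bool" where
  "equivalent_coverings = (\<lambda>(N1, p1) (N2, p2).
     \<exists>h. homeomorphic_map N1 N2 h \<and> (\<forall>x \<in> topspace N1. p1 x = p2 (h x)))"


section \<open>The fundamental group\<close>

text \<open>Loops are functions on \<^typ>\<open>real\<close> of which only the restriction to \<open>[0,1]\<close> matters:
  functions agreeing on \<open>[0,1]\<close> are homotopic in the sense below.\<close>

definition loop_at :: "'a topology \<Rightarrow> 'a \<Rightarrow> (real \<Rightarrow> 'a) \<Rightarrow> bool" where
  "loop_at X a g \<longleftrightarrow> pathin X g \<and> g 0 = a \<and> g 1 = a"

definition loop_class :: "'a topology \<Rightarrow> 'a \<Rightarrow> (real \<Rightarrow> 'a) \<Rightarrow> (real \<Rightarrow> 'a) set" where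
  "loop_class X a g = {h. homotopic_with (\<lambda>r. r 0 = a \<and> r 1 = a) (top_of_set {0..1}) X g h}"

text \<open>As \<^const>\<open>joinpaths\<close>, but without a topology on the type \<^typ>\<open>'a\<close>.\<close>

definition loop_join :: "(real \<Rightarrow> 'a) \<Rightarrow> (real \<Rightarrow> 'a) \<Rightarrow> real \<Rightarrow> 'a" where
  "loop_join g h = (\<lambda>t. if t \<le> 1/2 then g (2 * t) else h (2 * t - 1))"

definition fundamental_group :: "'a topology \<Rightarrow> 'a \<Rightarrow> (real \<Rightarrow> 'a) set monoid" where
  "fundamental_group X a =
     \<lparr>carrier = {loop_class X a g | g. loop_at X a g},
      monoid.mult = (\<lambda>A B. \<Union>g\<in>A. \<Union>h\<in>B. loop_class X a (loop_join g h)),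
      one = loop_class X a (\<lambda>_. a)\<rparr>"

text \<open>For path-connected spaces the choice of the base points is irrelevant.\<close>

definition isomorphic_fundamental_groups :: "'a topology \<Rightarrow> 'b topology \<Rightarrow> bool" where
  "isomorphic_fundamental_groups X Y \<longleftrightarrow>
     (\<exists>a \<in> topspace X. \<exists>b \<in> topspace Y. fundamental_group X a \<cong> fundamental_group Y b)"


section \<open>Counting coverings\<close>

text \<open>
  Connected \<open>n\<close>-fold coverings of \<open>M\<close> whose total space has the fundamental group of \<open>G\<close>,
  up to equivalence. HOL has no type of all topological spaces; the total spaces considered here
  are those whose points belong to a given type \<^typ>\<open>'a\<close>. A connected finite covering of a
  manifold of positive dimension has the cardinality of the continuum, so that any type into which
  the reals can be injected carries a copy of every such covering.
\<close>

definition coverings_of_type ::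
    "'a itself \<Rightarrow> 'c topology \<Rightarrow> 'b topology \<Rightarrow> nat \<Rightarrow> ('a topology \<times> ('a \<Rightarrow> 'b)) set" where
  "coverings_of_type _ G M n =
     {(N, p). connected_space N \<and> fold_covering n N M p \<and> isomorphic_fundamental_groups N G}"

definition covering_classes ::
    "'a itself \<Rightarrow> 'c topology \<Rightarrow> 'b topology \<Rightarrow> nat \<Rightarrow> ('a topology \<times> ('a \<Rightarrow> 'b)) set set" where
  "covering_classes T G M n =
     coverings_of_type T G M n //
       {(P, Q). P \<in> coverings_of_type T G M n \<and> Q \<in> coverings_of_type T G M n \<and>
                equivalent_coverings P Q}"


section \<open>The flat manifolds\<close>

definition orbit_of :: "('a \<Rightarrow> 'a) set \<Rightarrow> 'a \<Rightarrow> 'a set" where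
  "orbit_of \<Gamma> x = (\<lambda>g. g x) ` \<Gamma>"

definition orbit_space :: "('a::topological_space \<Rightarrow> 'a) set \<Rightarrow> 'a set topology" where
  "orbit_space \<Gamma> = topology (\<lambda>U. U \<subseteq> range (orbit_of \<Gamma>) \<and> open {x. orbit_of \<Gamma> x \<in> U})"

lemma openin_orbit_space:
  "openin (orbit_space \<Gamma>) U \<longleftrightarrow> U \<subseteq> range (orbit_of \<Gamma>) \<and> open {x. orbit_of \<Gamma> x \<in> U}"
proof -
  have "istopology (\<lambda>U. U \<subseteq> range (orbit_of \<Gamma>) \<and> open {x. orbit_of \<Gamma> x \<in> U})"
    unfolding istopology_def
  proof (intro conjI allI impI)
    fix S T
    assume "S \<subseteq> range (orbit_of \<Gamma>) \<and> open {x. orbit_of \<Gamma> x \<in> S}"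
      and "T \<subseteq> range (orbit_of \<Gamma>) \<and> open {x. orbit_of \<Gamma> x \<in> T}"
    then show "S \<inter> T \<subseteq> range (orbit_of \<Gamma>)" "open {x. orbit_of \<Gamma> x \<in> S \<inter> T}"
      by (auto simp: open_Collect_conj)
  next
    fix \<K>
    assume *: "\<forall>K\<in>\<K>. K \<subseteq> range (orbit_of \<Gamma>) \<and> open {x. orbit_of \<Gamma> x \<in> K}"
    then show "\<Union>\<K> \<subseteq> range (orbit_of \<Gamma>)" by blast
    have "{x. orbit_of \<Gamma> x \<in> \<Union>\<K>} = (\<Union>K\<in>\<K>. {x. orbit_of \<Gamma> x \<in> K})" by blast
    with * show "open {x. orbit_of \<Gamma> x \<in> \<Union>\<K>}" by (simp add: open_UN)
  qed
  then show ?thesis by (simp add: orbit_space_def)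
qed

lemma topspace_orbit_space: "topspace (orbit_space \<Gamma>) = range (orbit_of \<Gamma>)"
proof
  show "topspace (orbit_space \<Gamma>) \<subseteq> range (orbit_of \<Gamma>)"
    using openin_topspace[of "orbit_space \<Gamma>"] unfolding openin_orbit_space by blast
  show "range (orbit_of \<Gamma>) \<subseteq> topspace (orbit_space \<Gamma>)"
    by (rule openin_subset) (simp add: openin_orbit_space)
qed

lemma quotient_map_orbit_of: "quotient_map euclidean (orbit_space \<Gamma>) (orbit_of \<Gamma>)"
  by (auto simp: quotient_map_def topspace_orbit_space openin_orbit_space)

definition transformation_group :: "('a \<Rightarrow> 'a) set \<Rightarrow> ('a \<Rightarrow> 'a) set" where
  "transformation_group S = generate (BijGroup UNIV) S"

definition G1 :: "(real^3) set topology" where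
  "G1 = orbit_space (transformation_group
     {\<lambda>v. vector [v$1 + 1, v$2, v$3],
      \<lambda>v. vector [v$1, v$2 + 1, v$3],
      \<lambda>v. vector [v$1, v$2, v$3 + 1]})"

text \<open>
  With \<open>x\<close>, \<open>y\<close>, \<open>z\<close> the three generators below (two translations and a half-turn screw motion),
  \<open>x y = y x\<close>, \<open>z x z\<inverse> = x\<inverse>\<close> and \<open>z y z\<inverse> = y\<inverse>\<close>. These relations suffice to write each
  element as \<open>x\<^sup>a y\<^sup>b z\<^sup>c\<close>, and the motions \<open>x\<^sup>a y\<^sup>b z\<^sup>c\<close> are pairwise distinct, so that this is a
  presentation of the group.
\<close>

definition G2 :: "(real^3) set topology" where
  "G2 = orbit_space (transformation_group
     {\<lambda>v. vector [v$1 + 1, v$2, v$3],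
      \<lambda>v. vector [v$1, v$2 + 1, v$3],
      \<lambda>v. vector [- (v$1), - (v$2), v$3 + 1]})"

text \<open>The Hantzsche--Wendt manifold.\<close>

definition G6 :: "(real^3) set topology" where
  "G6 = orbit_space (transformation_group
     {\<lambda>v. vector [v$1 + 1, - (v$2), - (v$3) + 1],
      \<lambda>v. vector [- (v$1) + 1, v$2 + 1, - (v$3)],
      \<lambda>v. vector [- (v$1), - (v$2) + 1, v$3 + 1]})"


section \<open>Arithmetic functions\<close>

text \<open>The argument is real, and there are no triples unless it is a positive integer;
  this yields the convention that the functions vanish at non-integers.\<close>

definition factor_triples :: "real \<Rightarrow> (nat \<times> nat \<times> nat) set" where
  "factor_triples x = {(a, b, c). 0 < a \<and> 0 < b \<and> 0 < c \<and> real (a * b * c) = x}"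

definition omega :: "real \<Rightarrow> real" where
  "omega x = (\<Sum>(a, b, c)\<in>factor_triples x. real (a\<^sup>2 * b))"

text \<open>Not the sum of the squares of the divisors.\<close>

definition sigma2 :: "real \<Rightarrow> real" where
  "sigma2 x = (\<Sum>(a, b, c)\<in>factor_triples x. real a)"

definition d3 :: "real \<Rightarrow> real" where
  "d3 x = (\<Sum>(a, b, c)\<in>factor_triples x. 1)"

end

theory Submission
  imports Defs
begin

text \<open>
  A motion of the Hantzsche--Wendt group is determined by its translational part
  \<open>(a, b, c) \<in> \<int>\<^sup>3\<close>: the coordinate sum is even, and the signs of the linear part are given by the
  parities of \<open>b, c, a\<close>. Lifting the projection \<open>\<real>\<^sup>3 \<rightarrow> G\<^sub>6\<close> through a connected finite covering shows
  that the covering is the orbit space of a subgroup of finite index, unique up to conjugation, so it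
  remains to count conjugacy classes of subgroups. The even part of a subgroup is a lattice, which has
  a Hermite normal form. A subgroup without screw motions is a lattice, and conjugation acts on
  lattices by sign changes; Burnside's lemma gives the first formula. If the subgroup contains a screw
  motion about one axis, its lattice is an orthogonal sum of an odd multiple of the axis and a plane
  lattice; what remains is a class modulo that plane lattice and modulo 2, and conjugation acts on such
  pairs by an involution. If there are screw motions about all axes, the subgroup is conjugate to the
  image of the whole group under a diagonal matrix with odd entries. The three kinds of subgroups are
  distinguished by commutativity and by their centres.
\<close>

section \<open>Lifting through coverings\<close>

text \<open>The arguments of the arithmetic functions come from the index. The translations form
  \<open>evens\<close>, a copy of Z^3 scaled by two, of index four in the group. A lattice in it
  with diagonal \<open>a\<close>, \<open>b\<close>, \<open>c\<close> has index
  \<open>4 * a * b * c\<close>, and each doubling of the group of linear parts halves this: hence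
  \<open>n/4\<close> without screw motions, \<open>n/2\<close> with one axis and \<open>n\<close>
  with all three. Further halvings come only from parity conditions on the factors, and removing
  these conditions by inclusion and exclusion produces the alternating coefficients. In the second
  formula the terms in \<open>sigma2\<close> count parameters and those in \<open>d3\<close> count
  the fixed points of the involution; the factor 3 counts the axes, which the automorphism
  \<open>cyc\<close> permutes. On the topological side the total space has points in an arbitrary
  type and no structure beyond the covering, so no concrete quotient can be named inside it. The
  relation \<open>presents\<close> therefore records only a quotient map from Euclidean space and
  its fibres, and every comparison of spaces becomes a comparison of such maps.\<close>

lemma covering_map_unique_lift:
  assumes cov: "covering_map N M p" and X: "connected_space X"
    and f: "continuous_map X N f" and g: "continuous_map X N g"
    and eq: "\<And>x. x \<in> topspace X \<Longrightarrow> p (f x) = p (g x)"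
    and a: "a \<in> topspace X" "f a = g a" and x: "x \<in> topspace X"
  shows "f x = g x"
proof -
  have fN: "f y \<in> topspace N" and gN: "g y \<in> topspace N" if "y \<in> topspace X" for y
    using f g that by (auto simp: continuous_map_def)
  \<comment> \<open>Near \<open>y\<close> each lift stays in one sheet. If the two sheets coincide,
    injectivity of \<open>p\<close> forces agreement throughout; if they differ, disjointness
    excludes it. So agreement is locally constant.\<close>
  have sheets: "\<exists>W. openin X W \<and> y \<in> W \<and> (\<forall>w\<in>W. f w = g w \<longleftrightarrow> f y = g y)"
    if y: "y \<in> topspace X" for y
  proof -
    have "p (f y) \<in> topspace M"
      using cov fN[OF y] by (auto simp: covering_map_def)
    then obtain U \<V> where U: "p (f y) \<in> U"
      and V: "\<Union>\<V> = {x \<in> topspace N. p x \<in> U}" "\<And>V. V \<in> \<V> \<Longrightarrow> openin N V" "pairwise disjnt \<V>"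
      and hom: "\<And>V. V \<in> \<V> \<Longrightarrow> homeomorphic_map (subtopology N V) (subtopology M U) p"
      using cov unfolding covering_map_def by meson
    obtain V1 V2 where V12: "V1 \<in> \<V>" "f y \<in> V1" "V2 \<in> \<V>" "g y \<in> V2"
      using V(1) U eq[OF y] fN[OF y] gN[OF y] by (metis (mono_tags, lifting) UnionE mem_Collect_eq)
    define W where "W = {w \<in> topspace X. f w \<in> V1} \<inter> {w \<in> topspace X. g w \<in> V2}"
    have inj: "inj_on p V" if "V \<in> \<V>" for V
      using hom[OF that] openin_subset[OF V(2)[OF that]]
      by (simp add: homeomorphic_eq_everything_map inf.absorb2)
    have "openin X W"
      unfolding W_def using openin_continuous_map_preimage f g V(2) V12 by blast
    moreover have "y \<in> W" using V12 y by (simp add: W_def)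
    moreover have "f w = g w \<longleftrightarrow> f y = g y" if "w \<in> W" for w
    proof (cases "V1 = V2")
      case True
      then show ?thesis
        using inj[OF V12(1)] V12 that eq y unfolding W_def inj_on_def by blast
    next
      case False
      then have "V1 \<inter> V2 = {}"
        using V(3) V12 by (auto simp: pairwise_def disjnt_def)
      then show ?thesis using V12 that unfolding W_def by auto
    qed
    ultimately show ?thesis by blast
  qed
  define A where "A = {y \<in> topspace X. f y = g y}"
  define B where "B = {y \<in> topspace X. f y \<noteq> g y}"
  have "openin X A"
    unfolding openin_subopen[of X A]
  proof
    fix y assume "y \<in> A"
    then obtain W where "openin X W" "y \<in> W" "\<forall>w\<in>W. f w = g w"
      using sheets[of y] by (auto simp: A_def)
    then show "\<exists>T. openin X T \<and> y \<in> T \<and> T \<subseteq> A"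
      using openin_subset[of X W] by (auto simp: A_def)
  qed
  moreover have "openin X B"
    unfolding openin_subopen[of X B]
  proof
    fix y assume "y \<in> B"
    then obtain W where "openin X W" "y \<in> W" "\<forall>w\<in>W. f w \<noteq> g w"
      using sheets[of y] by (auto simp: B_def)
    then show "\<exists>T. openin X T \<and> y \<in> T \<and> T \<subseteq> B"
      using openin_subset[of X W] by (auto simp: B_def)
  qed
  moreover have "topspace X \<subseteq> A \<union> B" "A \<inter> B = {}" "A \<noteq> {}"
    using a by (auto simp: A_def B_def)
  ultimately have "B = {}"
    using X unfolding connected_space_def by blast
  then show ?thesis using x by (auto simp: B_def)
qed

text \<open>Slices of thickness \<open>\<epsilon>\<close> are cut off one at a time. The rule is
  tailored to lifting: \<open>cut\<close> also supplies a point of the common face, so that a lift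
  over one part can be continued across the face to the other.\<close>

lemma cbox_induct [consumes 1, case_names nonempty small cut]:
  fixes a b :: "'a::euclidean_space"
  assumes "0 < \<epsilon>" and ne: "cbox a b \<noteq> {}"
    and small: "\<And>c d. cbox c d \<subseteq> cbox a b \<Longrightarrow> (\<And>i. i \<in> Basis \<Longrightarrow> d \<bullet> i - c \<bullet> i \<le> \<epsilon>) \<Longrightarrow> Q (cbox c d)"
    and cut: "\<And>c d i t. i \<in> Basis \<Longrightarrow> cbox c d \<subseteq> cbox a b \<Longrightarrow>
      cbox c d \<inter> {x. x \<bullet> i = t} \<noteq> {} \<Longrightarrow>
      Q (cbox c d \<inter> {x. x \<bullet> i \<le> t}) \<Longrightarrow> Q (cbox c d \<inter> {x. x \<bullet> i \<ge> t}) \<Longrightarrow> Q (cbox c d)"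
  shows "Q (cbox a b)"
proof -
  \<comment> \<open>The number of slices of thickness \<open>\<epsilon>\<close>, summed over the
    axes. A cut at distance exactly \<open>\<epsilon>\<close> leaves one part with a single slice in
    direction \<open>i\<close> and takes one slice away from the other, so the measure drops for
    both.\<close>
  define m where "m c d = (\<Sum>i\<in>Basis. nat \<lceil>(d \<bullet> i - c \<bullet> i) / \<epsilon>\<rceil>)" for c d :: 'a
  have "Q (cbox c d)" if "cbox c d \<subseteq> cbox a b" "\<And>i. i \<in> Basis \<Longrightarrow> c \<bullet> i \<le> d \<bullet> i" for c d
    using that
  proof (induction "m c d" arbitrary: c d rule: less_induct)
    case less
    show ?case
    proof (cases "\<forall>i\<in>Basis. d \<bullet> i - c \<bullet> i \<le> \<epsilon>")
      case True
      then show ?thesis using small less.prems by blast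
    next
      case False
      then obtain i where i: "i \<in> Basis" "d \<bullet> i - c \<bullet> i > \<epsilon>" by force
      define t where "t = c \<bullet> i + \<epsilon>"
      define d' where "d' = (\<Sum>j\<in>Basis. (if j = i then min (d \<bullet> i) t else d \<bullet> j) *\<^sub>R j)"
      define c' where "c' = (\<Sum>j\<in>Basis. (if j = i then max (c \<bullet> i) t else c \<bullet> j) *\<^sub>R j)"
      have split: "cbox c d \<inter> {x. x \<bullet> i \<le> t} = cbox c d'" "cbox c d \<inter> {x. x \<bullet> i \<ge> t} = cbox c' d"
        unfolding d'_def c'_def using interval_split[OF i(1)] by blast+
      have d': "d' \<bullet> j = (if j = i then t else d \<bullet> j)" if "j \<in> Basis" for j
        using that i \<open>0 < \<epsilon>\<close> by (auto simp: d'_def t_def)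
      have c': "c' \<bullet> j = (if j = i then t else c \<bullet> j)" if "j \<in> Basis" for j
        using that i \<open>0 < \<epsilon>\<close> by (auto simp: c'_def t_def)
      have gt1: "(d \<bullet> i - c \<bullet> i) / \<epsilon> > 1" using i \<open>0 < \<epsilon>\<close> by simp
      have "(d \<bullet> i - t) / \<epsilon> = (d \<bullet> i - c \<bullet> i) / \<epsilon> - 1"
        using \<open>0 < \<epsilon>\<close> by (simp add: t_def field_simps)
      then have 1: "nat \<lceil>(d \<bullet> i - t) / \<epsilon>\<rceil> < nat \<lceil>(d \<bullet> i - c \<bullet> i) / \<epsilon>\<rceil>" using gt1 by linarith
      have "(t - c \<bullet> i) / \<epsilon> = 1" using \<open>0 < \<epsilon>\<close> by (simp add: t_def)
      then have 2: "nat \<lceil>(t - c \<bullet> i) / \<epsilon>\<rceil> < nat \<lceil>(d \<bullet> i - c \<bullet> i) / \<epsilon>\<rceil>"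
        using gt1 by (simp add: nat_less_iff less_ceiling_iff zless_nat_eq_int_zless)
      have "m c d' < m c d"
        unfolding m_def
        by (rule sum_strict_mono_ex1; use 2 i(1) d' less_imp_le in \<open>fastforce simp del: nat_ceiling_le_eq zless_nat_conj zero_less_ceiling\<close>)
      moreover have "m c' d < m c d"
        unfolding m_def
        by (rule sum_strict_mono_ex1; use 1 i(1) c' less_imp_le in \<open>fastforce simp del: nat_ceiling_le_eq zless_nat_conj zero_less_ceiling\<close>)
      moreover have "cbox c d' \<subseteq> cbox a b" "cbox c' d \<subseteq> cbox a b"
        using split less.prems(1) by blast+
      moreover have "c \<bullet> j \<le> d' \<bullet> j" "c' \<bullet> j \<le> d \<bullet> j" if "j \<in> Basis" for j
        using that less.prems(2)[OF that] c' d' i \<open>0 < \<epsilon>\<close> by (auto simp: t_def)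
      ultimately have "Q (cbox c d')" "Q (cbox c' d)"
        using less.hyps by blast+
      moreover have "d' \<in> cbox c d \<inter> {x. x \<bullet> i = t}"
        using d' less.prems(2) i \<open>0 < \<epsilon>\<close> by (auto simp: mem_box t_def)
      ultimately show ?thesis
        using cut[OF i(1) less.prems(1)] split by (metis empty_iff)
    qed
  qed
  then show ?thesis using ne by (simp add: box_ne_empty)
qed

text \<open>By compactness the box splits into pieces that map into evenly covered sets; over such a
  piece the inverse of \<open>p\<close> on a sheet, composed with \<open>f\<close>, is a lift.
  Neighbouring pieces are glued along their common face, which is convex and therefore connected:
  two lifts that agree at one point of it agree on all of it.\<close>

lemma covering_map_lift_cbox:
  fixes f :: "'e::euclidean_space \<Rightarrow> 'b"
  assumes cov: "covering_map N M p" and f: "continuous_map (top_of_set (cbox a b)) M f"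
    and "x \<in> cbox a b" "z \<in> topspace N" "p z = f x"
  obtains g where "continuous_map (top_of_set (cbox a b)) N g"
    "\<And>y. y \<in> cbox a b \<Longrightarrow> p (g y) = f y" "g x = z"
proof -
  define even where "even U \<longleftrightarrow> openin M U \<and>
        (\<exists>\<V>. \<Union>\<V> = {x \<in> topspace N. p x \<in> U} \<and>
             (\<forall>V\<in>\<V>. openin N V) \<and>
             (\<forall>V\<in>\<V>. homeomorphic_map (subtopology N V) (subtopology M U) p))" for U
  define \<C> where "\<C> = {B. open B \<and> (\<exists>U. even U \<and> f ` (B \<inter> cbox a b) \<subseteq> U)}"
  have \<C>: "\<exists>B\<in>\<C>. y \<in> B" if y: "y \<in> cbox a b" for y
  proof -
    have "f y \<in> topspace M" using f y by (auto simp: continuous_map_def)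
    then obtain U where U: "f y \<in> U" "even U"
      using cov unfolding covering_map_def even_def by meson
    then have "openin (top_of_set (cbox a b)) {w \<in> cbox a b. f w \<in> U}"
      using openin_continuous_map_preimage[OF f] by (simp add: even_def)
    then obtain B where "open B" "{w \<in> cbox a b. f w \<in> U} = cbox a b \<inter> B"
      by (meson openin_open)
    then have "B \<in> \<C>" "y \<in> B" using U y unfolding \<C>_def by blast+
    then show ?thesis by blast
  qed
  obtain \<delta> where "0 < \<delta>" and \<delta>: "\<And>T. \<lbrakk>T \<subseteq> cbox a b; diameter T < \<delta>\<rbrakk> \<Longrightarrow> \<exists>B \<in> \<C>. T \<subseteq> B"
  proof (rule Lebesgue_number_lemma[of "cbox a b" \<C>])
    show "\<C> \<noteq> {}" "cbox a b \<subseteq> \<Union>\<C>"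
      using \<open>x \<in> cbox a b\<close> \<C> by blast+
  qed (auto simp: \<C>_def)
  \<comment> \<open>The starting point is arbitrary: once one half of a box is lifted, the other
    half has to be lifted from a point of the common face, with the value already reached
    there.\<close>
  define liftable where "liftable S \<longleftrightarrow> (\<forall>x\<in>S. \<forall>z\<in>topspace N. p z = f x \<longrightarrow>
     (\<exists>g. continuous_map (top_of_set S) N g \<and> (\<forall>y\<in>S. p (g y) = f y) \<and> g x = z))" for S
  \<comment> \<open>The diameter of a box is at most the sum of its \<open>DIM('e)\<close> edges, so
    edges of this length keep it within half of the Lebesgue number.\<close>
  have "0 < \<delta> / (2 * DIM('e))" using \<open>0 < \<delta>\<close> by simp
  then have "liftable (cbox a b)"
  proof (induction rule: cbox_induct)
    case nonempty
    then show ?case using \<open>x \<in> cbox a b\<close> by blast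
  next
    case (small c d)
    show ?case
    proof (cases "cbox c d = {}")
      case True
      then show ?thesis by (simp add: liftable_def)
    next
      case False
      have "diameter (cbox c d) \<le> norm (d - c)"
        using False by (simp add: diameter_cbox box_ne_empty dist_norm norm_minus_commute)
      also have "\<dots> \<le> (\<Sum>i\<in>Basis. \<bar>(d - c) \<bullet> i\<bar>)" by (rule norm_le_l1)
      also have "\<dots> \<le> (\<Sum>i\<in>(Basis::'e set). \<delta> / (2 * DIM('e)))"
        by (rule sum_mono) (use small False in \<open>auto simp: box_ne_empty inner_diff_left\<close>)
      also have "\<dots> < \<delta>" using \<open>0 < \<delta>\<close> by simp
      finally obtain B where "B \<in> \<C>" "cbox c d \<subseteq> B" using \<delta> small by blast
      then obtain U where "even U" and fU: "f ` cbox c d \<subseteq> U"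
        using small unfolding \<C>_def by blast
      then obtain \<V> where V: "\<Union>\<V> = {x \<in> topspace N. p x \<in> U}" "\<And>V. V \<in> \<V> \<Longrightarrow> openin N V"
        and hom: "\<And>V. V \<in> \<V> \<Longrightarrow> homeomorphic_map (subtopology N V) (subtopology M U) p"
        and U: "openin M U"
        using that unfolding even_def by (elim conjE exE) metis
      show ?thesis unfolding liftable_def
      proof (intro ballI impI)
        fix x z assume x: "x \<in> cbox c d" and z: "z \<in> topspace N" "p z = f x"
        then obtain V where "V \<in> \<V>" "z \<in> V" using fU V(1) by blast
        then obtain q where q: "homeomorphic_maps (subtopology N V) (subtopology M U) p q"
          using hom homeomorphic_map_maps by blast
        have sub: "V \<subseteq> topspace N" "U \<subseteq> topspace M"
          using U V(2) \<open>V \<in> \<V>\<close> openin_subset by blast+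
        have "continuous_map (top_of_set (cbox c d)) (subtopology M U) f"
          using f small fU
          by (auto simp: continuous_map_in_subtopology continuous_map_from_subtopology_mono)
        then have "continuous_map (top_of_set (cbox c d)) N (q \<circ> f)"
          using q continuous_map_compose[of _ "subtopology M U" f "subtopology N V" q]
          by (simp add: continuous_map_in_subtopology homeomorphic_maps_def)
        moreover have "p ((q \<circ> f) y) = f y" if "y \<in> cbox c d" for y
          using q sub fU that unfolding homeomorphic_maps_def by (auto simp: image_subset_iff subset_iff)
        moreover have "(q \<circ> f) x = z"
          using q sub x z \<open>z \<in> V\<close> unfolding homeomorphic_maps_def by (metis IntI comp_apply topspace_subtopology)
        ultimately show "\<exists>g. continuous_map (top_of_set (cbox c d)) N g \<and>
            (\<forall>y\<in>cbox c d. p (g y) = f y) \<and> g x = z" by blast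
      qed
    qed
  next
    case (cut c d i t)
    let ?S = "cbox c d" let ?L = "cbox c d \<inter> {x. x \<bullet> i \<le> t}" let ?R = "cbox c d \<inter> {x. x \<bullet> i \<ge> t}"
    have glue: "\<exists>g. continuous_map (top_of_set ?S) N g \<and> (\<forall>y\<in>?S. p (g y) = f y) \<and>
        (\<forall>y\<in>?L. g y = gl y) \<and> (\<forall>y\<in>?R. g y = gr y)"
      if gl: "continuous_map (top_of_set ?L) N gl" "\<And>y. y \<in> ?L \<Longrightarrow> p (gl y) = f y"
        and gr: "continuous_map (top_of_set ?R) N gr" "\<And>y. y \<in> ?R \<Longrightarrow> p (gr y) = f y"
        and w: "w \<in> ?L \<inter> ?R" "gl w = gr w" for gl gr w
    proof -
      let ?I = "cbox c d \<inter> {x. x \<bullet> i = t}"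
      have conv: "connected_space (top_of_set ?I)"
        using convex_Int[OF convex_box(1) convex_hyperplane[of i t]]
        by (simp add: connected_space_subtopology convex_connected inner_commute)
      have agree: "gl y = gr y" if "y \<in> ?I" for y
      proof (rule covering_map_unique_lift[OF cov conv, of gl gr w])
        show "continuous_map (top_of_set ?I) N gl" "continuous_map (top_of_set ?I) N gr"
          using gl(1) gr(1) by (auto elim!: continuous_map_from_subtopology_mono)
      qed (use gl gr w that in auto)
      have "continuous_map (top_of_set ?S) N (\<lambda>y. if y \<bullet> i \<le> t then gl y else gr y)"
      proof (rule continuous_map_cases_le)
        have "{x \<in> ?S. x \<bullet> i \<le> t} = ?L" "{x \<in> ?S. t \<le> x \<bullet> i} = ?R" by auto
        then show "continuous_map (subtopology (top_of_set ?S) {x \<in> topspace (top_of_set ?S). x \<bullet> i \<le> t}) N gl"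
          "continuous_map (subtopology (top_of_set ?S) {x \<in> topspace (top_of_set ?S). t \<le> x \<bullet> i}) N gr"
          using gl(1) gr(1) by (simp_all add: subtopology_subtopology Int_absorb1 Int_absorb2)
      qed (use agree in \<open>auto intro!: continuous_intros\<close>)
      then show ?thesis
        using gl(2) gr(2) agree by (intro exI[of _ "\<lambda>y. if y \<bullet> i \<le> t then gl y else gr y"]) auto
    qed
    obtain w where w: "w \<in> ?L \<inter> ?R" using cut by auto
    show ?case unfolding liftable_def
    proof (intro ballI impI)
      fix x z assume x: "x \<in> ?S" and z: "z \<in> topspace N" "p z = f x"
      show "\<exists>g. continuous_map (top_of_set ?S) N g \<and> (\<forall>y\<in>?S. p (g y) = f y) \<and> g x = z"
      proof (cases "x \<bullet> i \<le> t")
        case True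
        then obtain gl where gl: "continuous_map (top_of_set ?L) N gl" "\<And>y. y \<in> ?L \<Longrightarrow> p (gl y) = f y"
            "gl x = z"
          using \<open>liftable ?L\<close> x z unfolding liftable_def by (metis Int_iff mem_Collect_eq)
        moreover have "gl w \<in> topspace N" using gl(1) w by (auto simp: continuous_map_def)
        ultimately obtain gr where gr: "continuous_map (top_of_set ?R) N gr" "\<And>y. y \<in> ?R \<Longrightarrow> p (gr y) = f y"
            "gr w = gl w"
          using \<open>liftable ?R\<close> w unfolding liftable_def by (metis Int_iff)
        show ?thesis using glue[OF gl(1,2) gr(1,2) w] gl(3) gr(3) True x by auto
      next
        case False
        then obtain gr where gr: "continuous_map (top_of_set ?R) N gr" "\<And>y. y \<in> ?R \<Longrightarrow> p (gr y) = f y"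
            "gr x = z"
          using \<open>liftable ?R\<close> x z unfolding liftable_def by (metis Int_iff mem_Collect_eq linear)
        moreover have "gr w \<in> topspace N" using gr(1) w by (auto simp: continuous_map_def)
        ultimately obtain gl where gl: "continuous_map (top_of_set ?L) N gl" "\<And>y. y \<in> ?L \<Longrightarrow> p (gl y) = f y"
            "gl w = gr w"
          using \<open>liftable ?L\<close> w unfolding liftable_def by (metis Int_iff)
        show ?thesis using glue[OF gl(1,2) gr(1,2) w] gl(3) gr(3) False x by auto
      qed
    qed
  qed
  then show ?thesis using that assms(3-5) unfolding liftable_def by blast
qed

text \<open>The space is exhausted by the cubes \<open>B n\<close> about \<open>x\<close>, and the
  lifts over them agree by uniqueness, all having the value \<open>z\<close> at \<open>x\<close>.
  The index \<open>k y\<close> places \<open>y\<close> in an open ball inside the cube, so that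
  continuity at \<open>y\<close> is tested on a neighbourhood where a single lift is used.\<close>

lemma covering_map_lift_euclidean:
  fixes f :: "'e::euclidean_space \<Rightarrow> 'b"
  assumes cov: "covering_map N M p" and f: "continuous_map euclidean M f"
    and z: "z \<in> topspace N" "p z = f x"
  obtains g where "continuous_map euclidean N g" "\<And>y. p (g y) = f y" "g x = z"
proof -
  define B where "B n = cbox (x - real n *\<^sub>R One) (x + real n *\<^sub>R One)" for n
  have xB: "x \<in> B n" for n by (auto simp: B_def mem_box algebra_simps)
  have "\<exists>g. continuous_map (top_of_set (B n)) N g \<and> (\<forall>y\<in>B n. p (g y) = f y) \<and> g x = z" for n
  proof -
    have "continuous_map (top_of_set (B n)) M f"
      using f continuous_map_from_subtopology by blast
    then obtain g where "continuous_map (top_of_set (B n)) N g" "\<And>y. y \<in> B n \<Longrightarrow> p (g y) = f y" "g x = z"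
      using covering_map_lift_cbox[OF cov, of _ _ f x z] xB z unfolding B_def by metis
    then show ?thesis by blast
  qed
  then obtain g where g: "\<And>n. continuous_map (top_of_set (B n)) N (g n)"
    "\<And>n y. y \<in> B n \<Longrightarrow> p (g n y) = f y" "\<And>n. g n x = z" by metis
  have agree: "g m y = g n y" if "y \<in> B m" "m \<le> n" for m n y
  proof (rule covering_map_unique_lift[OF cov, of "top_of_set (B m)" "g m" "g n" x])
    have "B m \<subseteq> B n"
      unfolding B_def using that(2) by (auto simp: subset_box algebra_simps)
    then show "continuous_map (top_of_set (B m)) N (g n)"
      "\<And>x. x \<in> topspace (top_of_set (B m)) \<Longrightarrow> p (g m x) = p (g n x)"
      using g continuous_map_from_subtopology_mono by (blast, auto)
  qed (use g xB that in \<open>auto simp: connected_space_subtopology convex_connected B_def\<close>)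
  have absorb: "ball x (real n) \<subseteq> B n" for n
  proof
    fix y assume y: "y \<in> ball x (real n)"
    have "\<bar>(y - x) \<bullet> i\<bar> \<le> real n" if "i \<in> Basis" for i
      using Basis_le_norm[OF that, of "y - x"] y by (simp add: dist_norm norm_minus_commute)
    then show "y \<in> B n" by (fastforce simp: B_def mem_box algebra_simps abs_le_iff)
  qed
  define k where "k y = nat \<lceil>dist x y\<rceil> + 1" for y
  define G where "G y = g (k y) y" for y
  have k: "y \<in> ball x (real (k y))" for y
    unfolding k_def by (simp add: of_nat_ceiling le_less_trans) linarith
  have G: "G y = g n y" if "y \<in> B n" for y n
    using agree[of y n "k y"] agree[of y "k y" n] that absorb k unfolding G_def
    by (metis linear subset_iff)
  have "continuous_map euclidean N G"
    unfolding continuous_map_def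
  proof (intro conjI allI impI)
    show "G \<in> topspace euclidean \<rightarrow> topspace N"
      using g(1) absorb k by (fastforce simp: G_def continuous_map_def)
    fix U assume U: "openin N U"
    show "openin euclidean {y \<in> topspace euclidean. G y \<in> U}"
      unfolding openin_subopen[of euclidean "Collect _"]
    proof
      fix y assume y: "y \<in> {y \<in> topspace euclidean. G y \<in> U}"
      let ?n = "k y"
      have "continuous_map (top_of_set (ball x (real ?n))) N (g ?n)"
        using g(1) absorb continuous_map_from_subtopology_mono by blast
      then have "openin (top_of_set (ball x (real ?n))) {w \<in> ball x (real ?n). g ?n w \<in> U}"
        using openin_continuous_map_preimage[OF _ U] by fastforce
      then have "open {w \<in> ball x (real ?n). g ?n w \<in> U}"
        by (simp add: openin_open_eq)
      moreover have "y \<in> {w \<in> ball x (real ?n). g ?n w \<in> U}"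
        using y k by (simp add: G_def)
      moreover have "{w \<in> ball x (real ?n). g ?n w \<in> U} \<subseteq> {y \<in> topspace euclidean. G y \<in> U}"
      proof
        fix w assume w: "w \<in> {w \<in> ball x (real ?n). g ?n w \<in> U}"
        then have "G w = g ?n w" using G absorb by blast
        then show "w \<in> {y \<in> topspace euclidean. G y \<in> U}" using w by simp
      qed
      ultimately show "\<exists>T. openin euclidean T \<and> y \<in> T \<and> T \<subseteq> {y \<in> topspace euclidean. G y \<in> U}"
        by (metis open_openin)
    qed
  qed
  moreover have "p (G y) = f y" for y
    unfolding G_def by (rule g(2)) (use absorb k in blast)
  moreover have "G x = z" using g(3) by (simp add: G_def)
  ultimately show ?thesis using that by blast
qed

section \<open>Coverings of orbit spaces\<close>

text \<open>Exhibits \<open>N\<close> as the orbit space of \<open>H\<close> without prescribing its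
  points: only the quotient topology and the fibres of \<open>f\<close> are recorded. One space can
  then be presented by several groups of motions, and identifying total spaces becomes a change of
  \<open>f\<close>.\<close>

definition presents :: "('g \<Rightarrow> 'e \<Rightarrow> 'e::euclidean_space) \<Rightarrow> 'g set \<Rightarrow> 'b topology \<Rightarrow> ('e \<Rightarrow> 'b) \<Rightarrow> bool" where
  "presents act H N f \<longleftrightarrow> quotient_map euclidean N f \<and> (\<forall>x y. f x = f y \<longleftrightarrow> (\<exists>h\<in>H. y = act h x))"

lemma presents_range: "presents act H N f \<Longrightarrow> range f = topspace N"
  using quotient_imp_surjective_map[of euclidean N f] by (simp add: presents_def)

lemma presents_in_topspace: "presents act H N f \<Longrightarrow> f x \<in> topspace N"
  using presents_range by blast

lemma presents_continuous: "presents act H N f \<Longrightarrow> continuous_map euclidean N f"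
  by (simp add: presents_def quotient_imp_continuous_map)

lemma presents_eq_iff: "presents act H N f \<Longrightarrow> f x = f y \<longleftrightarrow> (\<exists>h\<in>H. y = act h x)"
  by (simp add: presents_def)

lemma presents_openin_iff:
  "presents act H N f \<Longrightarrow> U \<subseteq> topspace N \<Longrightarrow> openin N U \<longleftrightarrow> open {x. f x \<in> U}"
  by (auto simp: presents_def quotient_map_def)

lemma presents_homeomorphic:
  assumes "presents act H N f" "homeomorphic_map N N' k"
  shows "presents act H N' (k \<circ> f)"
proof -
  have "quotient_map euclidean N' (k \<circ> f)"
    using assms quotient_map_compose[of euclidean N f N' k]
    by (simp add: presents_def homeomorphic_map_def)
  moreover have "k (f x) = k (f y) \<longleftrightarrow> f x = f y" for x y
    using assms presents_in_topspace[OF assms(1)] unfolding homeomorphic_map_def inj_on_def by metis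
  ultimately show ?thesis using assms(1) by (simp add: presents_def)
qed

lemma presents_change:
  assumes "presents act' H' N f" and \<phi>: "homeomorphic_map euclidean euclidean \<phi>"
    and "\<And>x y. (\<exists>h\<in>H. y = act h x) \<longleftrightarrow> (\<exists>h\<in>H'. \<phi> y = act' h (\<phi> x))"
  shows "presents act H N (f \<circ> \<phi>)"
  using assms quotient_map_compose[of euclidean euclidean \<phi> N f]
  by (simp add: presents_def homeomorphic_map_def)

text \<open>Each quotient map factors through the other, and the two factors are mutually inverse.
  This supplies the homeomorphisms between total spaces, both for the equivalence of coverings and
  for their homeomorphism types.\<close>

lemma presents_same_kernel:
  assumes f: "quotient_map euclidean N f" and f': "quotient_map euclidean N' f'"
    and eq: "\<And>x y. f x = f y \<longleftrightarrow> f' x = f' y"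
  obtains k where "homeomorphic_map N N' k" "\<And>x. k (f x) = f' x"
proof -
  obtain k where k: "continuous_map N N' k" "\<And>x. k (f x) = f' x"
    using quotient_map_lift_exists[OF f quotient_imp_continuous_map[OF f']] eq
    by (metis UNIV_I topspace_euclidean)
  obtain l where l: "continuous_map N' N l" "\<And>x. l (f' x) = f x"
    using quotient_map_lift_exists[OF f' quotient_imp_continuous_map[OF f]] eq
    by (metis UNIV_I topspace_euclidean)
  have "homeomorphic_maps N N' k l"
    using k l quotient_imp_surjective_map[OF f, symmetric] quotient_imp_surjective_map[OF f', symmetric]
    by (simp add: homeomorphic_maps_def)
  then show ?thesis using that k(2) homeomorphic_map_maps by blast
qed

lemma presents_unique:
  assumes "presents act H N f" "presents act H N' f'"
  shows "N homeomorphic_space N'"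
  using presents_same_kernel[of N f N' f'] assms unfolding presents_def
  by (metis homeomorphic_map_imp_homeomorphic_space)

lemma presents_orbit_space:
  assumes G: "group G" and act: "\<And>g h. g \<in> carrier G \<Longrightarrow> h \<in> carrier G \<Longrightarrow> act (g \<otimes>\<^bsub>G\<^esub> h) = act g \<circ> act h"
    "act \<one>\<^bsub>G\<^esub> = id" and \<Gamma>: "\<Gamma> = act ` carrier G"
  shows "presents act (carrier G) (orbit_space \<Gamma>) (orbit_of \<Gamma>)"
proof -
  interpret group G by (fact G)
  have inv: "act (inv\<^bsub>G\<^esub> g) (act g x) = x" if "g \<in> carrier G" for g x
    using act(1)[of "inv\<^bsub>G\<^esub> g" g] act(2) that by (simp add: fun_eq_iff)
  have "orbit_of \<Gamma> x = orbit_of \<Gamma> y \<longleftrightarrow> (\<exists>h\<in>carrier G. y = act h x)" for x y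
  proof
    assume "orbit_of \<Gamma> x = orbit_of \<Gamma> y"
    moreover have "y \<in> orbit_of \<Gamma> y"
      unfolding orbit_of_def \<Gamma> using act(2) by (metis (no_types, lifting) id_apply image_eqI one_closed)
    ultimately show "\<exists>h\<in>carrier G. y = act h x"
      unfolding orbit_of_def \<Gamma> by auto
  next
    have sub: "orbit_of \<Gamma> (act h x) \<subseteq> orbit_of \<Gamma> x" if "h \<in> carrier G" for h x
      unfolding orbit_of_def \<Gamma> using act(1)[OF _ that] that
      by (auto simp: image_iff) (metis comp_apply m_closed)
    assume "\<exists>h\<in>carrier G. y = act h x"
    then obtain h where h: "h \<in> carrier G" "y = act h x" by blast
    then have "x = act (inv\<^bsub>G\<^esub> h) y" using inv by simp
    then show "orbit_of \<Gamma> x = orbit_of \<Gamma> y" using h sub by (metis inv_closed subset_antisym)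
  qed
  then show ?thesis by (simp add: presents_def quotient_map_orbit_of)
qed

lemma quotient_topology_exists:
  fixes f :: "'e::topological_space \<Rightarrow> 'a"
  obtains N where "quotient_map euclidean N f"
proof -
  define T where "T = topology (\<lambda>U. U \<subseteq> range f \<and> open (f -` U))"
  have "istopology (\<lambda>U. U \<subseteq> range f \<and> open (f -` U))"
    unfolding istopology_def by (auto simp: vimage_Union)
  then have op: "openin T U \<longleftrightarrow> U \<subseteq> range f \<and> open (f -` U)" for U
    by (simp add: T_def)
  have "f -` range f = UNIV" by blast
  then have "openin T (range f)" by (simp add: op)
  then have "topspace T = range f"
    using openin_subset openin_topspace[of T] op by blast
  then show ?thesis using that[of T] by (auto simp: quotient_map_def op vimage_def)
qed

lemma connected_space_euclidean: "connected_space (euclidean :: 'e::real_normed_vector topology)"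
  by (metis connected_UNIV connectedin_iff_connected connectedin_topspace topspace_euclidean)

lemma card_image_same_kernel:
  assumes "\<And>x y. x \<in> A \<Longrightarrow> y \<in> A \<Longrightarrow> F x = F y \<longleftrightarrow> F' x = F' y"
  shows "card (F ` A) = card (F' ` A)"
proof (rule bij_betw_same_card)
  show "bij_betw (\<lambda>z. F' (inv_into A F z)) (F ` A) (F' ` A)"
    unfolding bij_betw_def inj_on_def
  proof (intro conjI ballI impI equalityI subsetI)
    fix z w assume "z \<in> F ` A" "w \<in> F ` A" "F' (inv_into A F z) = F' (inv_into A F w)"
    then show "z = w" using assms by (metis f_inv_into_f inv_into_into)
  next
    fix z assume "z \<in> (\<lambda>z. F' (inv_into A F z)) ` F ` A"
    then show "z \<in> F' ` A" by (auto intro: inv_into_into)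
  next
    fix z assume "z \<in> F' ` A"
    then obtain x where x: "x \<in> A" "z = F' x" by blast
    then have "F' (inv_into A F (F x)) = F' x"
      using assms by (metis f_inv_into_f image_eqI inv_into_into)
    then show "z \<in> (\<lambda>z. F' (inv_into A F z)) ` F ` A" using x by force
  qed
qed

text \<open>The classes of a possibly huge set \<open>Y\<close>, later a set of coverings, are
  counted on a finite set \<open>X\<close> of parameters whose images \<open>c x\<close> meet every
  class.\<close>

lemma card_quotient_eq:
  assumes E: "equiv Y F" and c: "\<And>x. x \<in> X \<Longrightarrow> c x \<in> Y"
    and surj: "\<And>y. y \<in> Y \<Longrightarrow> \<exists>x\<in>X. (y, c x) \<in> F"
    and X: "finite X"
  shows "finite (Y // F) \<and> card (Y // F) = card (X // {(x, x'). x \<in> X \<and> x' \<in> X \<and> (c x, c x') \<in> F})"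
proof -
  let ?E = "{(x, x'). x \<in> X \<and> x' \<in> X \<and> (c x, c x') \<in> F}"
  have eqX: "equiv X ?E"
  proof (rule equivI)
    show "refl_on X ?E" using c equiv_class_self[OF E] by (auto simp: refl_on_def)
    show "sym ?E" using E by (auto simp: equiv_def intro!: symI dest: symD)
    show "trans ?E" using E by (auto simp: equiv_def intro!: transI dest: transD)
  qed auto
  have Y: "Y // F = (\<lambda>x. F `` {c x}) ` X"
  proof
    show "Y // F \<subseteq> (\<lambda>x. F `` {c x}) ` X"
      using surj equiv_class_eq[OF E] by (auto simp: quotient_def image_iff) metis
    show "(\<lambda>x. F `` {c x}) ` X \<subseteq> Y // F"
      using c by (auto simp: quotient_def)
  qed
  have X': "X // ?E = (\<lambda>x. ?E `` {x}) ` X" by (auto simp: quotient_def)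
  have "card (Y // F) = card (X // ?E)" unfolding Y X'
  proof (rule card_image_same_kernel)
    fix x y assume xy: "x \<in> X" "y \<in> X"
    have "F `` {c x} = F `` {c y} \<longleftrightarrow> (c x, c y) \<in> F"
      using eq_equiv_class_iff[OF E] c xy by blast
    also have "\<dots> \<longleftrightarrow> (x, y) \<in> ?E" using xy by simp
    also have "\<dots> \<longleftrightarrow> ?E `` {x} = ?E `` {y}"
      using eq_equiv_class_iff[OF eqX] xy by blast
    finally show "F `` {c x} = F `` {c y} \<longleftrightarrow> ?E `` {x} = ?E `` {y}" .
  qed
  then show ?thesis using Y X by simp
qed

text \<open>The uniform bound on displacements expresses discreteness and freeness at once: a ball
  of radius 1/2 is moved off itself, which gives evenly covered neighbourhoods of a size independent
  of the point. The groups below satisfy it because each nontrivial motion translates along some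
  axis by a nonzero integer or is a translation.\<close>

locale isometric_action = group G for G (structure) +
  fixes act :: "'g \<Rightarrow> 'e::euclidean_space \<Rightarrow> 'e"
  assumes act_mult: "\<And>g h. g \<in> carrier G \<Longrightarrow> h \<in> carrier G \<Longrightarrow> act (g \<otimes> h) = act g \<circ> act h"
    and act_one: "act \<one> = id"
    and act_isometry: "\<And>g x y. g \<in> carrier G \<Longrightarrow> dist (act g x) (act g y) = dist x y"
    and act_displacement: "\<And>g x. g \<in> carrier G \<Longrightarrow> g \<noteq> \<one> \<Longrightarrow> 1 \<le> dist x (act g x)"
begin

lemma act_one_apply [simp]: "act \<one> x = x"
  by (simp add: act_one)

lemma act_mult_apply: "g \<in> carrier G \<Longrightarrow> h \<in> carrier G \<Longrightarrow> act (g \<otimes> h) x = act g (act h x)"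
  by (simp add: act_mult)

lemma act_inv_cancel [simp]:
  assumes "g \<in> carrier G" shows "act (inv g) (act g x) = x" "act g (act (inv g) x) = x"
  using assms by (simp_all flip: act_mult_apply)

lemma act_close: "g \<in> carrier G \<Longrightarrow> dist x (act g x) < 1 \<Longrightarrow> g = \<one>"
  using act_displacement[of g x] by linarith

lemma act_free: "g \<in> carrier G \<Longrightarrow> h \<in> carrier G \<Longrightarrow> act g x = act h x \<Longrightarrow> g = h"
  using act_close[of "inv g \<otimes> h" x] by (metis act_inv_cancel(1) act_mult_apply dist_self inv_closed
    inv_inv inv_equality l_inv m_closed r_one zero_less_one inv_solve_left' r_inv)

lemma continuous_on_act: "g \<in> carrier G \<Longrightarrow> continuous_on S (act g)"
  by (auto simp: continuous_on_iff act_isometry)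

lemma open_act_image:
  assumes "g \<in> carrier G" "open S"
  shows "open (act g ` S)"
proof -
  have "act g ` S = act (inv g) -` S"
    using assms by (force simp: image_iff)
  then show ?thesis
    using assms by (metis open_vimage continuous_on_act inv_closed)
qed

lemma presents_open:
  assumes "presents act H N f" "subgroup H G" "open S"
  shows "openin N (f ` S)"
proof -
  have "{x. f x \<in> f ` S} = (\<Union>h\<in>H. act h ` S)"
    using presents_eq_iff[OF assms(1)] by (auto simp: image_iff) metis+
  then have "open {x. f x \<in> f ` S}"
    using open_act_image[OF subgroup.mem_carrier[OF assms(2)] assms(3)] by auto
  moreover have "f ` S \<subseteq> topspace N"
    using presents_range[OF assms(1)] by blast
  ultimately show ?thesis
    by (simp add: presents_openin_iff[OF assms(1)])
qed

lemma presents_act: "presents act H N f \<Longrightarrow> h \<in> H \<Longrightarrow> f (act h x) = f x"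
  by (metis presents_eq_iff)

text \<open>Above the image of a ball \<open>B\<close> of radius 1/2 the sheets are the images of
  the translates of \<open>B\<close>. Translates by \<open>g\<close> and
  \<open>h \<otimes> g\<close> with \<open>h\<close> in \<open>H\<close> give the same sheet;
  conversely, overlapping sheets come from translates related in this way, because only the identity
  moves a point of \<open>B\<close> into \<open>B\<close>.\<close>

lemma presents_imp_covering_map:
  assumes f: "presents act H N f" and H: "subgroup H G" and q: "presents act (carrier G) M q"
    and p: "\<And>x. p (f x) = q x"
  shows "covering_map N M p"
proof -
  note fq = presents_eq_iff[OF f] presents_eq_iff[OF q]
  have pf: "p \<circ> f = q" using p by auto
  have contp: "continuous_map N M p"
    using presents_continuous[OF q] f continuous_compose_quotient_map
    unfolding presents_def pf[symmetric] by blast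
  have H': "h \<in> carrier G" if "h \<in> H" for h using H that subgroup.mem_carrier by metis
  show ?thesis
    unfolding covering_map_def
  proof (intro conjI ballI)
    show "continuous_map N M p" by (fact contp)
    show "p ` topspace N = topspace M"
      unfolding presents_range[OF f, symmetric] presents_range[OF q, symmetric] by (simp add: image_image p)
    fix y assume "y \<in> topspace M"
    then obtain b where b: "y = q b" using presents_range[OF q] by blast
    define B where "B = ball b (1/2)"
    have close: "g = \<one>" if "g \<in> carrier G" "u \<in> B" "act g u \<in> B" for g u
    proof (rule act_close)
      show "dist u (act g u) < 1"
        using that dist_triangle_half_r[of b u 1 "act g u"] by (simp add: B_def)
    qed (use that in simp)
    define \<V> where "\<V> = (\<lambda>g. f ` act g ` B) ` carrier G"
    have opB: "open (act g ` B)" if "g \<in> carrier G" for g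
      using open_act_image[OF that] by (simp add: B_def)
    have pV: "p ` f ` act g ` B = q ` B" if "g \<in> carrier G" for g
      using presents_act[OF q that] by (simp add: image_image p)
    have opV: "openin N V" if "V \<in> \<V>" for V
      using that presents_open[OF f H opB] by (auto simp: \<V>_def)
    have opU: "openin M (q ` B)"
      using presents_open[OF q subgroup_self] by (simp add: B_def)
    have union: "\<Union>\<V> = {x \<in> topspace N. p x \<in> q ` B}"
    proof
      show "\<Union>\<V> \<subseteq> {x \<in> topspace N. p x \<in> q ` B}"
        using presents_act[OF q] presents_in_topspace[OF f] by (auto simp: \<V>_def p)
      show "{x \<in> topspace N. p x \<in> q ` B} \<subseteq> \<Union>\<V>"
      proof
        fix z assume "z \<in> {x \<in> topspace N. p x \<in> q ` B}"
        then obtain w u where "z = f w" "q u = q w" "u \<in> B"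
          using presents_range[OF f] p by (auto simp: image_iff) (metis rangeE)
        then obtain g where "g \<in> carrier G" "w = act g u" using fq(2) by blast
        then show "z \<in> \<Union>\<V>" using \<open>z = f w\<close> \<open>u \<in> B\<close> by (auto simp: \<V>_def)
      qed
    qed
    have disj: "pairwise disjnt \<V>"
    proof (rule pairwiseI)
      fix V W assume "V \<in> \<V>" "W \<in> \<V>" "V \<noteq> W"
      then obtain g k where g: "g \<in> carrier G" "V = f ` act g ` B" and k: "k \<in> carrier G" "W = f ` act k ` B"
        by (auto simp: \<V>_def)
      have "V = W" if "z \<in> V" "z \<in> W" for z
      proof -
        obtain u v where uv: "u \<in> B" "v \<in> B" "f (act g u) = f (act k v)" using \<open>z \<in> V\<close> \<open>z \<in> W\<close> g k by blast
        then obtain h where h: "h \<in> H" "act k v = act h (act g u)" using fq(1) by blast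
        then have "act (inv k \<otimes> (h \<otimes> g)) u = v"
          using g k H' by (simp add: act_mult_apply) (metis act_inv_cancel(1))
        then have "inv k \<otimes> (h \<otimes> g) = \<one>"
          using close[of "inv k \<otimes> (h \<otimes> g)" u] uv g k h H' by simp
        then have "k = h \<otimes> g"
          using g k h H' by (metis inv_closed inv_equality inv_inv m_closed)
        then have "f (act k w) = f (act g w)" for w
          using h g H' by (simp add: act_mult_apply presents_act[OF f])
        then show ?thesis using g k by (auto simp: image_image)
      qed
      then show "disjnt V W" using \<open>V \<noteq> W\<close> by (auto simp: disjnt_def)
    qed
    have hom: "homeomorphic_map (subtopology N V) (subtopology M (q ` B)) p" if V: "V \<in> \<V>" for V
    proof (rule bijective_open_imp_homeomorphic_map)
      obtain g where g: "g \<in> carrier G" "V = f ` act g ` B" using V by (auto simp: \<V>_def)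
      have VN: "V \<subseteq> topspace N" and UM: "q ` B \<subseteq> topspace M"
        using openin_subset[OF opV[OF that]] openin_subset[OF opU] by auto
      show "continuous_map (subtopology N V) (subtopology M (q ` B)) p"
        using contp pV[OF g(1)] g(2) by (auto simp: continuous_map_in_subtopology continuous_map_from_subtopology)
      show "p ` topspace (subtopology N V) = topspace (subtopology M (q ` B))"
        using pV[OF g(1)] g(2) VN UM by (simp add: inf.absorb2)
      show "inj_on p (topspace (subtopology N V))"
      proof (rule inj_onI)
        fix z w assume "z \<in> topspace (subtopology N V)" "w \<in> topspace (subtopology N V)" and eq: "p z = p w"
        then obtain u v where uv: "u \<in> B" "v \<in> B" "z = f (act g u)" "w = f (act g v)" using g by auto
        then have "q u = q v" using eq presents_act[OF q g(1)] by (simp add: p)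
        then obtain k where k: "k \<in> carrier G" "v = act k u" using fq(2) by blast
        then have "k = \<one>" using close uv by simp
        then show "z = w" using uv k by simp
      qed
      show "open_map (subtopology N V) (subtopology M (q ` B)) p"
        unfolding open_map_def
      proof (intro allI impI)
        fix W assume "openin (subtopology N V) W"
        then have W: "openin N W" "W \<subseteq> V"
          using opV[OF that] openin_open_subtopology by blast+
        then have op: "open {x. f x \<in> W}"
          using presents_openin_iff[OF f] openin_subset by blast
        have "p ` W = q ` {x. f x \<in> W}"
          using openin_subset[OF W(1)] unfolding presents_range[OF f, symmetric]
          by (force simp: image_iff simp flip: p)
        then have "openin M (p ` W)" using presents_open[OF q subgroup_self op] by simp
        moreover have "p ` W \<subseteq> q ` B" using W(2) g(2) pV[OF g(1)] by blast
        ultimately show "openin (subtopology M (q ` B)) (p ` W)"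
          using opU by (simp add: openin_open_subtopology)
      qed
    qed
    show "\<exists>U. y \<in> U \<and> openin M U \<and> (\<exists>\<V>. \<Union>\<V> = {x \<in> topspace N. p x \<in> U} \<and>
        (\<forall>V\<in>\<V>. openin N V) \<and> pairwise disjnt \<V> \<and>
        (\<forall>V\<in>\<V>. homeomorphic_map (subtopology N V) (subtopology M U) p))"
    proof (intro exI[of _ "q ` B"] exI[of _ \<V>] conjI ballI)
      show "y \<in> q ` B" using b by (simp add: B_def)
    qed (use union opV opU disj hom in blast)+
  qed
qed

lemma covering_map_orbit:
  assumes q: "presents act (carrier G) M q"
  shows "covering_map euclidean M q"
proof (rule presents_imp_covering_map[of "{\<one>}" euclidean id])
  show "presents act {\<one>} euclidean id"
    by (auto simp: presents_def quotient_map_def)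
qed (use q triv_subgroup in auto)

text \<open>Over \<open>q b\<close> the point \<open>f (act g b)\<close> depends exactly on the
  right coset \<open>H #> g\<close>: the action is free, and \<open>f\<close> identifies points that
  differ by \<open>H\<close> on the left.\<close>

lemma card_fibre:
  assumes f: "presents act H N f" and H: "subgroup H G" and q: "presents act (carrier G) M q"
    and p: "\<And>x. p (f x) = q x" and y: "y \<in> topspace M"
  shows "card {z \<in> topspace N. p z = y} = card (rcosets H)"
proof -
  obtain b where b: "y = q b" using y presents_range[OF q] by blast
  have "{z \<in> topspace N. p z = y} = (\<lambda>g. f (act g b)) ` carrier G"
    unfolding presents_range[OF f, symmetric] b using presents_eq_iff[OF q]
    by (auto simp: p image_iff) metis+
  moreover have "rcosets H = (\<lambda>g. H #> g) ` carrier G" by (auto simp: RCOSETS_def)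
  moreover have "card ((\<lambda>g. f (act g b)) ` carrier G) = card ((\<lambda>g. H #> g) ` carrier G)"
  proof (rule card_image_same_kernel)
    fix g k assume gk: "g \<in> carrier G" "k \<in> carrier G"
    have "f (act g b) = f (act k b) \<longleftrightarrow> (\<exists>h\<in>H. k = h \<otimes> g)"
      unfolding presents_eq_iff[OF f] using gk act_free subgroup.mem_carrier[OF H]
      by (metis act_mult_apply m_closed)
    also have "\<dots> \<longleftrightarrow> k \<in> H #> g" by (auto simp: r_coset_def)
    also have "\<dots> \<longleftrightarrow> H #> g = H #> k"
      using repr_independence[OF _ gk(1) H] rcos_self[OF gk(2) H] by metis
    finally show "f (act g b) = f (act k b) \<longleftrightarrow> H #> g = H #> k" .
  qed
  ultimately show ?thesis by simp
qed

lemma fold_covering_iff: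
  assumes "presents act H N f" "subgroup H G" "presents act (carrier G) M q" "\<And>x. p (f x) = q x"
  shows "fold_covering n N M p \<longleftrightarrow> card (rcosets H) = n"
proof -
  have "topspace M \<noteq> {}" using presents_range[OF assms(3)] by auto
  then show ?thesis
    using card_fibre[OF assms] presents_imp_covering_map[OF assms] by (auto simp: fold_covering_def)
qed

text \<open>The projection \<open>q\<close> lifts to a map \<open>f\<close> into \<open>N\<close>.
  Lifts are open maps, and the ranges of two lifts are equal or disjoint, since lifts whose ranges
  meet differ by a motion of \<open>G\<close>. Connectedness of \<open>N\<close> therefore makes
  \<open>f\<close> surjective. The subgroup consists of the motions that leave \<open>f\<close>
  unchanged.\<close>

lemma connected_covering_presented:
  assumes cov: "covering_map N M p" and conn: "connected_space N" and q: "presents act (carrier G) M q"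
  obtains H f where "subgroup H G" "presents act H N f" "\<And>x. p (f x) = q x"
proof -
  have contq: "continuous_map euclidean M q" using presents_continuous[OF q] .
  have lift: "\<exists>f. continuous_map euclidean N f \<and> (\<forall>y. p (f y) = q y) \<and> f x = z"
    if "z \<in> topspace N" "p z = q x" for x z
    using covering_map_lift_euclidean[OF cov contq that] by metis
  have unique: "f = f'"
    if "continuous_map euclidean N f" "\<And>y. p (f y) = q y"
       "continuous_map euclidean N f'" "\<And>y. p (f' y) = q y" "f x = f' x" for f f' x
    using covering_map_unique_lift[OF cov connected_space_euclidean, of f f' x] that by (auto simp: fun_eq_iff)
  \<comment> \<open>Inside a sheet \<open>V\<close> around the given point, the image of
    \<open>W\<close> under \<open>f\<close> is the part of \<open>V\<close> lying over the image of
    \<open>W\<close> under \<open>q\<close>, and \<open>q\<close> is open.\<close>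
  have opmap: "openin N (f ` S)" if f: "continuous_map euclidean N f" "\<And>y. p (f y) = q y" and S: "open S" for f S
    unfolding openin_subopen[of N "f ` S"]
  proof
    fix z assume "z \<in> f ` S"
    then obtain x where x: "x \<in> S" "z = f x" by blast
    have z: "z \<in> topspace N" using f(1) x by (auto simp: continuous_map_def)
    then have "p z \<in> topspace M" using cov by (auto simp: covering_map_def)
    then obtain U \<V> where U: "p z \<in> U" "openin M U"
      and V: "\<Union>\<V> = {x \<in> topspace N. p x \<in> U}" "\<And>V. V \<in> \<V> \<Longrightarrow> openin N V"
      and hom: "\<And>V. V \<in> \<V> \<Longrightarrow> homeomorphic_map (subtopology N V) (subtopology M U) p"
      using cov unfolding covering_map_def by meson
    obtain V where V': "V \<in> \<V>" "z \<in> V" using V(1) U z by blast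
    have VN: "V \<subseteq> topspace N" using V(2)[OF V'(1)] openin_subset by blast
    have inj: "inj_on p V"
      using hom[OF V'(1)] VN by (simp add: homeomorphic_map_def inf.absorb2)
    define W where "W = S \<inter> {w. f w \<in> V}"
    have "open W"
      using openin_continuous_map_preimage[OF f(1) V(2)[OF V'(1)]] S by (auto simp: W_def)
    then have "openin M (q ` W)" using presents_open[OF q subgroup_self] by blast
    moreover have "continuous_map N M p" using cov by (simp add: covering_map_def)
    ultimately have "openin N {w \<in> topspace N. p w \<in> q ` W}"
      using openin_continuous_map_preimage by blast
    then have "openin N (V \<inter> {w \<in> topspace N. p w \<in> q ` W})"
      using V(2)[OF V'(1)] by blast
    moreover have "V \<inter> {w \<in> topspace N. p w \<in> q ` W} \<subseteq> f ` S"
    proof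
      fix v assume "v \<in> V \<inter> {w \<in> topspace N. p w \<in> q ` W}"
      then obtain w where "v \<in> V" "w \<in> W" "p v = p (f w)" using f(2) by auto
      then have "v = f w" using inj by (auto simp: inj_on_def W_def)
      then show "v \<in> f ` S" using \<open>w \<in> W\<close> by (auto simp: W_def)
    qed
    moreover have "z \<in> V \<inter> {w \<in> topspace N. p w \<in> q ` W}"
      using V' z x f(2) by (auto simp: W_def)
    ultimately show "\<exists>T. openin N T \<and> z \<in> T \<and> T \<subseteq> f ` S" by blast
  qed
  have "q 0 \<in> p ` topspace N"
    using presents_in_topspace[OF q] cov by (simp add: covering_map_def)
  then obtain z where z: "z \<in> topspace N" "p z = q 0" by fastforce
  then obtain f where f: "continuous_map euclidean N f" "\<And>y. p (f y) = q y"
    using lift by blast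
  have f_act: "continuous_map euclidean N (f \<circ> act g) \<and> (\<forall>y. p ((f \<circ> act g) y) = q y)"
    if "g \<in> carrier G" for g
    using f continuous_on_act[OF that] presents_act[OF q that]
    by (auto intro!: continuous_map_compose[where X' = euclidean])
  have "topspace N \<subseteq> range f"
  proof (rule ccontr)
    assume *: "\<not> topspace N \<subseteq> range f"
    have "openin N (topspace N - range f)"
      unfolding openin_subopen[of N "topspace N - range f"]
    proof
      fix z assume z: "z \<in> topspace N - range f"
      then have "p z \<in> topspace M" using cov by (auto simp: covering_map_def)
      then obtain x where x: "p z = q x" using presents_range[OF q] by blast
      then obtain f' where f': "continuous_map euclidean N f'" "\<And>y. p (f' y) = q y" "f' x = z"
        using lift z by blast
      have "f' u \<noteq> f w" for u w
      proof
        assume eq: "f' u = f w"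
        then have "q u = q w" using f(2) f'(2) by metis
        then obtain g where g: "g \<in> carrier G" "w = act g u" using presents_eq_iff[OF q] by blast
        then have "f' = f \<circ> act g"
          using unique[OF f'(1,2), of "f \<circ> act g" u] f_act[OF g(1)] eq by auto
        then show False using f'(3) z by auto
      qed
      moreover have "range f' \<subseteq> topspace N"
        using f'(1) by (auto simp: continuous_map_def)
      ultimately have "openin N (range f') \<and> z \<in> range f' \<and> range f' \<subseteq> topspace N - range f"
        using opmap[OF f'(1,2), of UNIV] f'(3) by auto
      then show "\<exists>T. openin N T \<and> z \<in> T \<and> T \<subseteq> topspace N - range f" by blast
    qed
    moreover have "openin N (range f)" using opmap[OF f] by simp
    ultimately show False using conn * unfolding connected_space_def by blast
  qed
  then have surj: "range f = topspace N" using f(1) by (auto simp: continuous_map_def)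
  have quot: "quotient_map euclidean N f"
    using f(1) surj opmap[OF f] by (intro continuous_open_imp_quotient_map) (auto simp: open_map_def)
  define H where "H = {g \<in> carrier G. f \<circ> act g = f}"
  have "f x = f y \<longleftrightarrow> (\<exists>h\<in>H. y = act h x)" for x y
  proof
    assume eq: "f x = f y"
    then have "q x = q y" using f(2) by metis
    then obtain g where g: "g \<in> carrier G" "y = act g x" using presents_eq_iff[OF q] by blast
    then have "f \<circ> act g = f" using unique[OF _ _ f, of "f \<circ> act g" x] f_act[OF g(1)] eq by auto
    then show "\<exists>h\<in>H. y = act h x" using g by (auto simp: H_def)
  next
    assume "\<exists>h\<in>H. y = act h x"
    then show "f x = f y" unfolding H_def by (metis (mono_tags, lifting) comp_apply mem_Collect_eq)
  qed
  then have "presents act H N f" using quot by (simp add: presents_def)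
  moreover have "subgroup H G"
  proof (rule subgroupI)
    show "H \<noteq> {}" using act_one by (auto simp: H_def)
    show "inv g \<in> H" if "g \<in> H" for g
    proof -
      have g: "g \<in> carrier G" "\<And>x. f (act g x) = f x" using that by (auto simp: H_def fun_eq_iff)
      then have "f (act (inv g) x) = f x" for x
        using g(2)[of "act (inv g) x"] by simp
      then show ?thesis using g by (auto simp: H_def fun_eq_iff)
    qed
    show "g \<otimes> h \<in> H" if "g \<in> H" "h \<in> H" for g h
      using that by (auto simp: H_def fun_eq_iff act_mult_apply)
  qed (auto simp: H_def)
  ultimately show ?thesis using that f(2) by blast
qed

text \<open>A homeomorphism over the base turns \<open>f1\<close> into another lift of
  \<open>q\<close> to \<open>N2\<close>, hence into \<open>f2\<close> preceded by a motion
  \<open>g\<close>. Preceding \<open>f2\<close> by \<open>g\<close> conjugates the presenting group,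
  and freeness allows a group to be read off from its orbit through 0; so the two groups are
  conjugate.\<close>

lemma equivalent_coverings_iff:
  assumes q: "presents act (carrier G) M q"
    and 1: "subgroup H1 G" "presents act H1 N1 f1" "\<And>x. p1 (f1 x) = q x"
    and 2: "subgroup H2 G" "presents act H2 N2 f2" "\<And>x. p2 (f2 x) = q x"
  shows "equivalent_coverings (N1, p1) (N2, p2) \<longleftrightarrow>
    (\<exists>g\<in>carrier G. H2 = (\<lambda>h. g \<otimes> h \<otimes> inv g) ` H1)"
proof -
  have H1: "h \<in> carrier G" if "h \<in> H1" for h using 1 that subgroup.mem_carrier by metis
  have H2: "h \<in> carrier G" if "h \<in> H2" for h using 2 that subgroup.mem_carrier by metis
  have transl: "presents act ((\<lambda>h. inv g \<otimes> h \<otimes> g) ` H2) N2 (f2 \<circ> act g)" if g: "g \<in> carrier G" for g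
  proof (rule presents_change[OF 2(2)])
    have "homeomorphic_maps euclidean euclidean (act g) (act (inv g))"
      using g continuous_on_act[of _ UNIV] by (simp add: homeomorphic_maps_def)
    then show "homeomorphic_map euclidean euclidean (act g)"
      using homeomorphic_map_maps by blast
    show "(\<exists>h\<in>(\<lambda>h. inv g \<otimes> h \<otimes> g) ` H2. y = act h x) \<longleftrightarrow> (\<exists>h\<in>H2. act g y = act h (act g x))" for x y
      using g H2 by (auto simp: act_mult_apply) (metis act_inv_cancel(1))
  qed
  show ?thesis
  proof
    assume "equivalent_coverings (N1, p1) (N2, p2)"
    then obtain k where k: "homeomorphic_map N1 N2 k" "\<And>x. x \<in> topspace N1 \<Longrightarrow> p1 x = p2 (k x)"
      by (auto simp: equivalent_coverings_def)
    have kf: "presents act H1 N2 (k \<circ> f1)" using presents_homeomorphic[OF 1(2) k(1)] .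
    have p2k: "p2 (k (f1 x)) = q x" for x
      using k(2)[OF presents_in_topspace[OF 1(2)]] 1(3) by metis
    obtain y where y: "k (f1 0) = f2 y"
      using presents_in_topspace[OF kf] presents_range[OF 2(2)] by (metis comp_apply rangeE)
    then have "q 0 = q y" using p2k 2(3) by metis
    then obtain g where g: "g \<in> carrier G" "y = act g 0" using presents_eq_iff[OF q] by blast
    have "(k \<circ> f1) x = (f2 \<circ> act g) x" for x
    proof (rule covering_map_unique_lift[where X = euclidean and a = 0])
      show "covering_map N2 M p2" using presents_imp_covering_map[OF 2(2,1) q 2(3)] .
      show "continuous_map euclidean N2 (k \<circ> f1)" "continuous_map euclidean N2 (f2 \<circ> act g)"
        using presents_continuous kf transl[OF g(1)] by blast+
      show "p2 ((k \<circ> f1) x) = p2 ((f2 \<circ> act g) x)" for x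
        using p2k 2(3) presents_act[OF q g(1)] by simp
    qed (use y g connected_space_euclidean in auto)
    then have "k \<circ> f1 = f2 \<circ> act g" by (rule ext)
    then have pres1: "presents act H1 N2 (f2 \<circ> act g)" using kf by simp
    define K where "K = (\<lambda>h. inv g \<otimes> h \<otimes> g) ` H2"
    have K: "h \<in> carrier G" if "h \<in> K" for h using that H2 g(1) by (auto simp: K_def)
    have "(\<exists>k\<in>H1. act h 0 = act k 0) \<longleftrightarrow> (\<exists>k\<in>K. act h 0 = act k 0)" for h
      using presents_eq_iff[OF pres1, of 0 "act h 0"]
        presents_eq_iff[OF transl[OF g(1)], of 0 "act h 0"] unfolding K_def by blast
    then have "h \<in> H1 \<longleftrightarrow> h \<in> K" if "h \<in> carrier G" for h
      using H1 K act_free[OF that] that by metis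
    then have "H1 = K" using H1 K by blast
    then have "H1 = (\<lambda>h. inv g \<otimes> h \<otimes> g) ` H2" by (simp add: K_def)
    then have "(\<lambda>h. g \<otimes> h \<otimes> inv g) ` H1 = (\<lambda>h. g \<otimes> (inv g \<otimes> h \<otimes> g) \<otimes> inv g) ` H2"
      by (simp add: image_image)
    also have "\<dots> = (\<lambda>h. h) ` H2"
      by (rule image_cong) (use H2 g(1) in \<open>auto simp: m_assoc\<close>, simp add: m_assoc[symmetric])
    finally show "\<exists>g\<in>carrier G. H2 = (\<lambda>h. g \<otimes> h \<otimes> inv g) ` H1" using g(1) by auto
  next
    assume "\<exists>g\<in>carrier G. H2 = (\<lambda>h. g \<otimes> h \<otimes> inv g) ` H1"
    then obtain g where g: "g \<in> carrier G" "H2 = (\<lambda>h. g \<otimes> h \<otimes> inv g) ` H1" by blast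
    have "(\<lambda>h. inv g \<otimes> h \<otimes> g) ` H2 = (\<lambda>h. inv g \<otimes> (g \<otimes> h \<otimes> inv g) \<otimes> g) ` H1"
      using g by (simp add: image_image)
    also have "\<dots> = (\<lambda>h. h) ` H1"
      by (rule image_cong) (use H1 g(1) in \<open>auto simp: m_assoc\<close>, simp add: m_assoc[symmetric])
    finally have "presents act H1 N2 (f2 \<circ> act g)" using transl[OF g(1)] by simp
    then obtain k where k: "homeomorphic_map N1 N2 k" "\<And>x. k (f1 x) = (f2 \<circ> act g) x"
      using presents_same_kernel[of N1 f1 N2 "f2 \<circ> act g"] 1(2) unfolding presents_def by auto
    moreover have "p1 z = p2 (k z)" if z: "z \<in> topspace N1" for z
    proof -
      obtain x where "z = f1 x" using z presents_range[OF 1(2)] by blast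
      then show ?thesis using k(2) 1(3) 2(3) presents_act[OF q g(1)] by simp
    qed
    ultimately show "equivalent_coverings (N1, p1) (N2, p2)"
      unfolding equivalent_coverings_def prod.case by blast
  qed
qed

text \<open>Loops lift to paths starting at \<open>x0\<close>, and \<open>ends r g\<close> says that
  some lift of \<open>r\<close> ends at \<open>act g x0\<close>. This end is unique, is invariant
  under homotopy, and determines the homotopy class, because paths in Euclidean space with common
  ends are joined by a linear homotopy.\<close>

lemma fundamental_group_presented:
  assumes q: "presents act (carrier G) M q"
  shows "G \<cong> fundamental_group M (q x0)"
proof -
  define a where "a = q x0"
  let ?I = "top_of_set {0..1::real}"
  let ?P = "\<lambda>r. r 0 = a \<and> r 1 = a"
  define htp where "htp = homotopic_with ?P ?I M"
  define ends :: "(real \<Rightarrow> 'b) \<Rightarrow> 'g \<Rightarrow> bool" where "ends r g \<longleftrightarrow> (\<exists>u. continuous_on {0..1} u \<and> (\<forall>s\<in>{0..1}. q (u s) = r s) \<and>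
      u 0 = x0 \<and> u 1 = act g x0)" for r g
  have cov: "covering_map euclidean M q" using covering_map_orbit[OF q] .
  have contq: "continuous_map euclidean M q" using presents_continuous[OF q] .
  have unique: "u s = v s" if "continuous_on {0..1} u" "continuous_on {0..1} v"
      "\<And>s. s \<in> {0..1} \<Longrightarrow> q (u s) = q (v s)" "u 0 = v 0" "s \<in> {0..1}" for u v and s :: real
    by (rule covering_map_unique_lift[OF cov, of ?I u v 0])
      (use that in \<open>auto simp: connected_space_subtopology\<close>)
  have ends_loop: "loop_at M a r" if "ends r g" "g \<in> carrier G" for r g
  proof -
    obtain u where u: "continuous_on {0..1} u" "\<And>s. s \<in> {0..1} \<Longrightarrow> q (u s) = r s" "u 0 = x0" "u 1 = act g x0"
      using \<open>ends r g\<close> unfolding ends_def by blast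
    have "continuous_map ?I M (q \<circ> u)"
      using u(1) contq by (auto intro!: continuous_map_compose[where X' = euclidean])
    then have "continuous_map ?I M r"
      using u(2) by (auto elim: continuous_map_eq)
    then show ?thesis
      using u(2)[of 0] u(2)[of 1] u(3,4) presents_act[OF q that(2)]
      by (simp add: loop_at_def pathin_def a_def)
  qed
  have ends_exists: "\<exists>g\<in>carrier G. ends r g" if "loop_at M a r" for r
  proof -
    have r: "continuous_map (top_of_set (cbox 0 1)) M r" "r 0 = a" "r 1 = a"
      using that by (auto simp: loop_at_def pathin_def)
    obtain u where u: "continuous_map (top_of_set (cbox 0 1)) euclidean u"
      "\<And>s. s \<in> cbox 0 1 \<Longrightarrow> q (u s) = r s" "u 0 = x0"
      using covering_map_lift_cbox[OF cov r(1), of 0 x0] r by (auto simp: a_def)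
    then have "q x0 = q (u 1)" using r by (simp add: a_def)
    then obtain g where "g \<in> carrier G" "u 1 = act g x0" using presents_eq_iff[OF q] by blast
    then show ?thesis using u unfolding ends_def by (auto intro!: bexI[of _ g] exI[of _ u])
  qed
  have ends_unique: "g = k" if "ends r g" "ends r k" "g \<in> carrier G" "k \<in> carrier G" for r g k
  proof -
    obtain u where u: "continuous_on {0..1} u" "\<And>s. s \<in> {0..1} \<Longrightarrow> q (u s) = r s" "u 0 = x0" "u 1 = act g x0"
      using \<open>ends r g\<close> unfolding ends_def by blast
    obtain v where v: "continuous_on {0..1} v" "\<And>s. s \<in> {0..1} \<Longrightarrow> q (v s) = r s" "v 0 = x0" "v 1 = act k x0"
      using \<open>ends r k\<close> unfolding ends_def by blast
    have "u 1 = v 1" by (rule unique) (use u v in auto)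
    then show ?thesis using u v act_free that by metis
  qed
  have htp_if_ends: "htp r r'" if "ends r g" "ends r' g" "g \<in> carrier G" for r r' g
  proof -
    obtain u where u: "continuous_on {0..1} u" "\<And>s. s \<in> {0..1} \<Longrightarrow> q (u s) = r s" "u 0 = x0" "u 1 = act g x0"
      using \<open>ends r g\<close> unfolding ends_def by blast
    obtain v where v: "continuous_on {0..1} v" "\<And>s. s \<in> {0..1} \<Longrightarrow> q (v s) = r' s" "v 0 = x0" "v 1 = act g x0"
      using \<open>ends r' g\<close> unfolding ends_def by blast
    have "homotopic_paths UNIV u v"
      by (rule homotopic_paths_linear) (use u v in \<open>auto simp: path_def pathstart_def pathfinish_def\<close>)
    then have "homotopic_with ?P ?I M (q \<circ> u) (q \<circ> v)"
      unfolding homotopic_paths_def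
      by (rule homotopic_with_compose_continuous_map_left)
        (use contq u presents_act[OF q that(3)] in \<open>auto simp: pathstart_def pathfinish_def a_def\<close>)
    moreover have loops: "loop_at M a r" "loop_at M a r'" using ends_loop that by blast+
    have "homotopic_with ?P ?I M r (q \<circ> u)"
      by (rule homotopic_with_equal)
        (use loops(1) u(2,3,4) in \<open>simp_all add: loop_at_def pathin_def a_def presents_act[OF q that(3)]\<close>)
    moreover have "homotopic_with ?P ?I M r' (q \<circ> v)"
      by (rule homotopic_with_equal)
        (use loops(2) v(2,3,4) in \<open>simp_all add: loop_at_def pathin_def a_def presents_act[OF q that(3)]\<close>)
    ultimately show ?thesis
      unfolding htp_def by (meson homotopic_with_trans homotopic_with_symD)
  qed
  have ends_htp: "ends r' g" if "htp r r'" "ends r g" "g \<in> carrier G" for r r' g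
  proof -
    obtain u where u: "continuous_on {0..1} u" "\<And>s. s \<in> {0..1} \<Longrightarrow> q (u s) = r s" "u 0 = x0" "u 1 = act g x0"
      using \<open>ends r g\<close> unfolding ends_def by blast
    \<comment> \<open>The homotopy is lifted over the unit square, whose first coordinate is the
      homotopy parameter. The edges with second coordinate 0 and 1 go to the base point, so the lift
      is constant on them and the end of the lifted loop does not move.\<close>
    let ?B = "cbox (0, 0) (1, 1) :: (real \<times> real) set"
    have B: "?B = {0..1} \<times> {0..1}" by (auto simp: cbox_Pair_eq)
    obtain H where H: "continuous_map (top_of_set ?B) M H"
      and H01: "\<And>s. H (0, s) = r s" "\<And>s. H (1, s) = r' s"
      and Ha: "\<And>t. t \<in> {0..1} \<Longrightarrow> H (t, 0) = a \<and> H (t, 1) = a"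
      using \<open>htp r r'\<close> unfolding htp_def homotopic_with_def B by auto
    obtain K where K: "continuous_on ({0..1} \<times> {0..1}) K"
      "\<And>y. y \<in> {0..1} \<times> {0..1} \<Longrightarrow> q (K y) = H y" "K (0, 0) = x0"
      using covering_map_lift_cbox[OF cov H, of "(0,0)" x0] Ha[of 0] by (auto simp: B a_def)
    have contK: "continuous_on {0..1} (\<lambda>s. K (t, s))" "continuous_on {0..1} (\<lambda>s. K (s, t))"
      if "t \<in> {0..1}" for t
      by (rule continuous_on_compose2[OF K(1)]; use that in \<open>auto intro!: continuous_intros\<close>)+
    have "K (0, 1) = u 1"
      by (rule unique[of "\<lambda>s. K (0, s)" u]) (use K H01 u contK in auto)
    moreover have "K (t, 0) = x0" if "t \<in> {0..1}" for t
      by (rule unique[of "\<lambda>t. K (t, 0)" "\<lambda>_. x0"]) (use K Ha contK that in \<open>auto simp: a_def\<close>)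
    moreover have "K (1, 1) = K (0, 1)"
      by (rule unique[of "\<lambda>t. K (t, 1)" "\<lambda>_. K (0, 1)"]) (use K Ha contK in auto)
    ultimately show ?thesis
      unfolding ends_def using contK[of 1] K(2) H01 u by (intro exI[of _ "\<lambda>s. K (1, s)"]) auto
  qed
  \<comment> \<open>Both homotopy and \<open>ends\<close> ignore values outside the unit interval,
    so a loop class is exactly the set of functions with a given end.\<close>
  have class_eq: "loop_class M a r = {r'. ends r' g}" if "ends r g" "g \<in> carrier G" for r g
    using that ends_htp htp_if_ends unfolding loop_class_def htp_def by blast
  define \<Phi> where "\<Phi> g = {r. ends r g}" for g
  have line: "ends (q \<circ> linepath x0 (act g x0)) g" for g
    unfolding ends_def by (intro exI[of _ "linepath x0 (act g x0)"]) (auto intro!: continuous_intros simp: linepath_def)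
  have join: "ends (loop_join r r') (g \<otimes> k)" if "ends r g" "ends r' k" "g \<in> carrier G" "k \<in> carrier G" for r r' g k
  proof -
    obtain u where u: "continuous_on {0..1} u" "\<And>s. s \<in> {0..1} \<Longrightarrow> q (u s) = r s" "u 0 = x0" "u 1 = act g x0"
      using \<open>ends r g\<close> unfolding ends_def by blast
    obtain v where v: "continuous_on {0..1} v" "\<And>s. s \<in> {0..1} \<Longrightarrow> q (v s) = r' s" "v 0 = x0" "v 1 = act k x0"
      using \<open>ends r' k\<close> unfolding ends_def by blast
    \<comment> \<open>The second lift starts at \<open>x0\<close> and has to be moved by
      \<open>act g\<close> to continue the first one; this puts the factors in the order
      \<open>g \<otimes> k\<close>.\<close>
    have "continuous_on {0..1} (\<lambda>s. act g (v s))"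
      by (rule continuous_on_compose2[OF continuous_on_act[OF that(3), of UNIV] v(1)]) simp
    then have "path (u +++ (act g \<circ> v))"
      using u v by (intro path_join_imp) (auto simp: path_def pathstart_def pathfinish_def o_def)
    moreover have "q ((u +++ (act g \<circ> v)) s) = loop_join r r' s" if "s \<in> {0..1}" for s
      using u v that presents_act[OF q \<open>g \<in> carrier G\<close>] by (auto simp: joinpaths_def loop_join_def)
    ultimately show ?thesis
      unfolding ends_def using u v that
      by (intro exI[of _ "u +++ (act g \<circ> v)"]) (auto simp: path_def joinpaths_def act_mult_apply)
  qed
  have "\<Phi> \<in> iso G (fundamental_group M a)"
  proof (rule isoI)
    have carrier: "carrier (fundamental_group M a) = \<Phi> ` carrier G"
    proof
      show "carrier (fundamental_group M a) \<subseteq> \<Phi> ` carrier G"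
        using ends_exists class_eq unfolding fundamental_group_def \<Phi>_def by fastforce
      show "\<Phi> ` carrier G \<subseteq> carrier (fundamental_group M a)"
        using line ends_loop class_eq unfolding fundamental_group_def \<Phi>_def by fastforce
    qed
    show "\<Phi> \<in> hom G (fundamental_group M a)"
    proof (rule homI)
      fix g k assume gk: "g \<in> carrier G" "k \<in> carrier G"
      have "loop_class M a (loop_join r r') = \<Phi> (g \<otimes> k)" if "r \<in> \<Phi> g" "r' \<in> \<Phi> k" for r r'
        using class_eq[OF join] that gk unfolding \<Phi>_def by blast
      moreover have "\<Phi> g \<noteq> {}" "\<Phi> k \<noteq> {}" using line unfolding \<Phi>_def by blast+
      ultimately show "\<Phi> (g \<otimes> k) = \<Phi> g \<otimes>\<^bsub>fundamental_group M a\<^esub> \<Phi> k"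
        unfolding fundamental_group_def by force
    qed (use carrier in auto)
    show "bij_betw \<Phi> (carrier G) (carrier (fundamental_group M a))"
      unfolding bij_betw_def carrier
      using ends_unique line unfolding inj_on_def \<Phi>_def by blast
  qed
  then show ?thesis unfolding is_iso_def a_def by blast
qed

text \<open>The points of the total space must belong to the given type. Each orbit is named by a
  chosen element, coded as a real number by \<open>e\<close> and carried into the type by
  \<open>emb\<close>; the set of names receives the quotient topology.\<close>

lemma covering_of_subgroup_exists:
  fixes emb :: "real \<Rightarrow> 'n"
  assumes H: "subgroup H G" and q: "presents act (carrier G) M q" and emb: "inj emb"
    and e: "inj (e :: 'e \<Rightarrow> real)"
  obtains N :: "'n topology" and f p where "presents act H N f" "\<And>x. p (f x) = q x"
proof -
  define orb where "orb x = (\<lambda>h. act h x) ` H" for x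
  define f where "f x = emb (e (SOME y. y \<in> orb x))" for x
  have mem: "act h x \<in> orb x" if "h \<in> H" for h x using that by (simp add: orb_def)
  have refl: "x \<in> orb x" for x
    using mem[OF subgroup.one_closed[OF H], of x] by simp
  have eq: "orb x = orb y" if y: "y \<in> orb x" for x y
  proof -
    obtain h where h: "h \<in> H" "y = act h x" using y by (auto simp: orb_def)
    have "orb x = (\<lambda>k. act (k \<otimes> h) x) ` H"
      unfolding orb_def
    proof (intro equalityI subsetI)
      fix z assume "z \<in> (\<lambda>h. act h x) ` H"
      then obtain k where k: "k \<in> H" "z = act k x" by blast
      then have "z = act ((k \<otimes> inv h) \<otimes> h) x"
        using h H by (simp add: m_assoc subgroup.mem_carrier)
      then show "z \<in> (\<lambda>k. act (k \<otimes> h) x) ` H"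
        using k h H by (meson image_eqI subgroup.m_closed subgroup.m_inv_closed)
    next
      fix z assume "z \<in> (\<lambda>k. act (k \<otimes> h) x) ` H"
      then show "z \<in> (\<lambda>h. act h x) ` H" using h H subgroup.m_closed by fastforce
    qed
    also have "\<dots> = orb y"
      unfolding orb_def using h H by (auto simp: act_mult_apply subgroup.mem_carrier intro!: image_cong)
    finally show ?thesis .
  qed
  have "f x = f y \<longleftrightarrow> y \<in> orb x" for x y
  proof
    assume "f x = f y"
    then have "(SOME y. y \<in> orb x) = (SOME z. z \<in> orb y)"
      using emb e by (simp add: f_def inj_eq)
    then have "(SOME y. y \<in> orb x) \<in> orb x \<and> (SOME y. y \<in> orb x) \<in> orb y"
      using someI[of "\<lambda>z. z \<in> orb x", OF refl] someI[of "\<lambda>z. z \<in> orb y", OF refl] by auto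
    then show "y \<in> orb x" using eq refl by metis
  next
    assume "y \<in> orb x"
    then show "f x = f y" using eq[of y x] by (simp add: f_def)
  qed
  moreover obtain N where "quotient_map euclidean N f" by (rule quotient_topology_exists)
  ultimately have N: "presents act H N f" by (auto simp: presents_def orb_def)
  moreover have "q (SOME y. f y = f x) = q x" for x
  proof -
    have "f (SOME y. f y = f x) = f x" by (rule someI[of "\<lambda>y. f y = f x"]) simp
    then show ?thesis
      using presents_eq_iff[OF N] presents_act[OF q] subgroup.mem_carrier[OF H] by metis
  qed
  ultimately show ?thesis using that[of N f "\<lambda>z. q (SOME y. f y = z)"] by blast
qed

text \<open>The link between topology and algebra. Once \<open>P\<close> characterises the subgroups
  whose orbit spaces have the fundamental group of \<open>T\<close>, classes of coverings are
  conjugacy classes of such subgroups, and these can be counted on any finite family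
  \<open>c\<close> that meets all of them. The family may be redundant, since the relation on
  \<open>X\<close> identifies conjugate members.\<close>

lemma card_covering_classes:
  fixes emb :: "real \<Rightarrow> 'n"
  assumes q: "presents act (carrier G) M q" and emb: "inj emb" and e: "inj (e :: 'e \<Rightarrow> real)"
    and type: "\<And>H (N :: 'n topology) f. subgroup H G \<Longrightarrow> card (rcosets H) = n \<Longrightarrow> presents act H N f \<Longrightarrow>
       isomorphic_fundamental_groups N T \<longleftrightarrow> P H"
    and X: "finite X" and c: "\<And>x. x \<in> X \<Longrightarrow> subgroup (c x) G \<and> card (rcosets (c x)) = n \<and> P (c x)"
    and surj: "\<And>H. subgroup H G \<Longrightarrow> card (rcosets H) = n \<Longrightarrow> P H \<Longrightarrow>
       \<exists>x\<in>X. \<exists>g\<in>carrier G. c x = (\<lambda>h. g \<otimes> h \<otimes> inv g) ` H"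
  shows "finite (covering_classes TYPE('n) T M n) \<and>
    card (covering_classes TYPE('n) T M n) =
      card (X // {(x, y). x \<in> X \<and> y \<in> X \<and> (\<exists>g\<in>carrier G. c y = (\<lambda>h. g \<otimes> h \<otimes> inv g) ` c x)})"
proof -
  define Y where "Y = coverings_of_type TYPE('n) T M n"
  define F where "F = {(P, Q). P \<in> Y \<and> Q \<in> Y \<and> equivalent_coverings P Q}"
  have pres: "\<exists>H f. subgroup H G \<and> presents act H N f \<and> (\<forall>x. p (f x) = q x) \<and> card (rcosets H) = n \<and> P H"
    if "(N, p) \<in> Y" for N p
  proof -
    have *: "connected_space N" "fold_covering n N M p" "isomorphic_fundamental_groups N T"
      using that by (auto simp: Y_def coverings_of_type_def)
    then obtain H f where H: "subgroup H G" "presents act H N f" "\<And>x. p (f x) = q x"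
      using connected_covering_presented[OF _ _ q, of N p] unfolding fold_covering_def by metis
    moreover have "card (rcosets H) = n" using fold_covering_iff[OF H(2,1) q H(3)] *(2) by blast
    ultimately show ?thesis using type *(3) by blast
  qed
  have presX: "\<exists>N p f. (N, p) \<in> Y \<and> presents act (c x) N f \<and> (\<forall>y. p (f y) = q y)" if x: "x \<in> X" for x
  proof -
    obtain N :: "'n topology" and f p where f: "presents act (c x) N f" "\<And>x. p (f x) = q x"
      using covering_of_subgroup_exists[OF _ q emb e] c[OF x] by metis
    have "connected_space N"
      using f(1) connected_space_quotient_map_image connected_space_euclidean unfolding presents_def by blast
    moreover have "fold_covering n N M p" using fold_covering_iff[OF f(1) _ q f(2)] c[OF x] by blast
    moreover have "isomorphic_fundamental_groups N T" using type c[OF x] f(1) by blast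
    ultimately show ?thesis using f by (auto simp: Y_def coverings_of_type_def)
  qed
  have "\<exists>z. \<forall>x\<in>X. fst z x \<in> Y \<and> presents act (c x) (fst (fst z x)) (snd z x) \<and>
      (\<forall>y. snd (fst z x) (snd z x y) = q y)"
  proof -
    have "\<forall>x\<in>X. \<exists>w. fst w \<in> Y \<and> presents act (c x) (fst (fst w)) (snd w) \<and> (\<forall>y. snd (fst w) (snd w y) = q y)"
      using presX by force
    then obtain w where "\<forall>x\<in>X. fst (w x) \<in> Y \<and> presents act (c x) (fst (fst (w x))) (snd (w x)) \<and>
        (\<forall>y. snd (fst (w x)) (snd (w x) y) = q y)"
      by (rule bchoice[THEN exE])
    then show ?thesis by (intro exI[of _ "(fst \<circ> w, snd \<circ> w)"]) simp
  qed
  then obtain d fd where d: "\<And>x. x \<in> X \<Longrightarrow> d x \<in> Y \<and> presents act (c x) (fst (d x)) (fd x) \<and> (\<forall>y. snd (d x) (fd x y) = q y)"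
    by auto
  have dd: "equivalent_coverings (d x) (d y) \<longleftrightarrow> (\<exists>g\<in>carrier G. c y = (\<lambda>h. g \<otimes> h \<otimes> inv g) ` c x)"
    if "x \<in> X" "y \<in> X" for x y
    using equivalent_coverings_iff[OF q, of "c x" "fst (d x)" "fd x" "snd (d x)" "c y" "fst (d y)" "fd y" "snd (d y)"]
      d[OF that(1)] d[OF that(2)] c[OF that(1)] c[OF that(2)] by simp
  have "equiv Y F"
  proof (rule equivI)
    show "refl_on Y F"
    proof (rule refl_onI)
      fix P assume "P \<in> Y"
      moreover have "equivalent_coverings P P"
        unfolding equivalent_coverings_def by (cases P) (auto intro!: exI[of _ id])
      ultimately show "(P, P) \<in> F" by (simp add: F_def)
    qed
    show "sym F"
    proof (rule symI)
      fix P Q assume "(P, Q) \<in> F"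
      then obtain h where PQ: "P \<in> Y" "Q \<in> Y" and h: "homeomorphic_map (fst P) (fst Q) h"
        "\<And>x. x \<in> topspace (fst P) \<Longrightarrow> snd P x = snd Q (h x)"
        by (auto simp: F_def equivalent_coverings_def case_prod_unfold)
      obtain k where k: "homeomorphic_maps (fst P) (fst Q) h k"
        using h(1) homeomorphic_map_maps by blast
      then have "homeomorphic_map (fst Q) (fst P) k"
        by (meson homeomorphic_map_maps homeomorphic_maps_sym)
      moreover have "snd Q y = snd P (k y)" if "y \<in> topspace (fst Q)" for y
        using k h(2)[of "k y"] that by (auto simp: homeomorphic_maps_def continuous_map_def Pi_iff)
      ultimately show "(Q, P) \<in> F"
        using PQ by (auto simp: F_def equivalent_coverings_def case_prod_unfold)
    qed
    show "trans F"
    proof (rule transI)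
      fix P Q R assume "(P, Q) \<in> F" "(Q, R) \<in> F"
      then obtain h k where PR: "P \<in> Y" "R \<in> Y" and h: "homeomorphic_map (fst P) (fst Q) h"
        "\<And>x. x \<in> topspace (fst P) \<Longrightarrow> snd P x = snd Q (h x)" and k: "homeomorphic_map (fst Q) (fst R) k"
        "\<And>x. x \<in> topspace (fst Q) \<Longrightarrow> snd Q x = snd R (k x)"
        by (auto simp: F_def equivalent_coverings_def case_prod_unfold)
      have "homeomorphic_map (fst P) (fst R) (k \<circ> h)" using homeomorphic_map_compose[OF h(1) k(1)] .
      moreover have "snd P x = snd R ((k \<circ> h) x)" if "x \<in> topspace (fst P)" for x
        using h k that homeomorphic_imp_continuous_map[OF h(1)] by (auto simp: continuous_map_def)
      ultimately show "(P, R) \<in> F"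
        using PR unfolding F_def equivalent_coverings_def by (auto simp: case_prod_unfold simp del: comp_apply)
    qed
  qed (auto simp: F_def)
  moreover have "\<exists>x\<in>X. (y, d x) \<in> F" if y: "y \<in> Y" for y
  proof -
    obtain N p where Np: "y = (N, p)" by fastforce
    obtain H f where H: "subgroup H G" "presents act H N f" "\<And>x. p (f x) = q x" "card (rcosets H) = n" "P H"
      using pres y unfolding Np by metis
    then obtain x g where x: "x \<in> X" "g \<in> carrier G" "c x = (\<lambda>h. g \<otimes> h \<otimes> inv g) ` H"
      using surj by blast
    then have "equivalent_coverings (N, p) (fst (d x), snd (d x))"
      using equivalent_coverings_iff[OF q H(1-3), of "c x" "fst (d x)" "fd x" "snd (d x)"] d[OF x(1)] c[OF x(1)]
      by blast
    then show ?thesis using x(1) d[OF x(1)] y by (auto simp: F_def Np)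
  qed
  ultimately have "finite (Y // F) \<and> card (Y // F) = card (X // {(x, x'). x \<in> X \<and> x' \<in> X \<and> (d x, d x') \<in> F})"
    using card_quotient_eq[of Y F X d] d X by blast
  moreover have "{(x, x'). x \<in> X \<and> x' \<in> X \<and> (d x, d x') \<in> F} =
     {(x, y). x \<in> X \<and> y \<in> X \<and> (\<exists>g\<in>carrier G. c y = (\<lambda>h. g \<otimes> h \<otimes> inv g) ` c x)}"
  proof -
    have "(d x, d y) \<in> F \<longleftrightarrow> (\<exists>g\<in>carrier G. c y = (\<lambda>h. g \<otimes> h \<otimes> inv g) ` c x)"
      if "x \<in> X" "y \<in> X" for x y
      using dd[OF that] d that by (simp add: F_def)
    then show ?thesis by blast
  qed
  ultimately show ?thesis unfolding covering_classes_def Y_def F_def by simp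
qed

end

section \<open>The three groups of motions\<close>

text \<open>The sign (-1)^k, generic in the ring, so that one symbol serves in the integral group
  laws and in the real motions.\<close>

definition psign :: "int \<Rightarrow> 'a::ring_1" where
  "psign k = (if even k then 1 else - 1)"

lemma psign_add [simp]: "psign (a + b) = psign a * psign b"
  by (simp add: psign_def)

lemma psign_uminus [simp]: "psign (- a) = psign a"
  by (simp add: psign_def)

text \<open>Parities ignore signs. This makes the product of \<open>HW\<close> associative, whose
  signs are read off from the parities of entries that are themselves added with signs.\<close>

lemma psign_psign_mult [simp]: "psign (psign a * b) = psign b" "psign (b * psign a) = psign b"
  by (simp_all add: psign_def)

lemma psign_square [simp]: "psign a * psign a = 1" "psign a * (psign a * x) = x"
  by (simp_all add: psign_def)

lemma of_int_psign [simp]: "of_int (psign a) = psign a"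
  by (simp add: psign_def)

lemma odd_psign [simp]: "even (psign a :: int) \<longleftrightarrow> False"
  by (simp add: psign_def)

lemma psign_even [simp]: "even a \<Longrightarrow> psign a = 1" and psign_odd [simp]: "odd a \<Longrightarrow> psign a = - 1"
  by (simp_all add: psign_def)

lemma exists_inj_real3_real: "\<exists>e :: real^3 \<Rightarrow> real. inj e"
proof -
  have "\<exists>f. bij_betw f (UNIV \<times> UNIV :: (real \<times> real) set) (UNIV :: real set)"
    using card_of_Times_same_infinite[of "UNIV :: real set"] card_of_ordIso infinite_UNIV_char_0 by blast
  then obtain f :: "real \<times> real \<Rightarrow> real" where "inj f"
    by (auto simp: bij_betw_def)
  then have "inj (\<lambda>v :: real^3. f (v $ 1, f (v $ 2, v $ 3)))"
  proof (intro injI)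
    fix v w :: "real^3"
    assume "f (v $ 1, f (v $ 2, v $ 3)) = f (w $ 1, f (w $ 2, w $ 3))"
    then have "v $ 1 = w $ 1 \<and> v $ 2 = w $ 2 \<and> v $ 3 = w $ 3"
      by (simp add: inj_eq[OF \<open>inj f\<close>])
    then show "v = w" by (simp add: vec_eq_iff forall_3)
  qed
  then show ?thesis by blast
qed

text \<open>As \<open>act\<close> is a homomorphism into the group of bijections, the group
  generated by the images of \<open>T\<close> is the image of the group generated by
  \<open>T\<close>. This connects the generating motions of the manifolds with groups of integer
  triples.\<close>

lemma (in isometric_action) transformation_group_act:
  assumes T: "T \<subseteq> carrier G" and gen: "carrier G \<subseteq> generate G T"
  shows "transformation_group (act ` T) = act ` carrier G"
proof -
  have bij: "bij (act g)" if "g \<in> carrier G" for g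
    using that by (intro o_bij[of "act (inv g)"]) (auto simp: fun_eq_iff)
  have "act \<in> hom G (BijGroup UNIV)"
    by (rule homI) (use bij in \<open>auto simp: BijGroup_def Bij_def act_mult compose_def\<close>)
  note in_carrier = generate_in_carrier[OF T]
  from \<open>act \<in> hom G (BijGroup UNIV)\<close> interpret group_hom G "BijGroup UNIV" act
    by (simp add: group_hom_def group_hom_axioms_def group_BijGroup)
  show ?thesis
    unfolding transformation_group_def generate_img[OF T]
    using gen in_carrier by blast
qed

lemma dist_le_component: "\<bar>x $ i - y $ i\<bar> \<le> dist x (y :: real^'n)"
  using component_le_norm_cart[of "x - y" i] by (simp add: dist_norm)

lemma dist_signed_motion:
  fixes x y :: "real^3"
  shows "dist (vector [a + psign i * x $ 1, b + psign j * x $ 2, c + psign k * x $ 3] :: real^3)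
     (vector [a + psign i * y $ 1, b + psign j * y $ 2, c + psign k * y $ 3]) = dist x y"
  by (simp add: dist_vec_def L2_set_def sum_3 dist_real_def psign_def power2_commute)

lemma one_le_abs_of_int: "a \<noteq> 0 \<Longrightarrow> 1 \<le> \<bar>real_of_int a\<bar>"
  by linarith

section \<open>The group of the 3-torus\<close>

definition ZZ3 :: "(int \<times> int \<times> int) monoid" where
  "ZZ3 = \<lparr>carrier = UNIV, mult = (+), one = 0\<rparr>"

definition torus_act :: "int \<times> int \<times> int \<Rightarrow> real^3 \<Rightarrow> real^3" where
  "torus_act = (\<lambda>(a, b, c) v. vector [of_int a + v $ 1, of_int b + v $ 2, of_int c + v $ 3])"

interpretation ZZ3: comm_group ZZ3
proof (rule comm_groupI)
  show "\<exists>y\<in>carrier ZZ3. y \<otimes>\<^bsub>ZZ3\<^esub> x = \<one>\<^bsub>ZZ3\<^esub>" for x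
    by (rule bexI[of _ "- x"]) (simp_all add: ZZ3_def)
qed (auto simp: ZZ3_def)

interpretation ZZ3: isometric_action ZZ3 torus_act
proof
  show "dist (torus_act g x) (torus_act g y) = dist x y" for g x y
    using dist_signed_motion[of _ 0 x _ 0 _ 0 y] by (cases g) (simp add: torus_act_def)
  fix g :: "int \<times> int \<times> int" and x assume "g \<noteq> \<one>\<^bsub>ZZ3\<^esub>"
  moreover obtain a b c where g: "g = (a, b, c)" by (cases g)
  ultimately have "a \<noteq> 0 \<or> b \<noteq> 0 \<or> c \<noteq> 0" by (simp add: ZZ3_def zero_prod_def)
  then show "1 \<le> dist x (torus_act g x)"
    using dist_le_component[of x 1 "torus_act g x"] dist_le_component[of x 2 "torus_act g x"]
      dist_le_component[of x 3 "torus_act g x"] one_le_abs_of_int[of a] one_le_abs_of_int[of b] one_le_abs_of_int[of c]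
    by (auto simp: torus_act_def g)
qed (auto simp: ZZ3_def torus_act_def zero_prod_def fun_eq_iff vec_eq_iff forall_3 algebra_simps)

lemma G1_presented: "presents torus_act UNIV G1 (orbit_of (torus_act ` UNIV))"
proof -
  have gen: "t \<in> generate ZZ3 {(1, 0, 0), (0, 1, 0), (0, 0, 1)}" (is "_ \<in> ?A") for t
  proof -
    have mult: "u + v \<in> ?A" if "u \<in> ?A" "v \<in> ?A" for u v
      using generate.eng[OF that] by (simp add: ZZ3_def)
    have inv: "- u \<in> ?A" if "u \<in> ?A" for u
    proof -
      have "inv\<^bsub>ZZ3\<^esub> u = - u"
        by (rule ZZ3.inv_equality) (simp_all add: ZZ3_def)
      then show ?thesis using ZZ3.generate_m_inv_closed[of "{(1, 0, 0), (0, 1, 0), (0, 0, 1)}" u] that by (simp add: ZZ3_def)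
    qed
    have zero: "0 \<in> ?A" using generate.one[of ZZ3] by (simp add: ZZ3_def)
    have "(a, 0, 0) \<in> ?A \<and> (0, a, 0) \<in> ?A \<and> (0, 0, a) \<in> ?A" for a
    proof (induction a rule: int_induct[where k = 0])
      case base
      then show ?case using zero by (simp add: zero_prod_def)
    next
      case (step1 i)
      have "(1, 0, 0) \<in> ?A" "(0, 1, 0) \<in> ?A" "(0, 0, 1) \<in> ?A" by (auto intro: generate.incl)
      then show ?case using step1 mult[of "(i, 0, 0)" "(1, 0, 0)"] mult[of "(0, i, 0)" "(0, 1, 0)"]
          mult[of "(0, 0, i)" "(0, 0, 1)"] by simp
    next
      case (step2 i)
      have "(1, 0, 0) \<in> ?A" "(0, 1, 0) \<in> ?A" "(0, 0, 1) \<in> ?A" by (auto intro: generate.incl)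
      then have "(-1, 0, 0) \<in> ?A" "(0, -1, 0) \<in> ?A" "(0, 0, -1) \<in> ?A" using inv by fastforce+
      then show ?case using step2 mult[of "(i, 0, 0)" "(-1, 0, 0)"] mult[of "(0, i, 0)" "(0, -1, 0)"]
          mult[of "(0, 0, i)" "(0, 0, -1)"] by simp
    qed
    then have "(a, 0, 0) + ((0, b, 0) + (0, 0, c)) \<in> ?A" for a b c
      using mult by blast
    then show ?thesis by (cases t) simp
  qed
  have "transformation_group (torus_act ` {(1, 0, 0), (0, 1, 0), (0, 0, 1)}) = torus_act ` carrier ZZ3"
    by (rule ZZ3.transformation_group_act) (use gen in \<open>auto simp: ZZ3_def\<close>)
  moreover have "torus_act ` {(1, 0, 0), (0, 1, 0), (0, 0, 1)} =
     {\<lambda>v. vector [v$1 + 1, v$2, v$3], \<lambda>v. vector [v$1, v$2 + 1, v$3], \<lambda>v. vector [v$1, v$2, v$3 + 1]}"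
    by (simp add: torus_act_def add.commute)
  ultimately have "G1 = orbit_space (torus_act ` carrier ZZ3)" by (simp add: G1_def)
  then show ?thesis
    using presents_orbit_space[OF ZZ3.is_group ZZ3.act_mult ZZ3.act_one refl] by (simp add: ZZ3_def)
qed

section \<open>The group of the half-turn manifold\<close>

definition SZ3 :: "(int \<times> int \<times> int) monoid" where
  "SZ3 = \<lparr>carrier = UNIV, mult = (\<lambda>(a, b, c) (a', b', c'). (a + psign c * a', b + psign c * b', c + c')),
     one = (0, 0, 0)\<rparr>"

text \<open>The triple \<open>(a, b, c)\<close> acts as x^a y^b z^c in the generators of
  \<open>G2\<close>. As an abstract group, \<open>SZ3\<close> is the semidirect product of Z^2 with
  Z acting through signs.\<close>

definition half_turn_act :: "int \<times> int \<times> int \<Rightarrow> real^3 \<Rightarrow> real^3" where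
  "half_turn_act = (\<lambda>(a, b, c) v. vector [of_int a + psign c * v $ 1, of_int b + psign c * v $ 2, of_int c + v $ 3])"

interpretation SZ3: group SZ3
proof (rule groupI)
  show "\<exists>y\<in>carrier SZ3. y \<otimes>\<^bsub>SZ3\<^esub> x = \<one>\<^bsub>SZ3\<^esub>" for x
  proof (cases x)
    case (fields a b c)
    then show ?thesis
      by (intro bexI[of _ "(- psign c * a, - psign c * b, - c)"]) (simp_all add: SZ3_def)
  qed
qed (auto simp: SZ3_def algebra_simps)

interpretation SZ3: isometric_action SZ3 half_turn_act
proof
  show "dist (half_turn_act g x) (half_turn_act g y) = dist x y" for g x y
    using dist_signed_motion[of _ _ x _ _ _ 0 y] by (cases g) (simp add: half_turn_act_def)
  fix g :: "int \<times> int \<times> int" and x assume "g \<noteq> \<one>\<^bsub>SZ3\<^esub>"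
  moreover obtain a b c where g: "g = (a, b, c)" by (cases g)
  ultimately have "a \<noteq> 0 \<or> b \<noteq> 0 \<or> c \<noteq> 0" by (simp add: SZ3_def)
  then show "1 \<le> dist x (half_turn_act g x)"
    using dist_le_component[of x 1 "half_turn_act g x"] dist_le_component[of x 2 "half_turn_act g x"]
      dist_le_component[of x 3 "half_turn_act g x"] one_le_abs_of_int[of a] one_le_abs_of_int[of b] one_le_abs_of_int[of c]
    by (cases "c = 0") (auto simp: half_turn_act_def g)
qed (auto simp: SZ3_def half_turn_act_def fun_eq_iff vec_eq_iff forall_3 algebra_simps)

lemma G2_presented: "presents half_turn_act UNIV G2 (orbit_of (half_turn_act ` UNIV))"
proof -
  have gen: "t \<in> generate SZ3 {(1, 0, 0), (0, 1, 0), (0, 0, 1)}" (is "_ \<in> ?A") for t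
  proof -
    have mult: "u \<otimes>\<^bsub>SZ3\<^esub> v \<in> ?A" if "u \<in> ?A" "v \<in> ?A" for u v
      using generate.eng[OF that] .
    have inv: "inv\<^bsub>SZ3\<^esub> u \<in> ?A" if "u \<in> ?A" for u
      using SZ3.generate_m_inv_closed[of "{(1, 0, 0), (0, 1, 0), (0, 0, 1)}" u] that by (simp add: SZ3_def)
    have gens: "(1, 0, 0) \<in> ?A" "(0, 1, 0) \<in> ?A" "(0, 0, 1) \<in> ?A" by (auto intro: generate.incl)
    have "inv\<^bsub>SZ3\<^esub> (1, 0, 0) = (-1, 0, 0)" "inv\<^bsub>SZ3\<^esub> (0, 1, 0) = (0, -1, 0)" "inv\<^bsub>SZ3\<^esub> (0, 0, 1) = (0, 0, -1)"
      by (rule SZ3.inv_equality; simp add: SZ3_def)+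
    then have invs: "(-1, 0, 0) \<in> ?A" "(0, -1, 0) \<in> ?A" "(0, 0, -1) \<in> ?A"
      using inv gens by metis+
    have "(a, 0, 0) \<in> ?A \<and> (0, a, 0) \<in> ?A \<and> (0, 0, a) \<in> ?A" for a
    proof (induction a rule: int_induct[where k = 0])
      case base
      then show ?case using generate.one[of SZ3] by (simp add: SZ3_def)
    next
      case (step1 i)
      then show ?case using gens mult[of "(i, 0, 0)" "(1, 0, 0)"] mult[of "(0, i, 0)" "(0, 1, 0)"]
          mult[of "(0, 0, i)" "(0, 0, 1)"] by (simp add: SZ3_def)
    next
      case (step2 i)
      then show ?case using invs mult[of "(i, 0, 0)" "(-1, 0, 0)"] mult[of "(0, i, 0)" "(0, -1, 0)"]
          mult[of "(0, 0, i)" "(0, 0, -1)"] by (simp add: SZ3_def)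
    qed
    then have "(a, 0, 0) \<otimes>\<^bsub>SZ3\<^esub> ((0, b, 0) \<otimes>\<^bsub>SZ3\<^esub> (0, 0, c)) \<in> ?A" for a b c
      using mult by blast
    then show ?thesis by (cases t) (simp add: SZ3_def)
  qed
  have "transformation_group (half_turn_act ` {(1, 0, 0), (0, 1, 0), (0, 0, 1)}) = half_turn_act ` carrier SZ3"
    by (rule SZ3.transformation_group_act) (use gen in \<open>auto simp: SZ3_def\<close>)
  moreover have "half_turn_act ` {(1, 0, 0), (0, 1, 0), (0, 0, 1)} =
     {\<lambda>v. vector [v$1 + 1, v$2, v$3], \<lambda>v. vector [v$1, v$2 + 1, v$3], \<lambda>v. vector [- (v$1), - (v$2), v$3 + 1]}"
    by (simp add: half_turn_act_def add.commute)
  ultimately have "G2 = orbit_space (half_turn_act ` carrier SZ3)" by (simp add: G2_def)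
  then show ?thesis
    using presents_orbit_space[OF SZ3.is_group SZ3.act_mult SZ3.act_one refl] by (simp add: SZ3_def)
qed

section \<open>The Hantzsche--Wendt group\<close>

definition HW :: "(int \<times> int \<times> int) monoid" where
  "HW = \<lparr>carrier = {(a, b, c). even (a + b + c)},
     mult = (\<lambda>(a, b, c) (a', b', c'). (a + psign b * a', b + psign c * b', c + psign a * c')),
     one = (0, 0, 0)\<rparr>"

text \<open>The three generating motions of \<open>G6\<close> are given by \<open>(1, 0, 1)\<close>,
  \<open>(1, 1, 0)\<close> and \<open>(0, 1, 1)\<close>.\<close>

definition hw_act :: "int \<times> int \<times> int \<Rightarrow> real^3 \<Rightarrow> real^3" where
  "hw_act = (\<lambda>(a, b, c) v. vector
     [of_int a + psign b * v $ 1, of_int b + psign c * v $ 2, of_int c + psign a * v $ 3])"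

abbreviation hw_mult (infixl "\<star>" 70) where
  "s \<star> t \<equiv> s \<otimes>\<^bsub>HW\<^esub> t"

abbreviation hw_inv where
  "hw_inv s \<equiv> inv\<^bsub>HW\<^esub> s"

abbreviation hw_index where
  "hw_index S \<equiv> card (rcosets\<^bsub>HW\<^esub> S)"

lemma carrier_HW [simp]: "(a, b, c) \<in> carrier HW \<longleftrightarrow> even (a + b + c)"
  and mult_HW [simp]: "(a, b, c) \<star> (a', b', c') = (a + psign b * a', b + psign c * b', c + psign a * c')"
  and one_HW [simp]: "\<one>\<^bsub>HW\<^esub> = (0, 0, 0)"
  by (simp_all add: HW_def)

interpretation HW: group HW
proof (rule groupI)
  show "\<exists>y\<in>carrier HW. y \<star> x = \<one>\<^bsub>HW\<^esub>" if "x \<in> carrier HW" for x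
  proof (cases x)
    case (fields a b c)
    then show ?thesis using that
      by (intro bexI[of _ "(- psign b * a, - psign c * b, - psign a * c)"]) auto
  qed
  show "\<one>\<^bsub>HW\<^esub> \<in> carrier HW" by simp
  show "x \<star> y \<in> carrier HW" if "x \<in> carrier HW" "y \<in> carrier HW" for x y
    using that by (cases x; cases y) (simp, blast)
  show "x \<star> y \<star> z = x \<star> (y \<star> z)" for x y z
    by (cases x; cases y; cases z) (simp add: algebra_simps)
  show "\<one>\<^bsub>HW\<^esub> \<star> x = x" for x by (cases x) simp
qed

lemma inv_HW [simp]:
  "even (a + b + c) \<Longrightarrow> hw_inv (a, b, c) = (- psign b * a, - psign c * b, - psign a * c)"
  by (rule HW.inv_equality) auto

text \<open>The factor \<open>1 - psign b\<close> is 0 or 2: on a coordinate that the motion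
  preserves, conjugation only changes the sign, whereas on a reflected coordinate it also shifts by
  twice the entry of \<open>s\<close>. So translations merely change signs, and conjugation by a
  translation, whose entries are even, shifts the reflected coordinates of a screw motion by
  multiples of four.\<close>

lemma conj_HW:
  assumes "even (s1 + s2 + s3)"
  shows "(s1, s2, s3) \<star> (a, b, c) \<star> hw_inv (s1, s2, s3) =
    (s1 * (1 - psign b) + psign s2 * a, s2 * (1 - psign c) + psign s3 * b, s3 * (1 - psign a) + psign s1 * c)"
  using assms by (simp add: algebra_simps)

interpretation HW: isometric_action HW hw_act
proof
  show "dist (hw_act g x) (hw_act g y) = dist x y" for g x y
    by (cases g) (simp add: hw_act_def dist_signed_motion)
  show "hw_act (g \<star> h) = hw_act g \<circ> hw_act h" for g h
    by (cases g; cases h) (simp add: hw_act_def fun_eq_iff vec_eq_iff forall_3 algebra_simps)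
  show "hw_act \<one>\<^bsub>HW\<^esub> = id"
    by (simp add: hw_act_def fun_eq_iff vec_eq_iff forall_3)
  fix g x assume g': "g \<in> carrier HW" "g \<noteq> \<one>\<^bsub>HW\<^esub>"
  obtain a b c where g: "g = (a, b, c)" by (cases g)
  \<comment> \<open>Along some axis the motion is a nonzero translation.\<close>
  have "even b \<and> a \<noteq> 0 \<or> even c \<and> b \<noteq> 0 \<or> even a \<and> c \<noteq> 0"
    using g' unfolding g by (cases "even a"; cases "even b") auto
  then show "1 \<le> dist x (hw_act g x)"
    using dist_le_component[of x 1 "hw_act g x"] dist_le_component[of x 2 "hw_act g x"]
      dist_le_component[of x 3 "hw_act g x"] one_le_abs_of_int[of a] one_le_abs_of_int[of b] one_le_abs_of_int[of c]
    by (auto simp: hw_act_def g)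
qed

lemma G6_presented: "presents hw_act (carrier HW) G6 (orbit_of (hw_act ` carrier HW))"
proof -
  let ?T = "{(1, 0, 1), (1, 1, 0), (0, 1, 1)} :: (int \<times> int \<times> int) set"
  have T: "?T \<subseteq> carrier HW" by auto
  have gen: "t \<in> generate HW ?T" (is "_ \<in> ?A") if t: "t \<in> carrier HW" for t
  proof -
    have mult: "u \<star> v \<in> ?A" if "u \<in> ?A" "v \<in> ?A" for u v
      using generate.eng[OF that] .
    have inv: "hw_inv u \<in> ?A" if "u \<in> ?A" for u
      using HW.generate_m_inv_closed[OF T that] .
    have gens: "(1, 0, 1) \<in> ?A" "(1, 1, 0) \<in> ?A" "(0, 1, 1) \<in> ?A" by (auto intro: generate.incl)
    \<comment> \<open>The squares of the generators span all translations of the group; each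
      remaining parity class is reached by multiplying a translation by one generator.\<close>
    then have twos: "(2, 0, 0) \<in> ?A" "(0, 2, 0) \<in> ?A" "(0, 0, 2) \<in> ?A"
      using mult[OF gens(1) gens(1)] mult[OF gens(2) gens(2)] mult[OF gens(3) gens(3)] by simp_all
    then have invs: "(-2, 0, 0) \<in> ?A" "(0, -2, 0) \<in> ?A" "(0, 0, -2) \<in> ?A"
      using inv[of "(2, 0, 0)"] inv[of "(0, 2, 0)"] inv[of "(0, 0, 2)"] by simp_all
    have "(2 * a, 0, 0) \<in> ?A \<and> (0, 2 * a, 0) \<in> ?A \<and> (0, 0, 2 * a) \<in> ?A" for a
    proof (induction a rule: int_induct[where k = 0])
      case base
      then show ?case using generate.one[of HW] by simp
    next
      case (step1 i)
      then show ?case using twos mult[of "(2 * i, 0, 0)" "(2, 0, 0)"] mult[of "(0, 2 * i, 0)" "(0, 2, 0)"]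
          mult[of "(0, 0, 2 * i)" "(0, 0, 2)"] by (simp add: algebra_simps)
    next
      case (step2 i)
      then show ?case using invs mult[of "(2 * i, 0, 0)" "(-2, 0, 0)"] mult[of "(0, 2 * i, 0)" "(0, -2, 0)"]
          mult[of "(0, 0, 2 * i)" "(0, 0, -2)"] by (simp add: algebra_simps)
    qed
    then have "(2 * a, 0, 0) \<star> ((0, 2 * b, 0) \<star> (0, 0, 2 * c)) \<in> ?A" for a b c
      using mult by blast
    then have even: "(a, b, c) \<in> ?A" if "even a" "even b" "even c" for a b c
      using that by (auto elim!: evenE)
    obtain a b c where abc: "t = (a, b, c)" by (cases t)
    then have "even (a + b + c)" using t by simp
    then consider "even a" "even b" "even c" | "odd a" "even b" "odd c" | "odd a" "odd b" "even c" | "even a" "odd b" "odd c"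
      by auto
    then show ?thesis
    proof cases
      case 1
      then show ?thesis using even abc by simp
    next
      case 2
      then show ?thesis using mult[OF even[of "a - 1" b "c - 1"] gens(1)] abc by simp
    next
      case 3
      then show ?thesis using mult[OF even[of "a - 1" "b - 1" c] gens(2)] abc by simp
    next
      case 4
      then show ?thesis using mult[OF even[of a "b - 1" "c - 1"] gens(3)] abc by simp
    qed
  qed
  have "transformation_group (hw_act ` ?T) = hw_act ` carrier HW"
    by (rule HW.transformation_group_act) (use gen T in auto)
  moreover have "hw_act ` ?T = {\<lambda>v. vector [v$1 + 1, - (v$2), - (v$3) + 1],
      \<lambda>v. vector [- (v$1) + 1, v$2 + 1, - (v$3)], \<lambda>v. vector [- (v$1), - (v$2) + 1, v$3 + 1]}"
    by (simp add: hw_act_def add.commute)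
  ultimately have "G6 = orbit_space (hw_act ` carrier HW)" by (simp add: G6_def)
  then show ?thesis
    using presents_orbit_space[OF HW.is_group HW.act_mult HW.act_one refl] by simp
qed

section \<open>Counting orbits\<close>

text \<open>A class \<open>C\<close> contributes \<open>card C\<close> summands, each equal to
  \<open>1 / card C\<close>. Orbit counting then reduces to evaluating the summand
  pointwise.\<close>

lemma card_quotient_sum:
  assumes X: "finite X" and E: "equiv X E"
  shows "real (card (X // E)) = (\<Sum>x\<in>X. 1 / real (card (E `` {x})))"
proof -
  have fin: "finite C" "C \<noteq> {}" if "C \<in> X // E" for C
    using that X E in_quotient_imp_subset[OF E that] in_quotient_imp_non_empty[OF E that]
    by (auto intro: finite_subset)
  have "(\<Sum>x\<in>X. 1 / real (card (E `` {x}))) = (\<Sum>x\<in>\<Union>(X // E). 1 / real (card (E `` {x})))"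
    using Union_quotient[OF E] by simp
  also have "\<dots> = (\<Sum>C\<in>X // E. \<Sum>x\<in>C. 1 / real (card (E `` {x})))"
    by (subst sum.Union_disjoint) (use fin quotient_disj[OF E] in \<open>blast | simp\<close>)+
  also have "\<dots> = (\<Sum>C\<in>X // E. 1)"
  proof (rule sum.cong[OF refl])
    fix C assume C: "C \<in> X // E"
    have "E `` {x} = C" if "x \<in> C" for x
      using C that E by (metis Image_singleton_iff equiv_class_eq_iff quotientE)
    then show "(\<Sum>x\<in>C. 1 / real (card (E `` {x}))) = 1"
      using fin[OF C] by simp
  qed
  finally show ?thesis by simp
qed

lemma card_quotient_involution:
  assumes X: "finite X" and E: "equiv X E" and cl: "\<And>x. x \<in> X \<Longrightarrow> E `` {x} = {x, f x}"
  shows "2 * real (card (X // E)) = (\<Sum>x\<in>X. 1 + of_bool (f x = x))"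
  unfolding card_quotient_sum[OF X E] sum_distrib_left
  by (rule sum.cong) (auto simp: cl card_insert_if)

text \<open>Burnside's lemma for the Klein four-group generated by two commuting involutions.
  Pointwise it says that four divided by the size of an orbit is the order of the
  stabiliser.\<close>

lemma card_quotient_klein:
  assumes X: "finite X" and E: "equiv X E" and cl: "\<And>x. x \<in> X \<Longrightarrow> E `` {x} = {x, f x, g x, f (g x)}"
    and f: "\<And>x. x \<in> X \<Longrightarrow> f (f x) = x" and g: "\<And>x. x \<in> X \<Longrightarrow> g (g x) = x"
    and fg: "\<And>x. x \<in> X \<Longrightarrow> f (g x) = g (f x)"
  shows "4 * real (card (X // E)) =
    real (card X) + real (card {x \<in> X. f x = x}) + real (card {x \<in> X. g x = x}) + real (card {x \<in> X. f (g x) = x})"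
proof -
  have "4 * (1 / real (card (E `` {x}))) =
      1 + of_bool (f x = x) + of_bool (g x = x) + of_bool (f (g x) = x)" if x: "x \<in> X" for x
  proof -
    have XX: "f x \<in> X" "g x \<in> X" "f (g x) \<in> X"
      using cl[OF x] E x by (auto simp: equiv_def refl_on_def)
    show ?thesis
      unfolding cl[OF x] using f[OF x] g[OF x] fg[OF x] f[OF XX(2)] g[OF XX(1)]
      by (cases "f x = x"; cases "g x = x"; cases "f x = g x"; auto simp: card_insert_if)
  qed
  then have "4 * real (card (X // E)) =
     (\<Sum>x\<in>X. 1 + of_bool (f x = x) + of_bool (g x = x) + of_bool (f (g x) = x))"
    unfolding card_quotient_sum[OF X E] sum_distrib_left by (intro sum.cong) auto
  also have "\<dots> = real (card X) + real (card {x \<in> X. f x = x}) + real (card {x \<in> X. g x = x}) + real (card {x \<in> X. f (g x) = x})"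
    using X by (simp add: sum.distrib sum.If_cases of_bool_def Collect_conj_eq Int_commute)
  finally show ?thesis .
qed

section \<open>Sums over factorisations\<close>

text \<open>Factorisations of \<open>n / k\<close>. With the divisor kept as a multiplier the set is
  empty unless \<open>k\<close> divides \<open>n\<close>, which matches the convention for
  non-integral arguments.\<close>

definition triples :: "nat \<Rightarrow> nat \<Rightarrow> (nat \<times> nat \<times> nat) set" where
  "triples n k = {(a, b, c). 0 < a \<and> 0 < b \<and> 0 < c \<and> k * (a * b * c) = n}"

lemma triples_iff: "(a, b, c) \<in> triples n k \<longleftrightarrow> 0 < a \<and> 0 < b \<and> 0 < c \<and> k * (a * b * c) = n"
  by (simp add: triples_def)

lemma factor_triples_divide: "0 < k \<Longrightarrow> factor_triples (real n / real k) = triples n k"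
  unfolding factor_triples_def triples_def
  by (auto simp: field_simps simp flip: of_nat_mult)

lemma finite_triples:
  assumes "0 < n" shows "finite (triples n k)"
proof (rule finite_subset)
  have "a \<le> n \<and> b \<le> n \<and> c \<le> n" if "k * (a * b * c) = n" for a b c
    using that assms by (auto intro!: dvd_imp_le)
  then show "triples n k \<subseteq> {..n} \<times> {..n} \<times> {..n}" by (auto simp: triples_def)
qed simp

definition tsum :: "nat \<Rightarrow> nat \<Rightarrow> (nat \<Rightarrow> nat \<Rightarrow> nat \<Rightarrow> real) \<Rightarrow> real" where
  "tsum n k h = (\<Sum>(a, b, c)\<in>triples n k. h a b c)"

lemma tsum_add: "tsum n k (\<lambda>a b c. h a b c + h' a b c) = tsum n k h + tsum n k h'"
  and tsum_diff: "tsum n k (\<lambda>a b c. h a b c - h' a b c) = tsum n k h - tsum n k h'"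
  and tsum_mult: "tsum n k (\<lambda>a b c. r * h a b c) = r * tsum n k h"
  by (simp_all add: tsum_def sum.distrib sum_subtractf sum_distrib_left case_prod_unfold)

lemma tsum_cong:
  "(\<And>a b c. (a, b, c) \<in> triples n k \<Longrightarrow> h a b c = h' a b c) \<Longrightarrow> tsum n k h = tsum n k h'"
  unfolding tsum_def by (rule sum.cong) auto

text \<open>In the Hermite normal form the last factor carries the largest weight, in the
  definitions of \<open>omega\<close> and \<open>sigma2\<close> the first one does.\<close>

lemma tsum_reverse: "tsum n k (\<lambda>a b c. h c b a) = tsum n k h"
  unfolding tsum_def
  by (rule sum.reindex_bij_witness[of _ "\<lambda>(a, b, c). (c, b, a)" "\<lambda>(a, b, c). (c, b, a)"])
    (auto simp: triples_iff mult_ac)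

lemma tsum_filter:
  assumes "0 < n"
  shows "tsum n k (\<lambda>a b c. if P a b c then h a b c else 0) =
    (\<Sum>(a, b, c)\<in>{(a, b, c). (a, b, c) \<in> triples n k \<and> P a b c}. h a b c)"
  unfolding tsum_def
  by (rule sum.mono_neutral_cong_right) (use finite_triples[OF assms] in \<open>auto split: if_splits\<close>)

text \<open>An even factor is halved and its 2 is moved into \<open>k\<close>. This is how parity
  conditions on the factors produce arguments such as \<open>n/8\<close>, \<open>n/16\<close> and
  \<open>n/32\<close>.\<close>

lemma tsum_even:
  assumes "0 < n"
  shows "tsum n k (\<lambda>a b c. if even a then h a b c else 0) = tsum n (2 * k) (\<lambda>a b c. h (2 * a) b c)"
    "tsum n k (\<lambda>a b c. if even b then h a b c else 0) = tsum n (2 * k) (\<lambda>a b c. h a (2 * b) c)"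
    "tsum n k (\<lambda>a b c. if even c then h a b c else 0) = tsum n (2 * k) (\<lambda>a b c. h a b (2 * c))"
proof -
  show "tsum n k (\<lambda>a b c. if even a then h a b c else 0) = tsum n (2 * k) (\<lambda>a b c. h (2 * a) b c)"
    unfolding tsum_filter[OF assms] unfolding tsum_def
    by (rule sum.reindex_bij_witness[of _ "\<lambda>(a, b, c). (2 * a, b, c)" "\<lambda>(a, b, c). (a div 2, b, c)"])
      (auto simp: triples_iff mult_ac elim!: evenE)
  show "tsum n k (\<lambda>a b c. if even b then h a b c else 0) = tsum n (2 * k) (\<lambda>a b c. h a (2 * b) c)"
    unfolding tsum_filter[OF assms] unfolding tsum_def
    by (rule sum.reindex_bij_witness[of _ "\<lambda>(a, b, c). (a, 2 * b, c)" "\<lambda>(a, b, c). (a, b div 2, c)"])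
      (auto simp: triples_iff mult_ac elim!: evenE)
  show "tsum n k (\<lambda>a b c. if even c then h a b c else 0) = tsum n (2 * k) (\<lambda>a b c. h a b (2 * c))"
    unfolding tsum_filter[OF assms] unfolding tsum_def
    by (rule sum.reindex_bij_witness[of _ "\<lambda>(a, b, c). (a, b, 2 * c)" "\<lambda>(a, b, c). (a, b, c div 2)"])
      (auto simp: triples_iff mult_ac elim!: evenE)
qed

lemma omega_tsum: "0 < k \<Longrightarrow> omega (real n / real k) = tsum n k (\<lambda>a b c. real (b * c * c))"
  unfolding omega_def factor_triples_divide
  by (subst tsum_reverse[symmetric]) (simp add: tsum_def power2_eq_square mult_ac)

lemma sigma2_tsum: "0 < k \<Longrightarrow> sigma2 (real n / real k) = tsum n k (\<lambda>a b c. real c)"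
  unfolding sigma2_def factor_triples_divide
  by (subst tsum_reverse[symmetric]) (simp add: tsum_def)

lemma d3_tsum: "0 < k \<Longrightarrow> d3 (real n / real k) = tsum n k (\<lambda>a b c. 1)"
  unfolding d3_def factor_triples_divide by (simp add: tsum_def)

text \<open>The weight is the number of lattices with diagonal \<open>a\<close>, \<open>b\<close>,
  \<open>c\<close> that the half-turn about the first axis preserves; for odd \<open>a\<close> it is
  also the number of parameters of screw subgroups with this diagonal and a given axis. Halving an
  even \<open>b\<close> keeps the weight \<open>c\<close> and halving an even \<open>c\<close>
  doubles it, whence the coefficient 1 + 2 = 3.\<close>

lemma tsum_invariant_lattices:
  assumes "0 < n" "0 < k"
  shows "tsum n k (\<lambda>a b c. real c * (1 + of_bool (even b) + of_bool (even c))) =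
    sigma2 (real n / real k) + 3 * sigma2 (real n / real (2 * k))"
proof -
  have "tsum n k (\<lambda>a b c. real c * (1 + of_bool (even b) + of_bool (even c))) =
      tsum n k (\<lambda>a b c. real c) + tsum n k (\<lambda>a b c. if even b then real c else 0)
      + tsum n k (\<lambda>a b c. if even c then real c else 0)"
    unfolding tsum_add[symmetric] by (rule tsum_cong) (simp add: algebra_simps)
  also have "\<dots> = tsum n k (\<lambda>a b c. real c) + 3 * tsum n (2 * k) (\<lambda>a b c. real c)"
    using assms by (simp add: tsum_even tsum_mult)
  finally show ?thesis using assms by (simp add: sigma2_tsum del: of_nat_mult)
qed

lemma tsum_odd:
  assumes "0 < n"
  shows "tsum n k (\<lambda>a b c. of_bool (odd a) * h a b c) =
    tsum n k h - tsum n (2 * k) (\<lambda>a b c. h (2 * a) b c)"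
  unfolding tsum_even(1)[OF assms, symmetric] tsum_diff[symmetric]
  by (rule tsum_cong) simp

text \<open>Each oddness condition contributes the difference between the values at an argument and
  at its half. The third power of this difference operator has the coefficients 1, -3, 3,
  -1.\<close>

lemma tsum_all_odd:
  assumes "0 < n" "0 < k"
  shows "tsum n k (\<lambda>a b c. of_bool (odd a \<and> odd b \<and> odd c)) =
    d3 (real n / real k) - 3 * d3 (real n / real (2 * k)) + 3 * d3 (real n / real (4 * k)) - d3 (real n / real (8 * k))"
proof -
  let ?h = "\<lambda>a b c. 1 :: real"
  have c: "tsum n k (\<lambda>a b c. of_bool (odd c)) = tsum n k ?h - tsum n (2 * k) ?h" for k
    unfolding tsum_even(3)[OF assms(1), of k ?h, symmetric] tsum_diff[symmetric]
    by (rule tsum_cong) simp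
  have bc: "tsum n k (\<lambda>a b c. of_bool (odd b \<and> odd c)) =
      tsum n k (\<lambda>a b c. of_bool (odd c)) - tsum n (2 * k) (\<lambda>a b c. of_bool (odd c))" for k
    unfolding tsum_even(2)[OF assms(1), of k "\<lambda>a b c. of_bool (odd c)", symmetric] tsum_diff[symmetric]
    by (rule tsum_cong) simp
  have abc: "tsum n k (\<lambda>a b c. of_bool (odd a \<and> odd b \<and> odd c)) =
      tsum n k (\<lambda>a b c. of_bool (odd b \<and> odd c)) - tsum n (2 * k) (\<lambda>a b c. of_bool (odd b \<and> odd c))" for k
    unfolding tsum_even(1)[OF assms(1), of k "\<lambda>a b c. of_bool (odd b \<and> odd c)", symmetric] tsum_diff[symmetric]
    by (rule tsum_cong) simp
  show ?thesis
    using assms unfolding abc bc c by (simp only: d3_tsum) (simp add: mult_ac)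
qed

text \<open>This is the sum belonging to one screw axis. Oddness of \<open>a\<close> turns the
  weight of invariant lattices into the terms in \<open>sigma2\<close>. The two corrections are an
  all-odd sum at \<open>n/2\<close> and, after halving \<open>c\<close>, twice an all-odd sum at
  \<open>n/4\<close>: the pattern 1, -3, 3, -1 plus its double moved by one place is 1, -1, -3, 5,
  -2.\<close>

lemma tsum_mirror_pairs:
  assumes n: "0 < n"
  shows "tsum n 2 (\<lambda>a b c. of_bool (odd a) * (real c * (1 + of_bool (even b) + of_bool (even c))
      + of_bool (odd b \<and> odd c) + 2 * of_bool (odd b \<and> even c \<and> odd (c div 2)))) =
    sigma2 (n/2) + 2 * sigma2 (n/4) - 3 * sigma2 (n/8)
      + d3 (n/2) - d3 (n/4) - 3 * d3 (n/8) + 5 * d3 (n/16) - 2 * d3 (n/32)"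
proof -
  let ?s = "\<lambda>a b c. real c * (1 + of_bool (even b) + of_bool (even c))"
  have "tsum n 2 (\<lambda>a b c. of_bool (odd a) * (?s a b c
      + of_bool (odd b \<and> odd c) + 2 * of_bool (odd b \<and> even c \<and> odd (c div 2)))) =
    tsum n 2 (\<lambda>a b c. of_bool (odd a) * ?s a b c) + tsum n 2 (\<lambda>a b c. of_bool (odd a \<and> odd b \<and> odd c))
      + 2 * tsum n 2 (\<lambda>a b c. if even c then of_bool (odd a \<and> odd b \<and> odd (c div 2)) else 0)"
    unfolding tsum_add[symmetric] tsum_mult[symmetric] by (rule tsum_cong) (simp add: algebra_simps)
  also have "tsum n 2 (\<lambda>a b c. of_bool (odd a) * ?s a b c) =
      sigma2 (n/2) + 3 * sigma2 (n/4) - (sigma2 (n/4) + 3 * sigma2 (n/8))"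
    using tsum_invariant_lattices[OF n, of 2] tsum_invariant_lattices[OF n, of 4]
    unfolding tsum_odd[OF n] by simp
  also have "tsum n 2 (\<lambda>a b c. of_bool (odd a \<and> odd b \<and> odd c)) =
      d3 (n/2) - 3 * d3 (n/4) + 3 * d3 (n/8) - d3 (n/16)"
    using tsum_all_odd[OF n, of 2] by simp
  also have "tsum n 2 (\<lambda>a b c. if even c then of_bool (odd a \<and> odd b \<and> odd (c div 2)) else 0) =
      d3 (n/4) - 3 * d3 (n/8) + 3 * d3 (n/16) - d3 (n/32)"
    using tsum_all_odd[OF n, of 4] unfolding tsum_even(3)[OF n] by simp
  finally show ?thesis by simp
qed

section \<open>Hermite normal form of sublattices\<close>

lemma int_subgroup_cyclic:
  fixes A :: "int set"
  assumes diff: "\<And>i j. i \<in> A \<Longrightarrow> j \<in> A \<Longrightarrow> i - j \<in> A" and m: "m \<in> A" "0 < m"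
  obtains c where "0 < c" "\<And>k. k \<in> A \<longleftrightarrow> c dvd k"
proof -
  define c where "c = int (LEAST n. 0 < n \<and> int n \<in> A)"
  have "0 < nat m \<and> int (nat m) \<in> A" using m by simp
  from LeastI[of "\<lambda>n. 0 < n \<and> int n \<in> A", OF this] have c: "0 < c" "c \<in> A" by (simp_all add: c_def)
  have least: "c \<le> k" if "k \<in> A" "0 < k" for k
    unfolding c_def using Least_le[of "\<lambda>n. 0 < n \<and> int n \<in> A" "nat k"] that by simp
  have zero: "0 \<in> A" using diff[OF c(2) c(2)] by simp
  have uminus: "- i \<in> A" if "i \<in> A" for i using diff[OF zero that] by simp
  have mult: "c * k \<in> A" for k
  proof (induction k rule: int_induct[where k = 0])
    case (step1 i)
    then show ?case using diff[OF step1(2) uminus[OF c(2)]] by (simp add: algebra_simps)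
  next
    case (step2 i)
    then show ?case using diff[OF step2(2) c(2)] by (simp add: algebra_simps)
  qed (simp add: zero)
  have "c dvd k" if "k \<in> A" for k
  proof -
    have "k mod c \<in> A" using diff[OF that mult[of "k div c"]] by (simp add: minus_mult_div_eq_mod)
    then have "k mod c = 0" using least[of "k mod c"] c(1) by (smt (verit) pos_mod_bound pos_mod_sign)
    then show ?thesis by auto
  qed
  then show ?thesis using that[OF c(1)] mult by (auto elim!: dvdE)
qed

text \<open>The lattice spanned by the rows \<open>(a, x, y)\<close>, \<open>(0, b, z)\<close>,
  \<open>(0, 0, c)\<close> of an upper triangular matrix.\<close>

definition lat :: "int \<Rightarrow> int \<Rightarrow> int \<Rightarrow> int \<Rightarrow> int \<Rightarrow> int \<Rightarrow> (int \<times> int \<times> int) set" where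
  "lat a b c x y z = {(a * p, x * p + b * q, y * p + z * q + c * r) | p q r. True}"

text \<open>The multiples of the unit vectors express full rank. The diagonal entries generate the
  subgroups of Z formed by the last entries of the vectors \<open>(0, 0, k)\<close>, the middle
  entries of the vectors \<open>(0, j, k)\<close> and the first entries of all vectors of
  \<open>K\<close>; the remaining entries are reduced by the rows below them.\<close>

lemma lat_exists:
  assumes zero: "(0, 0, 0) \<in> K"
    and diff: "\<And>i j k i' j' k'. (i, j, k) \<in> K \<Longrightarrow> (i', j', k') \<in> K \<Longrightarrow> (i - i', j - j', k - k') \<in> K"
    and m: "0 < m" "(m, 0, 0) \<in> K" "(0, m, 0) \<in> K" "(0, 0, m) \<in> K"
  obtains a b c x y z where "0 < a" "0 < b" "0 < c" "0 \<le> x" "x < b" "0 \<le> y" "y < c" "0 \<le> z" "z < c"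
    "K = lat a b c x y z"
proof -
  have smul: "(n * i, n * j, n * k) \<in> K" if t: "(i, j, k) \<in> K" for n i j k
  proof (induction n rule: int_induct[where k = 0])
    case (step1 l)
    then show ?case using diff[OF step1(2) diff[OF zero t]] by (simp add: algebra_simps)
  next
    case (step2 l)
    then show ?case using diff[OF step2(2) t] by (simp add: algebra_simps)
  qed (simp add: zero)
  have add: "(i + i', j + j', k + k') \<in> K" if "(i, j, k) \<in> K" "(i', j', k') \<in> K" for i j k i' j' k'
    using diff[OF that(1) diff[OF zero that(2)]] by simp
  obtain c where c: "0 < c" "\<And>k. k \<in> {k. (0, 0, k) \<in> K} \<longleftrightarrow> c dvd k"
  proof (rule int_subgroup_cyclic[of "{k. (0, 0, k) \<in> K}" m])
    show "i - j \<in> {k. (0, 0, k) \<in> K}" if "i \<in> {k. (0, 0, k) \<in> K}" "j \<in> {k. (0, 0, k) \<in> K}" for i j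
      using diff[of 0 0 i 0 0 j] that by simp
  qed (use m in auto)
  obtain b where b: "0 < b" "\<And>j. j \<in> {j. \<exists>k. (0, j, k) \<in> K} \<longleftrightarrow> b dvd j"
  proof (rule int_subgroup_cyclic[of "{j. \<exists>k. (0, j, k) \<in> K}" m])
    show "i - j \<in> {j. \<exists>k. (0, j, k) \<in> K}" if "i \<in> {j. \<exists>k. (0, j, k) \<in> K}" "j \<in> {j. \<exists>k. (0, j, k) \<in> K}" for i j
      using diff[of 0 i _ 0 j] that by auto
  qed (use m in auto)
  obtain a where a: "0 < a" "\<And>i. i \<in> {i. \<exists>j k. (i, j, k) \<in> K} \<longleftrightarrow> a dvd i"
  proof (rule int_subgroup_cyclic[of "{i. \<exists>j k. (i, j, k) \<in> K}" m])
    show "i - j \<in> {i. \<exists>j k. (i, j, k) \<in> K}" if "i \<in> {i. \<exists>j k. (i, j, k) \<in> K}" "j \<in> {i. \<exists>j k. (i, j, k) \<in> K}" for i j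
      using diff that by blast
  qed (use m in auto)
  obtain z0 where z0: "(0, b, z0) \<in> K" using b(2)[of b] by auto
  define z where "z = z0 mod c"
  have z: "(0, b, z) \<in> K"
  proof -
    have "(0, 0, c * (z0 div c)) \<in> K" using c(2)[of "c * (z0 div c)"] by simp
    then show ?thesis using diff[OF z0] by (fastforce simp: z_def minus_mult_div_eq_mod)
  qed
  obtain x0 y0 where xy0: "(a, x0, y0) \<in> K" using a(2)[of a] by auto
  define x where "x = x0 mod b"
  \<comment> \<open>Reducing \<open>x0\<close> modulo \<open>b\<close> subtracts a multiple of
    \<open>(0, b, z)\<close>, which also changes the last entry.\<close>
  define y1 where "y1 = y0 - z * (x0 div b)"
  define y where "y = y1 mod c"
  have "(a, x, y1) \<in> K"
    using diff[OF xy0 smul[OF z, of "x0 div b"]]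
    by (simp add: x_def y1_def minus_mult_div_eq_mod mult.commute)
  moreover have "(0, 0, c * (y1 div c)) \<in> K" using c(2)[of "c * (y1 div c)"] by simp
  ultimately have xy: "(a, x, y) \<in> K"
    using diff by (fastforce simp: y_def minus_mult_div_eq_mod)
  have "K = lat a b c x y z"
  proof (intro equalityI subsetI)
    fix t assume t: "t \<in> K"
    obtain i j k where ijk: "t = (i, j, k)" by (cases t)
    then obtain p where p: "i = a * p" using a(2)[of i] t by (auto elim!: dvdE)
    then have "(0, j - x * p, k - y * p) \<in> K"
      using diff[OF _ smul[OF xy, of p], of i j k] t ijk by (simp add: mult.commute)
    moreover from this obtain q where q: "j - x * p = b * q" using b(2)[of "j - x * p"] by (auto elim!: dvdE)
    ultimately have "(0, 0, k - y * p - z * q) \<in> K"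
      using diff[OF _ smul[OF z, of q], of 0 "j - x * p" "k - y * p"] by (simp add: mult.commute)
    then obtain r where "k - y * p - z * q = c * r" using c(2) by (auto elim!: dvdE)
    then have "j = x * p + b * q" "k = y * p + z * q + c * r" using q by linarith+
    then show "t \<in> lat a b c x y z" using p ijk by (auto simp: lat_def)
  next
    fix t assume "t \<in> lat a b c x y z"
    then obtain p q r where t: "t = (a * p, x * p + b * q, y * p + z * q + c * r)" by (auto simp: lat_def)
    have "(0, 0, c) \<in> K" using c(2)[of c] by simp
    then have "(p * a + (q * 0 + r * 0), p * x + (q * b + r * 0), p * y + (q * z + r * c)) \<in> K"
      using add smul xy z by meson
    then show "t \<in> K" by (simp add: t mult.commute add.assoc)
  qed
  show ?thesis
    by (rule that[of a b c x y z]) (use a(1) b(1) c(1) \<open>K = lat a b c x y z\<close> in \<open>simp_all add: x_def y_def z_def\<close>)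
qed

lemma lat_mem1: "0 < a \<Longrightarrow> (\<exists>j k. (i, j, k) \<in> lat a b c x y z) \<longleftrightarrow> a dvd i"
  unfolding lat_def dvd_def by (simp, blast)

lemma lat_mem2: "0 < a \<Longrightarrow> (\<exists>k. (0, j, k) \<in> lat a b c x y z) \<longleftrightarrow> b dvd j"
  unfolding lat_def dvd_def by (simp, blast)

lemma lat_mem3: "0 < a \<Longrightarrow> 0 < b \<Longrightarrow> (0, 0, k) \<in> lat a b c x y z \<longleftrightarrow> c dvd k"
  by (auto simp: lat_def dvd_def)

lemma lat_mem_b: "0 < a \<Longrightarrow> 0 < b \<Longrightarrow> (0, b, k) \<in> lat a b c x y z \<longleftrightarrow> c dvd k - z"
  by (auto simp: lat_def dvd_def algebra_simps)

lemma lat_mem_a: "0 < a \<Longrightarrow> (a, j, k) \<in> lat a b c x y z \<longleftrightarrow> (\<exists>q r. j = x + b * q \<and> k = y + z * q + c * r)"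
  by (auto simp: lat_def)

lemma zdvd_antisym_pos: "0 < m \<Longrightarrow> 0 < n \<Longrightarrow> m dvd n \<Longrightarrow> n dvd m \<Longrightarrow> m = (n :: int)"
  by (simp add: zdvd_antisym_nonneg)

lemma dvd_diff_bounded:
  fixes c :: int
  assumes "c dvd x - y" "0 \<le> x" "x < c" "0 \<le> y" "y < c"
  shows "x = y"
  using assms by (metis mod_eq_dvd_iff mod_pos_pos_trivial)

text \<open>The diagonal is read off from the same three subgroups of Z as in the construction. The
  rows are then determined modulo the rows below, and the bounds single out one residue.\<close>

lemma lat_unique:
  assumes eq: "lat a b c x y z = lat a' b' c' x' y' z'"
    and 1: "0 < a" "0 < b" "0 < c" "0 \<le> x" "x < b" "0 \<le> y" "y < c" "0 \<le> z" "z < c"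
    and 2: "0 < a'" "0 < b'" "0 < c'" "0 \<le> x'" "x' < b'" "0 \<le> y'" "y' < c'" "0 \<le> z'" "z' < c'"
  shows "(a, b, c, x, y, z) = (a', b', c', x', y', z')"
proof -
  have a: "a = a'"
    using lat_mem1[OF 1(1), of _ b c x y z] lat_mem1[OF 2(1), of _ b' c' x' y' z'] 1 2
    unfolding eq by (metis dvd_refl zdvd_antisym_pos)
  have b: "b = b'"
    using lat_mem2[OF 1(1), of _ b c x y z] lat_mem2[OF 2(1), of _ b' c' x' y' z'] 1 2
    unfolding eq by (metis dvd_refl zdvd_antisym_pos)
  have c: "c = c'"
    using lat_mem3[OF 1(1,2), of _ c x y z] lat_mem3[OF 2(1,2), of _ c' x' y' z'] 1 2
    unfolding eq by (metis dvd_refl zdvd_antisym_pos)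
  have "c dvd z' - z"
    using lat_mem_b[OF 1(1,2), of z' c x y z] lat_mem_b[OF 2(1,2), of z' c' x' y' z'] eq b by simp
  then have z: "z' = z" using dvd_diff_bounded 1 2 c by simp
  obtain q r where q: "x' = x + b * q" "y' = y + z * q + c * r"
    using lat_mem_a[OF 1(1), of x' y' b c x y z] lat_mem_a[OF 2(1), of x' y' b' c' x' y' z'] eq a
    by (metis add.right_neutral mult_zero_right)
  then have "x' = x" using dvd_diff_bounded[of b x' x] 1 2 b by simp
  then have "q = 0" using q 1 by simp
  then have "y' = y" using dvd_diff_bounded[of c y' y] q 1 2 c by simp
  then show ?thesis using a b c z \<open>x' = x\<close> by simp
qed

section \<open>Subgroups of finite index\<close>

lemma (in group) rcos_mem_iff:
  assumes "subgroup H G" "x \<in> carrier G" "y \<in> carrier G"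
  shows "x \<in> H #> y \<longleftrightarrow> x \<otimes> inv y \<in> H"
proof
  assume "x \<in> H #> y"
  then obtain h where "h \<in> H" "x = h \<otimes> y" by (auto simp: r_coset_def)
  then show "x \<otimes> inv y \<in> H"
    using assms subgroup.mem_carrier[OF assms(1)] by (simp add: m_assoc)
next
  assume "x \<otimes> inv y \<in> H"
  moreover have "x = (x \<otimes> inv y) \<otimes> y" using assms by (simp add: m_assoc)
  ultimately show "x \<in> H #> y" by (auto simp: r_coset_def)
qed

lemma (in group) rcos_eq_iff:
  assumes "subgroup H G" "x \<in> carrier G" "y \<in> carrier G"
  shows "H #> x = H #> y \<longleftrightarrow> x \<in> H #> y"
  using assms rcos_self[OF assms(2,1)] repr_independence[of x H y] by blast

text \<open>\<open>T\<close> is a transversal of \<open>K\<close> in \<open>H\<close>. With a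
  representative \<open>r C\<close> for each coset of \<open>H\<close>, every coset of
  \<open>K\<close> is \<open>K #> (t \<otimes> r C)\<close> for exactly one pair. Since a bijection
  is exhibited, the formula is compatible with \<open>card\<close> being 0 on infinite sets.\<close>

lemma (in group) card_rcosets_mult:
  assumes H: "subgroup H G" and K: "subgroup K G" and "K \<subseteq> H" and T: "T \<subseteq> H"
    and rep: "\<And>h. h \<in> H \<Longrightarrow> \<exists>!t. t \<in> T \<and> h \<in> K #> t"
  shows "card (rcosets K) = card T * card (rcosets H)"
proof -
  have Hc: "x \<in> carrier G" if "x \<in> H" for x using subgroup.mem_carrier[OF H that] .
  define r where "r C = (SOME x. x \<in> C)" for C :: "'a set"
  have r: "r C \<in> C" "r C \<in> carrier G" "H #> r C = C" if C: "C \<in> rcosets H" for C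
  proof -
    have ne: "C \<noteq> {}" "C \<subseteq> carrier G"
      using C subgroup.rcosets_non_empty[OF H] subgroup.rcosets_carrier[OF H is_group C] by auto
    then show 1: "r C \<in> C" unfolding r_def using some_in_eq by blast
    then show 2: "r C \<in> carrier G" using ne by blast
    obtain x where "x \<in> carrier G" "C = H #> x" using C by (auto simp: RCOSETS_def)
    then show "H #> r C = C" using rcos_eq_iff[OF H 2] 1 by blast
  qed
  have "bij_betw (\<lambda>(t, C). K #> (t \<otimes> r C)) (T \<times> rcosets H) (rcosets K)"
  proof (rule bij_betw_imageI)
    show "inj_on (\<lambda>(t, C). K #> (t \<otimes> r C)) (T \<times> rcosets H)"
    proof (rule inj_onI, clarify)
      fix t C t' C'
      assume t: "t \<in> T" "t' \<in> T" and C: "C \<in> rcosets H" "C' \<in> rcosets H"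
        and eq: "K #> (t \<otimes> r C) = K #> (t' \<otimes> r C')"
      have tc: "t \<in> carrier G" "t' \<in> carrier G" "t \<in> H" "t' \<in> H" using t T Hc by auto
      obtain k where k: "k \<in> K" "t \<otimes> r C = k \<otimes> (t' \<otimes> r C')"
        using rcos_self[OF _ K, of "t \<otimes> r C"] eq tc r(2)[OF C(1)] by (auto simp: r_coset_def)
      have kc: "k \<in> carrier G" "k \<in> H" using k \<open>K \<subseteq> H\<close> Hc by auto
      have rC: "r C = (inv t \<otimes> k \<otimes> t') \<otimes> r C'"
        using k(2) tc kc r(2) C by (metis inv_closed inv_solve_left m_assoc m_closed)
      then have "r C \<in> H #> r C'"
        using tc kc subgroup.m_closed[OF H] subgroup.m_inv_closed[OF H] by (auto simp: r_coset_def)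
      then have "C = C'" using rcos_eq_iff[OF H] r C by metis
      then have "t = k \<otimes> t'" using k(2) tc kc r(2) C by (metis m_assoc m_closed right_cancel)
      then have "t \<in> K #> t'" using k by (auto simp: r_coset_def)
      moreover have "t \<in> K #> t" using rcos_self[OF tc(1) K] .
      ultimately have "t = t'" using rep[OF tc(3)] t by blast
      then show "t = t' \<and> C = C'" using \<open>C = C'\<close> by simp
    qed
    show "(\<lambda>(t, C). K #> (t \<otimes> r C)) ` (T \<times> rcosets H) = rcosets K"
    proof (intro equalityI subsetI)
      fix D assume "D \<in> (\<lambda>(t, C). K #> (t \<otimes> r C)) ` (T \<times> rcosets H)"
      then obtain t C where "t \<in> T" "C \<in> rcosets H" "D = K #> (t \<otimes> r C)" by blast
      then show "D \<in> rcosets K" using rcosetsI[OF subgroup.subset[OF K]] T Hc r(2) by blast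
    next
      fix D assume "D \<in> rcosets K"
      then obtain x where x: "x \<in> carrier G" "D = K #> x" by (auto simp: RCOSETS_def)
      let ?C = "H #> x"
      have C: "?C \<in> rcosets H" using rcosetsI[OF subgroup.subset[OF H]] x(1) .
      have "x \<in> H #> r ?C" using rcos_self[OF x(1) H] r(3)[OF C] by simp
      then obtain h where h: "h \<in> H" "x = h \<otimes> r ?C" by (auto simp: r_coset_def)
      then obtain t where t: "t \<in> T" "h \<in> K #> t" using rep by blast
      then obtain k where k: "k \<in> K" "h = k \<otimes> t" by (auto simp: r_coset_def)
      have c: "t \<in> carrier G" "k \<in> carrier G" "r ?C \<in> carrier G"
        using t T k \<open>K \<subseteq> H\<close> Hc r(2)[OF C] by auto
      then have "x \<in> K #> (t \<otimes> r ?C)"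
        using h k by (auto simp: r_coset_def m_assoc)
      then have "D = K #> (t \<otimes> r ?C)" using rcos_eq_iff[OF K x(1)] c x(2) by blast
      then show "D \<in> (\<lambda>(t, C). K #> (t \<otimes> r C)) ` (T \<times> rcosets H)" using t(1) C by force
    qed
  qed
  then show ?thesis by (metis bij_betw_same_card card_cartesian_product)
qed

lemma (in group) card_rcosets_iso:
  assumes \<phi>: "\<phi> \<in> iso G G" and H: "subgroup H G"
  shows "subgroup (\<phi> ` H) G \<and> card (rcosets (\<phi> ` H)) = card (rcosets H)"
proof -
  interpret \<phi>: group_hom G G \<phi>
    using \<phi> by (simp add: group_hom_def group_hom_axioms_def iso_def is_group)
  have inj: "inj_on \<phi> (carrier G)" and surj: "\<phi> ` carrier G = carrier G"
    using \<phi> by (auto simp: iso_def bij_betw_def)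
  have Hc: "H \<subseteq> carrier G" using subgroup.subset[OF H] .
  have coset: "(\<phi> ` H) #> \<phi> x = \<phi> ` (H #> x)" if "x \<in> carrier G" for x
  proof -
    have "(\<Union>h\<in>H. {\<phi> h \<otimes> \<phi> x}) = (\<Union>h\<in>H. {\<phi> (h \<otimes> x)})"
      by (rule SUP_cong) (use that Hc in auto)
    then show ?thesis by (simp add: r_coset_def image_UN)
  qed
  have "rcosets (\<phi> ` H) = ((`) \<phi>) ` (rcosets H)"
  proof -
    have "rcosets (\<phi> ` H) = (\<lambda>y. (\<phi> ` H) #> y) ` \<phi> ` carrier G"
      unfolding surj by (auto simp: RCOSETS_def)
    also have "\<dots> = (\<lambda>x. \<phi> ` (H #> x)) ` carrier G"
      unfolding image_image by (rule image_cong) (simp_all add: coset)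
    also have "\<dots> = ((`) \<phi>) ` (rcosets H)" by (auto simp: RCOSETS_def)
    finally show ?thesis .
  qed
  moreover have "inj_on ((`) \<phi>) (rcosets H)"
    using inj subgroup.rcosets_carrier[OF H is_group]
    by (meson PowI inj_on_image_Pow inj_on_subset subsetI)
  ultimately show ?thesis
    using \<phi>.subgroup_img_is_subgroup[OF H] by (simp add: card_image)
qed

lemma (in group) conjugation_iso:
  assumes g: "g \<in> carrier G"
  shows "(\<lambda>h. g \<otimes> h \<otimes> inv g) \<in> iso G G"
proof (rule isoI)
  show "(\<lambda>h. g \<otimes> h \<otimes> inv g) \<in> hom G G"
  proof (rule homI)
    fix x y assume "x \<in> carrier G" "y \<in> carrier G"
    then show "g \<otimes> (x \<otimes> y) \<otimes> inv g = g \<otimes> x \<otimes> inv g \<otimes> (g \<otimes> y \<otimes> inv g)"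
      using g by (simp add: m_assoc) (simp add: m_assoc[symmetric])
  qed (use g in simp)
  show "bij_betw (\<lambda>h. g \<otimes> h \<otimes> inv g) (carrier G) (carrier G)"
    by (rule bij_betw_byWitness[where f' = "\<lambda>h. inv g \<otimes> h \<otimes> g"])
      (use g in \<open>auto simp: m_assoc\<close>, simp_all add: m_assoc[symmetric])
qed

section \<open>Translation lattices and their index\<close>

definition evens :: "(int \<times> int \<times> int) set" where
  "evens = {(a, b, c). even a \<and> even b \<and> even c}"

text \<open>The translations are the triples with even entries, so a translation subgroup is
  \<open>double K\<close> for a lattice \<open>K\<close> in Z^3, to which the Hermite normal form
  applies.\<close>

definition double :: "(int \<times> int \<times> int) set \<Rightarrow> (int \<times> int \<times> int) set" where
  "double K = (\<lambda>(i, j, k). (2 * i, 2 * j, 2 * k)) ` K"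

lemma evens_iff [simp]: "(a, b, c) \<in> evens \<longleftrightarrow> even a \<and> even b \<and> even c"
  by (simp add: evens_def)

lemma double_iff [simp]: "(2 * i, 2 * j, 2 * k) \<in> double K \<longleftrightarrow> (i, j, k) \<in> K"
  by (force simp: double_def)

lemma mem_double_iff: "t \<in> double K \<longleftrightarrow> (\<exists>i j k. (i, j, k) \<in> K \<and> t = (2 * i, 2 * j, 2 * k))"
  by (auto simp: double_def image_iff split: prod.splits)

lemma mem_double_lat_iff: "t \<in> double (lat a b c x y z) \<longleftrightarrow>
    (\<exists>p q r. t = (2 * (a * p), 2 * (x * p + b * q), 2 * (y * p + z * q + c * r)))"
  unfolding mem_double_iff lat_def by blast

lemma double_subset_evens: "double K \<subseteq> evens"
  by (auto simp: double_def)

lemma subgroup_evens: "subgroup evens HW"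
  by (rule HW.subgroupI) (auto simp: evens_def)

lemma subgroup_double_lat: "subgroup (double (lat a b c x y z)) HW"
proof (rule HW.subgroupI)
  show "double (lat a b c x y z) \<subseteq> carrier HW" by (auto simp: double_def)
  have "(0, 0, 0) \<in> lat a b c x y z" unfolding lat_def by (simp, metis add.right_neutral mult_zero_right)
  then show "double (lat a b c x y z) \<noteq> {}" by (auto simp: double_def)
next
  fix s assume "s \<in> double (lat a b c x y z)"
  then obtain p q r where "s = (2 * (a * p), 2 * (x * p + b * q), 2 * (y * p + z * q + c * r))"
    unfolding mem_double_lat_iff by blast
  then have "hw_inv s = (2 * (a * (- p)), 2 * (x * (- p) + b * (- q)), 2 * (y * (- p) + z * (- q) + c * (- r)))"
    by (simp add: algebra_simps)
  then show "hw_inv s \<in> double (lat a b c x y z)" unfolding mem_double_lat_iff by blast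
next
  fix s t assume "s \<in> double (lat a b c x y z)" "t \<in> double (lat a b c x y z)"
  then obtain p q r p' q' r' where "s = (2 * (a * p), 2 * (x * p + b * q), 2 * (y * p + z * q + c * r))"
    "t = (2 * (a * p'), 2 * (x * p' + b * q'), 2 * (y * p' + z * q' + c * r'))"
    unfolding mem_double_lat_iff by blast
  then have "s \<star> t = (2 * (a * (p + p')), 2 * (x * (p + p') + b * (q + q')),
      2 * (y * (p + p') + z * (q + q') + c * (r + r')))"
    by (simp add: algebra_simps)
  then show "s \<star> t \<in> double (lat a b c x y z)" unfolding mem_double_lat_iff by blast
qed

text \<open>Two entries are free and the parity of the third is prescribed, which leaves half of the
  \<open>8 * a * b * c\<close> points.\<close>

lemma card_even_box:
  assumes "0 < a" "0 < b" "0 < c"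
  shows "card {(i, j, k). 0 \<le> i \<and> i < 2 * a \<and> 0 \<le> j \<and> j < 2 * b \<and> 0 \<le> k \<and> k < 2 * c \<and> even (i + j + k)} =
    nat (4 * a * b * c)"
proof -
  have "bij_betw (\<lambda>(i, j, k). (i, j, 2 * k + (i + j) mod 2)) ({0..<2 * a} \<times> {0..<2 * b} \<times> {0..<c})
     {(i, j, k). 0 \<le> i \<and> i < 2 * a \<and> 0 \<le> j \<and> j < 2 * b \<and> 0 \<le> k \<and> k < 2 * c \<and> even (i + j + k)}"
    (is "bij_betw ?f ?A ?B")
  proof (rule bij_betw_byWitness[where f' = "\<lambda>(i, j, k). (i, j, k div 2)"])
    show "\<forall>u\<in>?A. (\<lambda>(i, j, k). (i, j, k div 2)) (?f u) = u" by auto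
    have "2 * (k div 2) + (i + j) mod 2 = k" if "even (i + j + k)" for i j k :: int
      using that by presburger
    then show "\<forall>u\<in>?B. ?f ((\<lambda>(i, j, k). (i, j, k div 2)) u) = u" by auto
    have "0 \<le> 2 * k + m mod 2 \<and> 2 * k + m mod 2 < 2 * c" if "0 \<le> k" "k < c" for k m :: int
      using that by presburger
    moreover have "even (i + j + (2 * k + (i + j) mod 2))" for i j k :: int
      by presburger
    ultimately show "?f ` ?A \<subseteq> ?B" by auto
    have "0 \<le> k div 2 \<and> k div 2 < c" if "0 \<le> k" "k < 2 * c" for k :: int
      using that by presburger
    then show "(\<lambda>(i, j, k). (i, j, k div 2)) ` ?B \<subseteq> ?A" by auto
  qed
  then have "card ?A = card ?B" by (rule bij_betw_same_card)
  then have "card ?B = card ?A" by simp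
  also have "\<dots> = nat (2 * a) * (nat (2 * b) * nat c)" by (simp add: card_cartesian_product)
  also have "\<dots> = nat (4 * a * b * c)" using assms by (simp add: nat_mult_distrib)
  finally show ?thesis .
qed

text \<open>Left multiplication by a translation is addition. So each coset has a unique member in
  the box with edges \<open>2 * a\<close>, \<open>2 * b\<close>, \<open>2 * c\<close>, found by
  reducing the entries in turn with the rows of the matrix.\<close>

lemma card_rcosets_double_lat:
  assumes "0 < a" "0 < b" "0 < c"
  shows "hw_index (double (lat a b c x y z)) = nat (4 * a * b * c)"
proof -
  let ?K = "double (lat a b c x y z)"
  let ?T = "{(i, j, k). 0 \<le> i \<and> i < 2 * a \<and> 0 \<le> j \<and> j < 2 * b \<and> 0 \<le> k \<and> k < 2 * c \<and> even (i + j + k)}"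
  have "hw_index ?K = card ?T * hw_index (carrier HW)"
  proof (rule HW.card_rcosets_mult[OF HW.subgroup_self subgroup_double_lat])
    show "?K \<subseteq> carrier HW" using subgroup.subset[OF subgroup_double_lat] .
    show "?T \<subseteq> carrier HW" by auto
    fix t assume t: "t \<in> carrier HW"
    obtain i j k where ijk: "t = (i, j, k)" by (cases t)
    have mem: "t \<in> ?K #>\<^bsub>HW\<^esub> (i', j', k') \<longleftrightarrow> (\<exists>p q r. i = 2 * a * p + i' \<and>
        j = 2 * x * p + 2 * b * q + j' \<and> k = 2 * y * p + 2 * z * q + 2 * c * r + k')" for i' j' k'
    proof -
      have "t \<in> ?K #>\<^bsub>HW\<^esub> (i', j', k') \<longleftrightarrow> (\<exists>u. u \<in> ?K \<and> t = u \<star> (i', j', k'))"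
        unfolding r_coset_def by blast
      also have "\<dots> \<longleftrightarrow> (\<exists>p q r. t = (2 * (a * p), 2 * (x * p + b * q), 2 * (y * p + z * q + c * r)) \<star> (i', j', k'))"
        unfolding mem_double_lat_iff by blast
      finally show ?thesis by (simp add: ijk algebra_simps)
    qed
    define p where "p = i div (2 * a)"
    define q where "q = (j - 2 * x * p) div (2 * b)"
    define r where "r = (k - 2 * y * p - 2 * z * q) div (2 * c)"
    let ?t = "(i mod (2 * a), (j - 2 * x * p) mod (2 * b), (k - 2 * y * p - 2 * z * q) mod (2 * c))"
    have "even (i mod (2 * a)) \<longleftrightarrow> even i" "even ((j - 2 * x * p) mod (2 * b)) \<longleftrightarrow> even j"
      "even ((k - 2 * y * p - 2 * z * q) mod (2 * c)) \<longleftrightarrow> even k"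
      by (simp_all add: dvd_mod_iff)
    then have "?t \<in> ?T" using assms t ijk by simp
    moreover have "t \<in> ?K #>\<^bsub>HW\<^esub> ?t"
      unfolding mem
    proof (intro exI conjI)
      show "i = 2 * a * p + i mod (2 * a)" by (simp add: p_def)
      have "j - 2 * x * p = 2 * b * q + (j - 2 * x * p) mod (2 * b)" by (simp add: q_def)
      then show "j = 2 * x * p + 2 * b * q + (j - 2 * x * p) mod (2 * b)" by linarith
      have "k - 2 * y * p - 2 * z * q = 2 * c * r + (k - 2 * y * p - 2 * z * q) mod (2 * c)" by (simp add: r_def)
      then show "k = 2 * y * p + 2 * z * q + 2 * c * r + (k - 2 * y * p - 2 * z * q) mod (2 * c)" by linarith
    qed
    moreover have "t' = ?t" if t'T: "t' \<in> ?T" and t'K: "t \<in> ?K #>\<^bsub>HW\<^esub> t'" for t'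
    proof -
      obtain i' j' k' where t': "t' = (i', j', k')" by (cases t')
      then obtain p' q' r' where *: "i = 2 * a * p' + i'" "j = 2 * x * p' + 2 * b * q' + j'"
          "k = 2 * y * p' + 2 * z * q' + 2 * c * r' + k'"
        using t'K mem by blast
      have b: "0 \<le> i'" "i' < 2 * a" "0 \<le> j'" "j' < 2 * b" "0 \<le> k'" "k' < 2 * c"
        using t'T t' by auto
      have p: "p' = p" "i' = i mod (2 * a)" using * b by (simp_all add: p_def)
      have "j - 2 * x * p = 2 * b * q' + j'" using * p by simp
      then have q: "q' = q" "j' = (j - 2 * x * p) mod (2 * b)" using b by (simp_all add: q_def)
      have "k - 2 * y * p - 2 * z * q = 2 * c * r' + k'" using * p q by simp
      then have "k' = (k - 2 * y * p - 2 * z * q) mod (2 * c)" using b by simp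
      then show ?thesis using p q t' by simp
    qed
    ultimately show "\<exists>!t'. t' \<in> ?T \<and> t \<in> ?K #>\<^bsub>HW\<^esub> t'" by blast
  qed
  moreover have "rcosets\<^bsub>HW\<^esub> (carrier HW) = {carrier HW}"
    using HW.coset_join2[OF _ HW.subgroup_self] unfolding RCOSETS_def by (auto intro: exI[of _ "(0, 0, 0)"])
  ultimately show ?thesis using card_even_box[OF assms] by simp
qed

lemma even_multiples:
  assumes S: "subgroup S HW" and t: "(2 * i, 2 * j, 2 * k) \<in> S"
  shows "(2 * (n * i), 2 * (n * j), 2 * (n * k)) \<in> S"
proof (induction n rule: int_induct[where k = 0])
  case base
  then show ?case using subgroup.one_closed[OF S] by simp
next
  case (step1 n)
  show ?case using subgroup.m_closed[OF S step1(2) t] by (simp add: algebra_simps)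
next
  case (step2 n)
  have "(2 * (n * i), 2 * (n * j), 2 * (n * k)) \<star> hw_inv (2 * i, 2 * j, 2 * k) \<in> S"
    using subgroup.m_closed[OF S step2(2) subgroup.m_inv_closed[OF S t]] .
  then show ?case by (simp add: algebra_simps)
qed

text \<open>Two different multiples of the translation lie in the same coset, by the pigeonhole
  principle. Finiteness of the index is expressed by its being positive, as \<open>card\<close> of
  an infinite set is 0.\<close>

lemma finite_index_multiple:
  assumes S: "subgroup S HW" and fin: "0 < hw_index S"
  obtains m where "0 < m" "(2 * (m * i), 2 * (m * j), 2 * (m * k)) \<in> S"
proof -
  define f where "f m = S #>\<^bsub>HW\<^esub> (2 * (int m * i), 2 * (int m * j), 2 * (int m * k))" for m :: nat
  have "range f \<subseteq> rcosets\<^bsub>HW\<^esub> S"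
    unfolding f_def by (intro image_subsetI HW.rcosetsI[OF subgroup.subset[OF S]]) simp
  then have "\<not> inj f"
    using fin by (metis card_gt_0_iff finite_subset range_inj_infinite)
  then obtain l m where "f m = f l" "l < m"
    by (metis injI linorder_neqE_nat)
  then have "(2 * (int m * i), 2 * (int m * j), 2 * (int m * k)) \<star>
      hw_inv (2 * (int l * i), 2 * (int l * j), 2 * (int l * k)) \<in> S"
    using HW.rcos_eq_iff[OF S] HW.rcos_mem_iff[OF S] unfolding f_def by auto
  then have "(2 * ((int m - int l) * i), 2 * ((int m - int l) * j), 2 * ((int m - int l) * k)) \<in> S"
    by (simp add: algebra_simps)
  then show ?thesis using that[of "int m - int l"] \<open>l < m\<close> by simp
qed

lemma even_part_lat:
  assumes S: "subgroup S HW" and fin: "0 < hw_index S"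
  obtains a b c x y z where "0 < a" "0 < b" "0 < c" "0 \<le> x" "x < b" "0 \<le> y" "y < c" "0 \<le> z" "z < c"
    "S \<inter> evens = double (lat a b c x y z)"
proof -
  define K where "K = {(i, j, k). (2 * i, 2 * j, 2 * k) \<in> S}"
  have SK: "S \<inter> evens = double K"
    by (auto simp: K_def mem_double_iff elim!: evenE)
  obtain m1 m2 m3 where m: "0 < m1" "(2 * m1, 0, 0) \<in> S" "0 < m2" "(0, 2 * m2, 0) \<in> S" "0 < m3" "(0, 0, 2 * m3) \<in> S"
    using finite_index_multiple[OF S fin, of 1 0 0] finite_index_multiple[OF S fin, of 0 1 0]
      finite_index_multiple[OF S fin, of 0 0 1] by (metis mult.right_neutral mult_zero_right)
  let ?m = "m1 * m2 * m3"
  have "(?m, 0, 0) \<in> K" "(0, ?m, 0) \<in> K" "(0, 0, ?m) \<in> K"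
    using even_multiples[OF S, of m1 0 0 "m2 * m3"] even_multiples[OF S, of 0 m2 0 "m1 * m3"]
      even_multiples[OF S, of 0 0 m3 "m1 * m2"] m by (simp_all add: K_def mult_ac)
  moreover have "(i - i', j - j', k - k') \<in> K" if "(i, j, k) \<in> K" "(i', j', k') \<in> K" for i j k i' j' k'
  proof -
    have "(2 * i, 2 * j, 2 * k) \<star> hw_inv (2 * i', 2 * j', 2 * k') \<in> S"
      using that subgroup.m_closed[OF S] subgroup.m_inv_closed[OF S] by (simp only: K_def) blast
    then show ?thesis by (simp add: K_def algebra_simps)
  qed
  moreover have "(0, 0, 0) \<in> K" using subgroup.one_closed[OF S] by (simp add: K_def)
  moreover have "0 < ?m" using m by simp
  ultimately show ?thesis using lat_exists[of K ?m] that SK by metis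
qed

lemma even_quotient_iff:
  assumes "(a, b, c) \<in> carrier HW" "(a', b', c') \<in> carrier HW"
  shows "(a, b, c) \<star> hw_inv (a', b', c') \<in> evens \<longleftrightarrow>
    (even a \<longleftrightarrow> even a') \<and> (even b \<longleftrightarrow> even b')"
  using assms by auto

text \<open>Modulo translations an element is determined by the parities of its first two entries,
  the third being forced by the even sum. So \<open>T\<close> is a transversal of the translations
  in \<open>S\<close>.\<close>

lemma card_rcosets_even_part:
  assumes S: "subgroup S HW" and T: "T \<subseteq> S"
    and rep: "\<And>a b c. (a, b, c) \<in> S \<Longrightarrow>
      \<exists>!t. t \<in> T \<and> (even (fst t) \<longleftrightarrow> even a) \<and> (even (fst (snd t)) \<longleftrightarrow> even b)"
  shows "hw_index (S \<inter> evens) = card T * hw_index S"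
proof (rule HW.card_rcosets_mult[OF S])
  show K: "subgroup (S \<inter> evens) HW" using HW.subgroups_Inter_pair[OF S subgroup_evens] .
  fix h assume h: "h \<in> S"
  obtain a b c where abc: "h = (a, b, c)" by (cases h)
  have hc: "h \<in> carrier HW" using subgroup.mem_carrier[OF S h] .
  have "h \<in> (S \<inter> evens) #>\<^bsub>HW\<^esub> t \<longleftrightarrow> (even (fst t) \<longleftrightarrow> even a) \<and> (even (fst (snd t)) \<longleftrightarrow> even b)"
    if "t \<in> T" for t
  proof -
    obtain a' b' c' where t: "t = (a', b', c')" by (cases t)
    have "t \<in> S" using that T by blast
    then have tc: "t \<in> carrier HW" and "h \<star> hw_inv t \<in> S"
      using subgroup.mem_carrier[OF S] subgroup.m_closed[OF S h] subgroup.m_inv_closed[OF S] by blast+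
    then show ?thesis
      using HW.rcos_mem_iff[OF K hc tc] even_quotient_iff[of a b c a' b' c'] hc tc
      unfolding abc t by auto
  qed
  then show "\<exists>!t. t \<in> T \<and> h \<in> (S \<inter> evens) #>\<^bsub>HW\<^esub> t"
    using rep[of a b c] h unfolding abc by (metis (no_types, lifting))
qed (use T in auto)

section \<open>Translation subgroups\<close>

definition cyc :: "int \<times> int \<times> int \<Rightarrow> int \<times> int \<times> int" where
  "cyc = (\<lambda>(a, b, c). (c, a, b))"

lemma cyc_simp [simp]: "cyc (a, b, c) = (c, a, b)"
  by (simp add: cyc_def)

lemma cyc_cyc_cyc [simp]: "cyc (cyc (cyc t)) = t"
  by (cases t) simp

lemma inj_cyc: "inj cyc"
  by (metis cyc_cyc_cyc injI)

text \<open>The rule that takes the signs from the entries \<open>b\<close>, \<open>c\<close>,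
  \<open>a\<close> is invariant under rotation of the entries. Geometrically, \<open>cyc\<close>
  carries screw motions about the first axis to the second, from the second to the third, and from
  the third to the first.\<close>

lemma cyc_mult: "cyc (s \<star> t) = cyc s \<star> cyc t"
  by (cases s; cases t) simp

lemma cyc_carrier [simp]: "cyc t \<in> carrier HW \<longleftrightarrow> t \<in> carrier HW"
  by (cases t) (simp, blast)

lemma cyc_iso: "cyc \<in> iso HW HW"
proof (rule isoI)
  show "cyc \<in> hom HW HW" by (rule homI) (simp_all add: cyc_mult)
  show "bij_betw cyc (carrier HW) (carrier HW)"
    by (rule bij_betw_byWitness[where f' = "\<lambda>t. cyc (cyc t)"]) auto
qed

lemma cyc_inv: "t \<in> carrier HW \<Longrightarrow> cyc (hw_inv t) = hw_inv (cyc t)"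
  by (rule HW.inv_equality[symmetric]) (simp_all flip: cyc_mult)

abbreviation conj_HW_set :: "int \<times> int \<times> int \<Rightarrow> (int \<times> int \<times> int) set \<Rightarrow> (int \<times> int \<times> int) set" where
  "conj_HW_set s S \<equiv> (\<lambda>h. s \<star> h \<star> hw_inv s) ` S"

lemma cyc_conj: "s \<in> carrier HW \<Longrightarrow> cyc ` conj_HW_set s S = conj_HW_set (cyc s) (cyc ` S)"
  by (simp add: image_image cyc_mult cyc_inv)

definition translation_subgroups :: "nat \<Rightarrow> (int \<times> int \<times> int) set set" where
  "translation_subgroups n = {S. subgroup S HW \<and> hw_index S = n \<and> S \<subseteq> evens}"

lemma cyc_evens [simp]: "cyc t \<in> evens \<longleftrightarrow> t \<in> evens"
  by (cases t) auto

lemma cyc_translation_subgroups: "S \<in> translation_subgroups n \<Longrightarrow> cyc ` S \<in> translation_subgroups n"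
  using HW.card_rcosets_iso[OF cyc_iso, of S] by (auto simp: translation_subgroups_def)

text \<open>A diagonal satisfies \<open>4 * (a * b * c) = n\<close> and carries
  \<open>b * c * c\<close> reduced matrices, which is the weight of \<open>omega\<close> with the
  factors in reverse order.\<close>

definition hermite_params :: "nat \<Rightarrow> ((nat \<times> nat \<times> nat) \<times> int \<times> int \<times> int) set" where
  "hermite_params n = (SIGMA (a, b, c) : triples n 4. {0..<int b} \<times> {0..<int c} \<times> {0..<int c})"

definition hermite_lat :: "(nat \<times> nat \<times> nat) \<times> int \<times> int \<times> int \<Rightarrow> (int \<times> int \<times> int) set" where
  "hermite_lat = (\<lambda>((a, b, c), x, y, z). double (lat (int a) (int b) (int c) x y z))"

lemma double_eq_iff: "double K = double K' \<longleftrightarrow> K = K'"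
proof
  assume eq: "double K = double K'"
  have "(i, j, k) \<in> K \<longleftrightarrow> (i, j, k) \<in> K'" for i j k
    using double_iff[of i j k K] double_iff[of i j k K'] eq by simp
  then show "K = K'" by auto
qed simp

lemma hermite_lat_bij:
  assumes n: "0 < n"
  shows "bij_betw hermite_lat (hermite_params n) (translation_subgroups n)"
proof (rule bij_betw_imageI)
  show "inj_on hermite_lat (hermite_params n)"
  proof (rule inj_onI)
    fix u v assume u: "u \<in> hermite_params n" and v: "v \<in> hermite_params n" and eq: "hermite_lat u = hermite_lat v"
    obtain a b c x y z where u': "u = ((a, b, c), x, y, z)" by (metis prod_cases3)
    obtain a' b' c' x' y' z' where v': "v = ((a', b', c'), x', y', z')" by (metis prod_cases3)
    have "(int a, int b, int c, x, y, z) = (int a', int b', int c', x', y', z')"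
      by (rule lat_unique)
        (use u v eq in \<open>auto simp: u' v' hermite_lat_def hermite_params_def triples_iff double_eq_iff\<close>)
    then show "u = v" by (simp add: u' v')
  qed
  show "hermite_lat ` hermite_params n = translation_subgroups n"
  proof (intro equalityI subsetI)
    fix S assume "S \<in> hermite_lat ` hermite_params n"
    then obtain a b c x y z where abc: "(a, b, c) \<in> triples n 4" and S: "S = double (lat (int a) (int b) (int c) x y z)"
      by (auto simp: hermite_lat_def hermite_params_def)
    have "hw_index S = nat (4 * int a * int b * int c)"
      unfolding S by (rule card_rcosets_double_lat) (use abc in \<open>auto simp: triples_iff\<close>)
    also have "\<dots> = n" using abc by (auto simp: triples_iff nat_mult_distrib)
    finally show "S \<in> translation_subgroups n"
      unfolding translation_subgroups_def S using subgroup_double_lat double_subset_evens by blast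
  next
    fix S assume "S \<in> translation_subgroups n"
    then have S: "subgroup S HW" "hw_index S = n" "S \<subseteq> evens"
      by (auto simp: translation_subgroups_def)
    obtain a b c x y z where abc: "0 < a" "0 < b" "0 < c" and xyz: "0 \<le> x" "x < b" "0 \<le> y" "y < c" "0 \<le> z" "z < c"
      and eq: "S \<inter> evens = double (lat a b c x y z)"
      using even_part_lat[OF S(1)] S(2) n by metis
    then have Seq: "S = double (lat a b c x y z)" using S(3) by blast
    have "n = nat (4 * a * b * c)"
      using card_rcosets_double_lat[OF abc, of x y z] S(2) Seq by simp
    then have "(nat a, nat b, nat c) \<in> triples n 4"
      using abc by (simp add: triples_iff nat_mult_distrib)
    then have "((nat a, nat b, nat c), x, y, z) \<in> hermite_params n"
      using abc xyz by (simp add: hermite_params_def)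
    moreover have "hermite_lat ((nat a, nat b, nat c), x, y, z) = S"
      using abc Seq by (simp add: hermite_lat_def)
    ultimately show "S \<in> hermite_lat ` hermite_params n" by blast
  qed
qed

lemma finite_hermite_params: "0 < n \<Longrightarrow> finite (hermite_params n)"
  unfolding hermite_params_def by (intro finite_SigmaI) (auto simp: finite_triples)

lemma finite_translation_subgroups: "0 < n \<Longrightarrow> finite (translation_subgroups n)"
  using hermite_lat_bij finite_hermite_params bij_betw_finite by blast

lemma card_hermite_params_filter:
  assumes n: "0 < n"
  shows "real (card {u \<in> hermite_params n. P u}) =
    tsum n 4 (\<lambda>a b c. real (card {v \<in> {0..<int b} \<times> {0..<int c} \<times> {0..<int c}. P ((a, b, c), v)}))"
proof -
  have "{u \<in> hermite_params n. P u} =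
    (SIGMA t : triples n 4. {v \<in> (case t of (a, b, c) \<Rightarrow> {0..<int b} \<times> {0..<int c} \<times> {0..<int c}). P (t, v)})"
    by (auto simp: hermite_params_def)
  then have "real (card {u \<in> hermite_params n. P u}) =
    (\<Sum>t\<in>triples n 4. real (card {v \<in> (case t of (a, b, c) \<Rightarrow> {0..<int b} \<times> {0..<int c} \<times> {0..<int c}). P (t, v)}))"
    using finite_triples[OF n] by (simp add: card_SigmaI split: prod.splits)
  also have "\<dots> = tsum n 4 (\<lambda>a b c. real (card {v \<in> {0..<int b} \<times> {0..<int c} \<times> {0..<int c}. P ((a, b, c), v)}))"
    unfolding tsum_def by (intro sum.cong) auto
  finally show ?thesis .
qed

lemma card_translation_subgroups:
  assumes n: "0 < n"
  shows "real (card (translation_subgroups n)) = omega (n/4)"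
proof -
  have "real (card (translation_subgroups n)) = real (card {u \<in> hermite_params n. True})"
    using bij_betw_same_card[OF hermite_lat_bij[OF n]] by simp
  also have "\<dots> = tsum n 4 (\<lambda>a b c. real (b * c * c))"
    unfolding card_hermite_params_filter[OF n] by (simp add: card_cartesian_product mult_ac)
  also have "\<dots> = omega (n/4)" using omega_tsum[of 4 n] by simp
  finally show ?thesis .
qed

section \<open>Conjugation on lattices and its fixed points\<close>

definition flip1 :: "int \<times> int \<times> int \<Rightarrow> int \<times> int \<times> int" where
  "flip1 = (\<lambda>(a, b, c). (a, - b, - c))"

definition flip2 :: "int \<times> int \<times> int \<Rightarrow> int \<times> int \<times> int" where
  "flip2 = (\<lambda>(a, b, c). (- a, b, - c))"

lemma flips: "flip1 (flip1 t) = t" "flip2 (flip2 t) = t" "flip1 (flip2 t) = flip2 (flip1 t)"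
  by (cases t; simp add: flip1_def flip2_def)+

lemma flip2_cyc: "flip2 (cyc t) = cyc (flip1 t)"
  by (cases t) (simp add: flip1_def flip2_def)

lemma flip12_cyc: "flip1 (flip2 (cyc t)) = cyc (flip2 t)"
  by (cases t) (simp add: flip1_def flip2_def)

text \<open>A motion acts on translations through its linear part; \<open>flip1\<close>,
  \<open>flip2\<close> and their composition are the half-turns about the three axes.\<close>

lemma conj_evens:
  assumes "S \<subseteq> evens" "(a, b, c) \<in> carrier HW"
  shows "conj_HW_set (a, b, c) S = (if even a then if even b then S else flip1 ` flip2 ` S
    else if even b then flip1 ` S else flip2 ` S)"
proof -
  have conj: "(a, b, c) \<star> t \<star> hw_inv (a, b, c) =
     (if even a then if even b then t else flip1 (flip2 t) else if even b then flip1 t else flip2 t)"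
    if "t \<in> S" for t
  proof -
    obtain i j k where t: "t = (i, j, k)" by (cases t)
    then have "even i" "even j" "even k" using that assms(1) by auto
    moreover have "even (a + b + c)" using assms(2) by simp
    ultimately show ?thesis
      unfolding t conj_HW[OF \<open>even (a + b + c)\<close>] by (auto simp: flip1_def flip2_def)
  qed
  show ?thesis
    using conj by (auto simp: image_image intro!: image_cong)
qed

lemma mult_between:
  fixes c k :: int
  assumes "0 < c" "- c < c * k" "c * k < 2 * c"
  shows "k = 0 \<or> k = 1"
proof -
  have "- 1 < k" "k < 2"
    using assms mult_less_cancel_left_pos[OF assms(1), of "- 1" k] mult_less_cancel_left_pos[OF assms(1), of k 2]
    by (simp_all add: mult.commute)
  then show ?thesis by linarith
qed

text \<open>The last two rows have first entry 0 and are negated, so only the first row matters: the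
  lattice is preserved iff it contains \<open>(a, - x, - y)\<close>. Its difference from
  \<open>(a, x, y)\<close> must be a combination of the lower rows, and the bounds on
  \<open>x\<close> leave the coefficients 0 and -1 for the second row; these are the two
  alternatives.\<close>

lemma flip1_fixes_lat_iff:
  assumes abc: "0 < a" "0 < b" "0 < c" and xyz: "0 \<le> x" "x < b" "0 \<le> y" "y < c" "0 \<le> z" "z < c"
  shows "flip1 ` double (lat a b c x y z) = double (lat a b c x y z) \<longleftrightarrow>
    x = 0 \<and> c dvd 2 * y \<or> 2 * x = b \<and> z = 2 * y mod c"
proof
  assume fixed: "flip1 ` double (lat a b c x y z) = double (lat a b c x y z)"
  have "(a, x, y) \<in> lat a b c x y z"
    unfolding lat_mem_a[OF abc(1)] by (metis add.right_neutral mult_zero_right)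
  then have "flip1 (2 * a, 2 * x, 2 * y) \<in> double (lat a b c x y z)"
    using fixed double_iff by blast
  then have "(2 * a, 2 * - x, 2 * - y) \<in> double (lat a b c x y z)" by (simp add: flip1_def)
  then have "(a, - x, - y) \<in> lat a b c x y z" by (simp only: double_iff)
  then obtain q r where q: "- x = x + b * q" "- y = y + z * q + c * r"
    unfolding lat_mem_a[OF abc(1)] by blast
  then have bq: "2 * x = b * (- q)" by simp
  have "- q = 0 \<or> - q = 1" by (rule mult_between[OF abc(2)]; unfold bq[symmetric]; use xyz abc(2) in linarith)
  then consider "q = 0" | "q = - 1" by linarith
  then show "x = 0 \<and> c dvd 2 * y \<or> 2 * x = b \<and> z = 2 * y mod c"
  proof cases
    case 1
    then have "x = 0" "2 * y = c * (- r)" using q by simp_all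
    then show ?thesis by simp
  next
    case 2
    then have "2 * x = b" "2 * y = z + c * (- r)" using q by simp_all
    moreover from this have "2 * y mod c = z" using xyz by (simp only: mod_mult_self2) simp
    ultimately show ?thesis by simp
  qed
next
  assume *: "x = 0 \<and> c dvd 2 * y \<or> 2 * x = b \<and> z = 2 * y mod c"
  obtain q r where qr: "2 * x = b * q" "2 * y = z * q + c * r"
  proof (cases "x = 0 \<and> c dvd 2 * y")
    case True
    then show thesis using that[of 0] by (auto elim!: dvdE)
  next
    case False
    then have "2 * x = b * 1" "2 * y = z * 1 + c * (2 * y div c)" using * by auto
    then show thesis using that by blast
  qed
  have sub: "flip1 t \<in> double (lat a b c x y z)" if t_in: "t \<in> double (lat a b c x y z)" for t
  proof -
    obtain p' q' r' where t: "t = (2 * (a * p'), 2 * (x * p' + b * q'), 2 * (y * p' + z * q' + c * r'))"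
      using t_in unfolding mem_double_lat_iff by blast
    have "- (x * p') = x * p' + b * (- q * p')" using arg_cong[OF qr(1)[symmetric], of "\<lambda>t. t * p'"] by (simp add: algebra_simps)
    moreover have "- (y * p') = y * p' + z * (- q * p') + c * (- r * p')"
      using arg_cong[OF qr(2), of "\<lambda>t. t * p'"] by (simp add: algebra_simps)
    ultimately have "flip1 t = (2 * (a * p'), 2 * (x * p' + b * (- q * p' - q')), 2 * (y * p' + z * (- q * p' - q') + c * (- r * p' - r')))"
      unfolding t flip1_def by (simp add: algebra_simps)
    then show ?thesis unfolding mem_double_lat_iff by blast
  qed
  show "flip1 ` double (lat a b c x y z) = double (lat a b c x y z)"
    using sub flips(1) by (metis (no_types, lifting) equalityI image_eqI image_subsetI subsetI)
qed

text \<open>The two alternatives exclude each other. For \<open>x = 0\<close> there are one or two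
  values of \<open>y\<close>, according to the parity of \<open>c\<close>, and \<open>z\<close> is
  free; for \<open>2 * x = b\<close>, possible if \<open>b\<close> is even, \<open>y\<close> is free
  and determines \<open>z\<close>.\<close>

lemma card_flip1_params:
  fixes b c :: int
  assumes "0 < b" "0 < c"
  shows "card {(x, y, z). 0 \<le> x \<and> x < b \<and> 0 \<le> y \<and> y < c \<and> 0 \<le> z \<and> z < c \<and>
      (x = 0 \<and> c dvd 2 * y \<or> 2 * x = b \<and> z = 2 * y mod c)} =
    nat c * (1 + of_bool (even b) + of_bool (even c))" (is "card ?A = _")
proof -
  have half: "c dvd 2 * y \<longleftrightarrow> y = 0 \<or> 2 * y = c" if "0 \<le> y" "y < c" for y
  proof
    assume "c dvd 2 * y"
    then obtain k where k: "2 * y = c * k" by (auto elim: dvdE)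
    have "k = 0 \<or> k = 1" by (rule mult_between[OF assms(2)]; unfold k[symmetric]; use that assms in linarith)
    then show "y = 0 \<or> 2 * y = c" using k by auto
  qed auto
  define Y where "Y = (if even c then {0, c div 2} else {0})"
  define Z where "Z = (if even b then (\<lambda>y. (b div 2, y, 2 * y mod c)) ` {0..<c} else {})"
  have Y: "y \<in> Y \<longleftrightarrow> 0 \<le> y \<and> y < c \<and> c dvd 2 * y" for y
    using half[of y] assms by (auto simp: Y_def split: if_splits)
  have "{(x :: int, y, z). x = 0 \<and> 0 \<le> y \<and> y < c \<and> 0 \<le> z \<and> z < c \<and> c dvd 2 * y} = {0} \<times> Y \<times> {0..<c}"
  proof (rule Set.set_eqI)
    show "v \<in> {(x, y, z). x = 0 \<and> 0 \<le> y \<and> y < c \<and> 0 \<le> z \<and> z < c \<and> c dvd 2 * y} \<longleftrightarrow>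
        v \<in> {0} \<times> Y \<times> {0..<c}" for v :: "int \<times> int \<times> int"
      by (cases v) (simp add: Y conj_ac)
  qed
  moreover have "{(x, y, z). 2 * x = b \<and> 0 \<le> y \<and> y < c \<and> z = 2 * y mod c} = Z"
    by (auto simp: Z_def elim!: evenE)
  moreover have "?A = {(x, y, z). x = 0 \<and> 0 \<le> y \<and> y < c \<and> 0 \<le> z \<and> z < c \<and> c dvd 2 * y} \<union>
      {(x, y, z). 2 * x = b \<and> 0 \<le> y \<and> y < c \<and> z = 2 * y mod c}"
    using assms by auto
  ultimately have "?A = {0} \<times> Y \<times> {0..<c} \<union> Z" by (simp only:)
  moreover have "({0} \<times> Y \<times> {0..<c}) \<inter> Z = {}"
    using assms by (auto simp: Z_def split: if_splits)
  moreover have "card ({0} \<times> Y \<times> {0..<c}) = (1 + of_bool (even c)) * nat c"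
    using assms by (auto simp: Y_def card_cartesian_product card_insert_if)
  moreover have "card Z = of_bool (even b) * nat c"
    by (auto simp: Z_def card_image inj_on_def)
  moreover have "finite Y" "finite Z" by (auto simp: Y_def Z_def)
  ultimately show ?thesis
    using card_Un_disjoint[of "{0} \<times> Y \<times> {0..<c}" Z] by (simp add: algebra_simps)
qed

lemma card_flip1_fixed:
  assumes n: "0 < n"
  shows "real (card {S \<in> translation_subgroups n. flip1 ` S = S}) = sigma2 (n/4) + 3 * sigma2 (n/8)"
proof -
  have "{S \<in> translation_subgroups n. flip1 ` S = S} =
      hermite_lat ` {u \<in> hermite_params n. flip1 ` hermite_lat u = hermite_lat u}"
    unfolding bij_betw_imp_surj_on[OF hermite_lat_bij[OF n], symmetric] by blast
  moreover have "inj_on hermite_lat {u \<in> hermite_params n. flip1 ` hermite_lat u = hermite_lat u}"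
    using bij_betw_imp_inj_on[OF hermite_lat_bij[OF n]] by (rule inj_on_subset) auto
  ultimately have "real (card {S \<in> translation_subgroups n. flip1 ` S = S}) =
      real (card {u \<in> hermite_params n. flip1 ` hermite_lat u = hermite_lat u})"
    by (simp add: card_image)
  also have "\<dots> = tsum n 4 (\<lambda>a b c. real c * (1 + of_bool (even b) + of_bool (even c)))"
    unfolding card_hermite_params_filter[OF n]
  proof (rule tsum_cong)
    fix a b c assume abc: "(a, b, c) \<in> triples n 4"
    have "{v \<in> {0..<int b} \<times> {0..<int c} \<times> {0..<int c}. flip1 ` hermite_lat ((a, b, c), v) = hermite_lat ((a, b, c), v)} =
      {(x, y, z). 0 \<le> x \<and> x < int b \<and> 0 \<le> y \<and> y < int c \<and> 0 \<le> z \<and> z < int c \<and>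
      (x = 0 \<and> int c dvd 2 * y \<or> 2 * x = int b \<and> z = 2 * y mod int c)}"
    proof (rule Set.set_eqI)
      fix v :: "int \<times> int \<times> int"
      obtain x y z where v: "v = (x, y, z)" by (cases v)
      show "v \<in> {v \<in> {0..<int b} \<times> {0..<int c} \<times> {0..<int c}. flip1 ` hermite_lat ((a, b, c), v) = hermite_lat ((a, b, c), v)} \<longleftrightarrow>
        v \<in> {(x, y, z). 0 \<le> x \<and> x < int b \<and> 0 \<le> y \<and> y < int c \<and> 0 \<le> z \<and> z < int c \<and>
          (x = 0 \<and> int c dvd 2 * y \<or> 2 * x = int b \<and> z = 2 * y mod int c)}"
        using abc flip1_fixes_lat_iff[of "int a" "int b" "int c" x y z]
        by (simp add: v hermite_lat_def triples_iff cong: conj_cong)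
    qed
    then show "real (card {v \<in> {0..<int b} \<times> {0..<int c} \<times> {0..<int c}.
        flip1 ` hermite_lat ((a, b, c), v) = hermite_lat ((a, b, c), v)}) =
        real c * (1 + of_bool (even b) + of_bool (even c))"
      using card_flip1_params[of "int b" "int c"] abc by (simp add: triples_iff)
  qed
  also have "\<dots> = sigma2 (n/4) + 3 * sigma2 (n/8)"
    using tsum_invariant_lattices[OF n, of 4] by simp
  finally show ?thesis .
qed

text \<open>Rotation of the axes conjugates the half-turns into each other, so that one count of
  fixed lattices serves for all three.\<close>

lemma card_flip_fixed_cyc:
  assumes "\<And>t. f (cyc t) = cyc (g t)"
  shows "card {S \<in> translation_subgroups n. f ` S = S} = card {S \<in> translation_subgroups n. g ` S = S}"
proof -
  have eq: "f ` cyc ` S = cyc ` S \<longleftrightarrow> g ` S = S" for S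
  proof -
    have "f ` cyc ` S = cyc ` g ` S" by (simp add: image_image assms)
    then show ?thesis using inj_image_eq_iff[OF inj_cyc] by simp
  qed
  have "bij_betw ((`) cyc) {S \<in> translation_subgroups n. g ` S = S} {S \<in> translation_subgroups n. f ` S = S}"
  proof (rule bij_betw_byWitness[where f' = "\<lambda>S. cyc ` cyc ` S"])
    have cyc3: "cyc ` cyc ` cyc ` S = S" for S by (simp add: image_image)
    then show "\<forall>S\<in>{S \<in> translation_subgroups n. g ` S = S}. cyc ` cyc ` cyc ` S = S"
      "\<forall>S\<in>{S \<in> translation_subgroups n. f ` S = S}. cyc ` cyc ` cyc ` S = S" by blast+
    show "(`) cyc ` {S \<in> translation_subgroups n. g ` S = S} \<subseteq> {S \<in> translation_subgroups n. f ` S = S}"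
      using cyc_translation_subgroups eq by blast
    show "(\<lambda>S. cyc ` cyc ` S) ` {S \<in> translation_subgroups n. f ` S = S} \<subseteq> {S \<in> translation_subgroups n. g ` S = S}"
    proof (rule image_subsetI)
      fix S assume S: "S \<in> {S \<in> translation_subgroups n. f ` S = S}"
      then have "cyc ` cyc ` S \<in> translation_subgroups n" using cyc_translation_subgroups by blast
      moreover have "g ` cyc ` cyc ` S = cyc ` cyc ` S" using S eq[of "cyc ` cyc ` S"] unfolding cyc3 by blast
      ultimately show "cyc ` cyc ` S \<in> {S \<in> translation_subgroups n. g ` S = S}" by blast
    qed
  qed
  from bij_betw_same_card[OF this] show ?thesis by simp
qed

text \<open>The conjugates of a lattice are its images under the Klein four-group of half-turns. The
  identity fixes all lattices, and each of the three half-turns fixes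
  \<open>sigma2 (n/4) + 3 * sigma2 (n/8)\<close> of them.\<close>

lemma card_translation_classes:
  assumes n: "0 < n"
  shows "4 * real (card (translation_subgroups n // {(S, S'). S \<in> translation_subgroups n \<and>
      S' \<in> translation_subgroups n \<and> (\<exists>g\<in>carrier HW. S' = conj_HW_set g S)})) =
    omega (n/4) + 3 * sigma2 (n/4) + 9 * sigma2 (n/8)"
proof -
  let ?X = "translation_subgroups n"
  let ?f = "\<lambda>S. flip1 ` S" and ?g = "\<lambda>S. flip2 ` S"
  define E where "E = {(S, S'). S \<in> ?X \<and> S' \<in> ?X \<and> (\<exists>g\<in>carrier HW. S' = conj_HW_set g S)}"
  have conj_X: "conj_HW_set g S \<in> ?X" if "S \<in> ?X" "g \<in> carrier HW" for S g
  proof -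
    have "conj_HW_set g S \<subseteq> evens"
    proof -
      obtain a b c where g: "g = (a, b, c)" by (cases g)
      have S: "S \<subseteq> evens" using that by (simp add: translation_subgroups_def)
      have "flip1 ` A \<subseteq> evens" "flip2 ` A \<subseteq> evens" if "A \<subseteq> evens" for A
        using that by (auto simp: flip1_def flip2_def)
      then show ?thesis
        using S that(2) unfolding g conj_evens[OF S that(2)[unfolded g]] by simp
    qed
    then show ?thesis
      using that HW.card_rcosets_iso[OF HW.conjugation_iso[OF that(2)], of S]
      by (simp add: translation_subgroups_def)
  qed
  have cl: "E `` {S} = {S, ?f S, ?g S, ?f (?g S)}" if S: "S \<in> ?X" for S
  proof -
    have ev: "S \<subseteq> evens" using S by (simp add: translation_subgroups_def)
    have "E `` {S} = (\<lambda>g. conj_HW_set g S) ` carrier HW"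
      using S conj_X by (auto simp: E_def)
    also have "\<dots> = {S, ?f S, ?g S, ?f (?g S)}"
    proof (intro equalityI subsetI)
      fix S' assume "S' \<in> (\<lambda>g. conj_HW_set g S) ` carrier HW"
      then obtain a b c where "(a, b, c) \<in> carrier HW" "S' = conj_HW_set (a, b, c) S" by force
      then show "S' \<in> {S, ?f S, ?g S, ?f (?g S)}"
        using conj_evens[OF ev] by (auto split: if_splits)
    next
      \<comment> \<open>One conjugating element for each linear part: the identity and the three
        generators.\<close>
      have 1: "conj_HW_set (0, 0, 0) S = S" "conj_HW_set (1, 0, 1) S = ?f S"
        "conj_HW_set (1, 1, 0) S = ?g S" "conj_HW_set (0, 1, 1) S = ?f (?g S)"
        by (subst conj_evens[OF ev]; simp)+
      have 2: "(\<lambda>g. conj_HW_set g S) ` {(0, 0, 0), (1, 0, 1), (1, 1, 0), (0, 1, 1)} = {S, ?f S, ?g S, ?f (?g S)}"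
        by (simp only: image_insert image_empty 1)
      fix S' assume "S' \<in> {S, ?f S, ?g S, ?f (?g S)}"
      then have "S' \<in> (\<lambda>g. conj_HW_set g S) ` {(0, 0, 0), (1, 0, 1), (1, 1, 0), (0, 1, 1)}"
        unfolding 2 .
      then show "S' \<in> (\<lambda>g. conj_HW_set g S) ` carrier HW"
        by (rule rev_subsetD[OF _ image_mono]) simp
    qed
    finally show ?thesis .
  qed
  have flip: "?f (?f S) = S" "?g (?g S) = S" "?f (?g S) = ?g (?f S)" for S
    by (simp_all add: image_image flips)
  have "equiv ?X E"
  proof (rule equivI)
    show "refl_on ?X E" using cl by (intro refl_onI) (metis Image_singleton_iff insertI1)
    have EI: "(S, S') \<in> E \<longleftrightarrow> S \<in> ?X \<and> S' \<in> {S, ?f S, ?g S, ?f (?g S)}" for S S'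
    proof
      assume "(S, S') \<in> E"
      then show "S \<in> ?X \<and> S' \<in> {S, ?f S, ?g S, ?f (?g S)}"
        using cl[of S] unfolding E_def by (metis (no_types, lifting) Image_singleton_iff case_prodD mem_Collect_eq E_def)
    qed (use cl in blast)
    show "sym E"
    proof (rule symI)
      fix S S' assume SS': "(S, S') \<in> E"
      then have "S' \<in> ?X" by (simp add: E_def)
      moreover have "S \<in> {S', ?f S', ?g S', ?f (?g S')}"
        using SS' unfolding EI by (auto simp: image_image flips)
      ultimately show "(S', S) \<in> E" unfolding EI by blast
    qed
    show "trans E"
    proof (rule transI)
      fix S S' S'' assume "(S, S') \<in> E" "(S', S'') \<in> E"
      then show "(S, S'') \<in> E"
        unfolding EI by (elim conjE insertE emptyE; simp add: image_image flips)
    qed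
  qed (auto simp: E_def)
  then have "4 * real (card (?X // E)) = real (card ?X) + real (card {S \<in> ?X. ?f S = S}) +
      real (card {S \<in> ?X. ?g S = S}) + real (card {S \<in> ?X. ?f (?g S) = S})"
    by (intro card_quotient_klein finite_translation_subgroups n) (use cl flip in auto)
  also have "card {S \<in> ?X. ?g S = S} = card {S \<in> ?X. ?f S = S}"
    by (rule card_flip_fixed_cyc) (rule flip2_cyc)
  also have "card {S \<in> ?X. ?f (?g S) = S} = card {S \<in> ?X. ?g S = S}"
    using card_flip_fixed_cyc[of "\<lambda>t. flip1 (flip2 t)" flip2 n] flip12_cyc by (simp add: image_image)
  also have "card {S \<in> ?X. ?g S = S} = card {S \<in> ?X. ?f S = S}"
    by (rule card_flip_fixed_cyc) (rule flip2_cyc)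
  finally show ?thesis
    using card_flip1_fixed[OF n] card_translation_subgroups[OF n] unfolding E_def by simp
qed

section \<open>Subgroups with one screw axis\<close>

text \<open>The screw motions about the first axis: the linear part preserves the first coordinate
  and reflects the other two.\<close>

definition odd1 :: "(int \<times> int \<times> int) set" where
  "odd1 = {(a, b, c). odd a \<and> even b \<and> odd c}"

lemma odd1_iff [simp]: "(a, b, c) \<in> odd1 \<longleftrightarrow> odd a \<and> even b \<and> odd c"
  by (simp add: odd1_def)

definition screw :: "(int \<times> int \<times> int) set \<Rightarrow> bool" where
  "screw S \<longleftrightarrow> S \<subseteq> evens \<union> odd1 \<and> \<not> S \<subseteq> evens"

lemma even_diff:
  assumes S: "subgroup S HW" and "(2 * i, 2 * j, 2 * k) \<in> S" "(2 * i', 2 * j', 2 * k') \<in> S"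
  shows "(2 * (i - i'), 2 * (j - j'), 2 * (k - k')) \<in> S"
proof -
  have "(2 * i, 2 * j, 2 * k) \<star> hw_inv (2 * i', 2 * j', 2 * k') \<in> S"
    using subgroup.m_closed[OF S assms(2) subgroup.m_inv_closed[OF S assms(3)]] .
  then show ?thesis by (simp add: algebra_simps)
qed

text \<open>Take a translation \<open>v\<close> in \<open>S\<close> whose first entry
  \<open>2 * a\<close> is the least positive one. Conjugation by the screw motion \<open>h\<close>
  reverses the part of \<open>v\<close> across the axis, so twice this part lies in
  \<open>S\<close>. The first entry of \<open>h\<close> is an odd multiple of \<open>a\<close>,
  which makes \<open>a\<close> odd; comparing that multiple of \<open>v\<close> with
  \<open>h \<star> h\<close>, which is parallel to the axis, puts an odd multiple of the part across
  the axis into \<open>S\<close>. Hence the part itself lies in \<open>S\<close> and the lattice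
  splits orthogonally. Translations along the axis finally shorten the first entry of
  \<open>h\<close> to \<open>a\<close>.\<close>

lemma axis_structure:
  assumes S: "subgroup S HW" and fin: "0 < hw_index S" and h: "h \<in> S" "h \<in> odd1"
  obtains a p r where "0 < a" "odd a" "even p" "odd r" "(a, p, r) \<in> S" "(2 * a, 0, 0) \<in> S"
    "\<And>i j k. (2 * i, 2 * j, 2 * k) \<in> S \<Longrightarrow> a dvd i"
proof -
  obtain h1 h2 h3 where h123: "h = (h1, h2, h3)" by (cases h)
  have par: "odd h1" "even h2" "odd h3" using h h123 by auto
  obtain m where m: "0 < m" "(2 * m, 0, 0) \<in> S"
    using finite_index_multiple[OF S fin, of 1 0 0] by (metis mult.right_neutral mult_zero_right)
  define A where "A = {i. \<exists>j k. (2 * i, 2 * j, 2 * k) \<in> S}"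
  have "m \<in> A" using m(2) unfolding A_def by (intro CollectI exI[of _ 0]) simp
  moreover have "i - i' \<in> A" if "i \<in> A" "i' \<in> A" for i i'
    using that even_diff[OF S] unfolding A_def by blast
  ultimately obtain a where a: "0 < a" "\<And>i. i \<in> A \<longleftrightarrow> a dvd i"
    using int_subgroup_cyclic[of A m] m(1) by metis
  have "h \<star> h \<in> S" using subgroup.m_closed[OF S h(1) h(1)] .
  then have hh: "(2 * h1, 2 * 0, 2 * 0) \<in> S" using par by (simp add: h123)
  then have "h1 \<in> A" unfolding A_def by blast
  then obtain l' where l': "h1 = a * l'" using a(2) by (auto elim: dvdE)
  then have "odd a" "odd l'" using par by auto
  then obtain l where l: "l' = 2 * l + 1" by (auto elim: oddE)
  obtain x y where xy: "(2 * a, 2 * x, 2 * y) \<in> S" using a(2)[of a] unfolding A_def by auto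
  have "even (h1 + h2 + h3)" using par by simp
  then have "h \<star> (2 * a, 2 * x, 2 * y) \<star> hw_inv h = (2 * a, 2 * - x, 2 * - y)"
    unfolding h123 by (subst conj_HW) (use par in simp_all)
  moreover have "h \<star> (2 * a, 2 * x, 2 * y) \<star> hw_inv h \<in> S"
    using subgroup.m_closed[OF S subgroup.m_closed[OF S h(1) xy] subgroup.m_inv_closed[OF S h(1)]] .
  ultimately have "(2 * a, 2 * - x, 2 * - y) \<in> S" by simp
  from even_diff[OF S xy this] have 1: "(2 * 0, 2 * (2 * x), 2 * (2 * y)) \<in> S" by simp
  from even_diff[OF S even_multiples[OF S xy, of l'] hh]
  have 2: "(2 * 0, 2 * (l' * x), 2 * (l' * y)) \<in> S" by (simp add: l' mult.commute)
  from even_diff[OF S 2 even_multiples[OF S 1, of l]]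
  have 3: "(2 * 0, 2 * x, 2 * y) \<in> S" by (simp add: l algebra_simps)
  from even_diff[OF S xy 3] have aa: "(2 * a, 0, 0) \<in> S" by simp
  then have "(2 * (- l * a), 2 * (- l * 0), 2 * (- l * 0)) \<in> S"
    using even_multiples[OF S, of a 0 0 "- l"] by simp
  from subgroup.m_closed[OF S this h(1)] have "(a, h2, h3) \<in> S"
    by (simp add: h123 l' l algebra_simps)
  moreover have "a dvd i" if "(2 * i, 2 * j, 2 * k) \<in> S" for i j k
    using that a(2)[of i] unfolding A_def by blast
  ultimately show ?thesis using that[of a h2 h3] a(1) \<open>odd a\<close> par aa by blast
qed

text \<open>For odd \<open>a\<close>, even \<open>p\<close> and odd \<open>r\<close> this is the
  product of the translation by \<open>i\<close> times \<open>(0, 2 * b, 2 * z)\<close> plus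
  \<open>j\<close> times \<open>(0, 0, 2 * c)\<close> with the \<open>k\<close>-th power of the
  screw motion \<open>(a, p, r)\<close>. The square of the latter is \<open>(2 * a, 0, 0)\<close>,
  so \<open>p\<close> and \<open>r\<close> appear only for odd \<open>k\<close>.\<close>

definition screw_elt :: "int \<Rightarrow> int \<Rightarrow> int \<Rightarrow> int \<Rightarrow> int \<Rightarrow> int \<Rightarrow> int \<times> int \<times> int \<Rightarrow> int \<times> int \<times> int" where
  "screw_elt a b c z p r = (\<lambda>(k, i, j). (a * k, 2 * (b * i) + (if odd k then p else 0),
     2 * (z * i + c * j) + (if odd k then r else 0)))"

definition screw_group :: "int \<Rightarrow> int \<Rightarrow> int \<Rightarrow> int \<Rightarrow> int \<Rightarrow> int \<Rightarrow> (int \<times> int \<times> int) set" where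
  "screw_group a b c z p r = range (screw_elt a b c z p r)"

text \<open>With \<open>k\<close> moved to the last place this is the product of \<open>SZ3\<close>:
  the subgroups in question are copies of the half-turn group.\<close>

lemma screw_elt_mult:
  assumes "odd a" "even p" "odd r"
  shows "screw_elt a b c z p r (k, i, j) \<star> screw_elt a b c z p r (k', i', j') =
    screw_elt a b c z p r (k + k', i + psign k * i', j + psign k * j')"
  using assms by (simp add: screw_elt_def algebra_simps)

lemma screw_elt_carrier: "odd a \<Longrightarrow> even p \<Longrightarrow> odd r \<Longrightarrow> screw_elt a b c z p r t \<in> carrier HW"
  by (cases t) (simp add: screw_elt_def)

lemma screw_group_subgroup:
  assumes par: "odd a" "even p" "odd r"
  shows "subgroup (screw_group a b c z p r) HW"
proof (rule HW.subgroupI)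
  show "screw_group a b c z p r \<subseteq> carrier HW"
    using screw_elt_carrier[OF par] by (auto simp: screw_group_def)
  fix s assume "s \<in> screw_group a b c z p r"
  then obtain k i j where s: "s = screw_elt a b c z p r (k, i, j)" by (auto simp: screw_group_def)
  have "screw_elt a b c z p r (- k, - psign k * i, - psign k * j) \<star> s = \<one>\<^bsub>HW\<^esub>"
    unfolding s screw_elt_mult[OF par] by (simp add: screw_elt_def)
  then have "hw_inv s = screw_elt a b c z p r (- k, - psign k * i, - psign k * j)"
    using screw_elt_carrier[OF par] s by (intro HW.inv_equality) auto
  then show "hw_inv s \<in> screw_group a b c z p r" by (simp add: screw_group_def)
next
  fix s t assume "s \<in> screw_group a b c z p r" "t \<in> screw_group a b c z p r"
  then show "s \<star> t \<in> screw_group a b c z p r"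
    unfolding screw_group_def using screw_elt_mult[OF par] by fastforce
qed (simp add: screw_group_def)

lemma screw_group_evens:
  assumes par: "odd a" "even p" "odd r"
  shows "screw_group a b c z p r \<inter> evens = double (lat a b c 0 0 z)"
proof (rule Set.set_eqI)
  fix t
  have "t \<in> screw_group a b c z p r \<inter> evens \<longleftrightarrow> (\<exists>k i j. t = screw_elt a b c z p r (k, i, j) \<and> even k)"
  proof -
    have "screw_elt a b c z p r (k, i, j) \<in> evens \<longleftrightarrow> even k" for k i j
      using par by (simp add: screw_elt_def)
    then show ?thesis by (auto simp: screw_group_def)
  qed
  also have "\<dots> \<longleftrightarrow> (\<exists>l i j. t = screw_elt a b c z p r (2 * l, i, j))"
    by (metis dvd_triv_left evenE)
  also have "\<dots> \<longleftrightarrow> t \<in> double (lat a b c 0 0 z)"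
    unfolding mem_double_lat_iff screw_elt_def by (simp add: algebra_simps)
  finally show "t \<in> screw_group a b c z p r \<inter> evens \<longleftrightarrow> t \<in> double (lat a b c 0 0 z)" .
qed

lemma screw_group_screw:
  assumes par: "odd a" "even p" "odd r"
  shows "screw (screw_group a b c z p r)"
proof -
  have "screw_elt a b c z p r t \<in> evens \<union> odd1" for t
    using par by (cases t) (auto simp: screw_elt_def)
  moreover have "screw_elt a b c z p r (1, 0, 0) \<notin> evens"
    using par by (simp add: screw_elt_def)
  ultimately show ?thesis unfolding screw_def screw_group_def by blast
qed

text \<open>The translations have index two in \<open>S\<close>, and \<open>h\<close> represents the
  other coset.\<close>

lemma screw_card_rcosets:
  assumes S: "subgroup S HW" and "screw S" and ev: "S \<inter> evens = double (lat a b c x y z)" and abc: "0 < a" "0 < b" "0 < c"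
  shows "2 * hw_index S = nat (4 * a * b * c)"
proof -
  obtain h where h: "h \<in> S" "h \<in> odd1" using \<open>screw S\<close> by (auto simp: screw_def)
  have one: "(0, 0, 0) \<in> S" using subgroup.one_closed[OF S] by simp
  have "hw_index (S \<inter> evens) = card {(0, 0, 0), h} * hw_index S"
  proof (rule card_rcosets_even_part[OF S])
    fix a b c assume abc: "(a, b, c) \<in> S"
    then have b: "even b" using \<open>screw S\<close> by (auto simp: screw_def)
    obtain h1 h2 h3 where h123: "h = (h1, h2, h3)" by (cases h)
    then have par: "odd h1" "even h2" "odd h3" using h by auto
    show "\<exists>!t. t \<in> {(0, 0, 0), h} \<and> (even (fst t) \<longleftrightarrow> even a) \<and> (even (fst (snd t)) \<longleftrightarrow> even b)"
    proof (cases "even a")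
      case True
      show ?thesis by (rule ex1I[of _ "(0, 0, 0)"]) (use True b par h123 in auto)
    next
      case False
      show ?thesis by (rule ex1I[of _ h]) (use False b par h123 in auto)
    qed
  qed (use one h in auto)
  moreover have "h \<noteq> (0, 0, 0)" using h by auto
  ultimately show ?thesis using card_rcosets_double_lat[OF abc, of x y z] ev by simp
qed

lemma screw_group_reparam:
  assumes "\<And>t. screw_elt a b c z p r (\<tau> t) = screw_elt a b c z' p' r' t" and "surj \<tau>"
  shows "screw_group a b c z' p' r' = screw_group a b c z p r"
proof -
  have "screw_group a b c z' p' r' = range (\<lambda>t. screw_elt a b c z p r (\<tau> t))"
    by (simp add: screw_group_def assms(1))
  also have "\<dots> = screw_elt a b c z p r ` range \<tau>" by auto
  finally show ?thesis by (simp add: assms(2) screw_group_def)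
qed

lemma screw_group_mod: "screw_group a b c (z mod c) p r = screw_group a b c z p r"
proof -
  have "screw_group a b c (z' + c * m) p r = screw_group a b c z' p r" for z' m
  proof (rule screw_group_reparam)
    let ?\<tau> = "\<lambda>(k, i, j). (k, i, j + m * i)"
    show "screw_elt a b c z' p r (?\<tau> t) = screw_elt a b c (z' + c * m) p r t" for t
      by (cases t) (simp add: screw_elt_def algebra_simps)
    show "surj ?\<tau>"
      by (rule surjI[of _ "\<lambda>(k, i, j). (k, i, j - m * i)"]) auto
  qed
  from this[of "z mod c" "z div c"] show ?thesis by simp
qed

text \<open>Multiplying the screw motion by a translation across the axis changes
  \<open>(p, r)\<close> by twice a vector of the plane lattice spanned by \<open>(b, z)\<close> and
  \<open>(0, c)\<close>, and the group remains the same.\<close>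

lemma screw_group_shift:
  "screw_group a b c z (p + 2 * (b * i0)) (r + 2 * (z * i0 + c * j0)) = screw_group a b c z p r"
proof (rule screw_group_reparam)
  let ?\<tau> = "\<lambda>(k, i, j). if odd k then (k, i + i0, j + j0) else (k, i, j)"
  show "screw_elt a b c z p r (?\<tau> t) = screw_elt a b c z (p + 2 * (b * i0)) (r + 2 * (z * i0 + c * j0)) t" for t
    by (cases t) (simp add: screw_elt_def algebra_simps)
  show "surj ?\<tau>"
    by (rule surjI[of _ "\<lambda>(k, i, j). if odd k then (k, i - i0, j - j0) else (k, i, j)"]) auto
qed

text \<open>\<open>z\<close> is multiplied by the quotient of the signs with which conjugation acts
  on the last two coordinates. This quotient is \<open>psign s2\<close>, because the entries of the
  conjugating motion have an even sum.\<close>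

lemma conj_screw_group:
  assumes par: "odd a" "even p" "odd r" and s: "even (s1 + s2 + s3)"
  shows "conj_HW_set (s1, s2, s3) (screw_group a b c z p r) =
    screw_group a b c (psign s2 * z) (2 * s2 + psign s3 * p) (2 * s3 + psign s1 * r)"
proof -
  let ?\<tau> = "\<lambda>(k :: int, i :: int, j :: int). (psign s2 * k, psign s3 * i, psign s1 * j)"
  have signs: "psign s1 = psign s2 * (psign s3 :: int)" using s by (simp add: psign_def) presburger
  have "(s1, s2, s3) \<star> screw_elt a b c z p r t \<star> hw_inv (s1, s2, s3) =
      screw_elt a b c (psign s2 * z) (2 * s2 + psign s3 * p) (2 * s3 + psign s1 * r) (?\<tau> t)" for t
  proof -
    obtain k i j where t: "t = (k, i, j)" by (cases t)
    show ?thesis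
      unfolding t screw_elt_def prod.case conj_HW[OF s]
      using par by (cases "even k") (simp_all add: signs algebra_simps)
  qed
  then have "conj_HW_set (s1, s2, s3) (screw_group a b c z p r) =
      screw_elt a b c (psign s2 * z) (2 * s2 + psign s3 * p) (2 * s3 + psign s1 * r) ` range ?\<tau>"
    by (simp add: screw_group_def image_image)
  moreover have "surj ?\<tau>" by (rule surjI[of _ ?\<tau>]) auto
  ultimately show ?thesis by (simp add: screw_group_def)
qed

text \<open>The translations determine the lattice parameters, by uniqueness of the Hermite normal
  form. The screw motion \<open>(a, p', r')\<close> must then occur in the other group, necessarily
  with exponent 1, and comparing entries gives the condition on \<open>(p, r)\<close>.\<close>

lemma screw_group_eq_iff:
  assumes par: "odd a" "even p" "odd r" "odd a'" "even p'" "odd r'"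
    and pos: "0 < a" "0 < b" "0 < c" "0 \<le> z" "z < c" "0 < a'" "0 < b'" "0 < c'" "0 \<le> z'" "z' < c'"
  shows "screw_group a' b' c' z' p' r' = screw_group a b c z p r \<longleftrightarrow>
    a' = a \<and> b' = b \<and> c' = c \<and> z' = z \<and> (\<exists>i j. p' = p + 2 * (b * i) \<and> r' = r + 2 * (z * i + c * j))"
proof
  assume eq: "screw_group a' b' c' z' p' r' = screw_group a b c z p r"
  then have "double (lat a' b' c' 0 0 z') = double (lat a b c 0 0 z)"
    using screw_group_evens[OF par(1-3)] screw_group_evens[OF par(4-6)] by metis
  then have "lat a' b' c' 0 0 z' = lat a b c 0 0 z" by (simp add: double_eq_iff)
  then have "(a', b', c', 0 :: int, 0 :: int, z') = (a, b, c, 0, 0, z)"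
    by (rule lat_unique) (use pos in auto)
  then have abc: "a' = a" "b' = b" "c' = c" "z' = z" by auto
  have "screw_elt a' b' c' z' p' r' (1, 0, 0) \<in> screw_group a b c z p r"
    using eq unfolding screw_group_def by blast
  then obtain k i j where "screw_elt a' b' c' z' p' r' (1, 0, 0) = screw_elt a b c z p r (k, i, j)"
    unfolding screw_group_def by auto
  then have "k = 1" "p' = p + 2 * (b * i)" "r' = r + 2 * (z * i + c * j)"
    using abc pos by (auto simp: screw_elt_def)
  then show "a' = a \<and> b' = b \<and> c' = c \<and> z' = z \<and> (\<exists>i j. p' = p + 2 * (b * i) \<and> r' = r + 2 * (z * i + c * j))"
    using abc by blast
next
  assume "a' = a \<and> b' = b \<and> c' = c \<and> z' = z \<and> (\<exists>i j. p' = p + 2 * (b * i) \<and> r' = r + 2 * (z * i + c * j))"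
  then show "screw_group a' b' c' z' p' r' = screw_group a b c z p r"
    using screw_group_shift by blast
qed

text \<open>\<open>axis_structure\<close> supplies a screw motion and a translation along the axis,
  and the latter forces \<open>x = y = 0\<close> in the Hermite normal form of the
  translations.\<close>

lemma screw_is_screw_group:
  assumes S: "subgroup S HW" and fin: "0 < hw_index S" and "screw S"
  obtains a b c z p r where "0 < a" "0 < b" "0 < c" "0 \<le> z" "z < c" "odd a" "even p" "odd r"
    "S = screw_group a b c z p r" "2 * hw_index S = nat (4 * a * b * c)"
proof -
  obtain h where h: "h \<in> S" "h \<in> odd1" using \<open>screw S\<close> by (auto simp: screw_def)
  obtain a p r where a: "0 < a" "odd a" "even p" "odd r" and apr: "(a, p, r) \<in> S" and aa: "(2 * a, 0, 0) \<in> S"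
    and a_dvd: "\<And>i j k. (2 * i, 2 * j, 2 * k) \<in> S \<Longrightarrow> a dvd i"
    using axis_structure[OF S fin h] by metis
  obtain a' b c x y z where abc: "0 < a'" "0 < b" "0 < c" "0 \<le> x" "x < b" "0 \<le> y" "y < c" "0 \<le> z" "z < c"
    and ev: "S \<inter> evens = double (lat a' b c x y z)"
    using even_part_lat[OF S fin] by metis
  have K: "(i, j, k) \<in> lat a' b c x y z \<longleftrightarrow> (2 * i, 2 * j, 2 * k) \<in> S" for i j k
    using ev double_iff[of i j k "lat a' b c x y z"] by (metis IntE IntI dvd_triv_left evens_iff)
  have "a' = a"
  proof (rule zdvd_antisym_pos)
    have "(a', x, y) \<in> lat a' b c x y z"
      unfolding lat_mem_a[OF abc(1)] by (metis add.right_neutral mult_zero_right)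
    then show "a dvd a'" using K a_dvd by blast
    have "(a, 0, 0) \<in> lat a' b c x y z" using K aa by simp
    then show "a' dvd a" using lat_mem1[OF abc(1)] by blast
  qed (use a abc in auto)
  have "(a', 0, 0) \<in> lat a' b c x y z" using K aa \<open>a' = a\<close> by simp
  then obtain q q' where q: "0 = x + b * q" "0 = y + z * q + c * q'" unfolding lat_mem_a[OF abc(1)] by blast
  then have "x = 0" using dvd_diff_bounded[of b x 0] abc by (simp add: eq_neg_iff_add_eq_0[symmetric])
  then have "q = 0" using q abc by simp
  then have "y = 0" using q dvd_diff_bounded[of c y 0] abc by (simp add: eq_neg_iff_add_eq_0[symmetric])
  have ev': "S \<inter> evens = double (lat a b c 0 0 z)" using ev \<open>a' = a\<close> \<open>x = 0\<close> \<open>y = 0\<close> by simp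
  have sub: "screw_group a b c z p r \<subseteq> S"
  proof -
    have even_elt: "screw_elt a b c z p r (k, i, j) \<in> S" if "even k" for k i j
    proof -
      have "screw_elt a b c z p r (k, i, j) \<in> evens" using that a by (simp add: screw_elt_def)
      then show ?thesis
        using ev' screw_group_evens[OF a(2-4), of b c z] unfolding screw_group_def by blast
    qed
    have "screw_elt a b c z p r (k, i, j) \<in> S" for k i j
    proof (cases "even k")
      case True
      then show ?thesis by (rule even_elt)
    next
      case False
      have "screw_elt a b c z p r (k - 1, i, j) \<star> (a, p, r) \<in> S"
        using even_elt[of "k - 1" i j] False apr subgroup.m_closed[OF S] by simp
      moreover have "(a, p, r) = screw_elt a b c z p r (1, 0, 0)" by (simp add: screw_elt_def)
      ultimately show ?thesis using False by (simp add: screw_elt_mult[OF a(2-4)])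
    qed
    then show ?thesis by (auto simp: screw_group_def)
  qed
  have "S \<subseteq> screw_group a b c z p r"
  proof
    fix t assume t: "t \<in> S"
    show "t \<in> screw_group a b c z p r"
    proof (cases "t \<in> evens")
      case True
      then show ?thesis using t ev' screw_group_evens[OF a(2-4), of b c z] by blast
    next
      case False
      then have "t \<in> odd1" using t \<open>screw S\<close> by (auto simp: screw_def)
      obtain t1 t2 t3 where t123: "t = (t1, t2, t3)" by (cases t)
      have "t \<star> hw_inv (a, p, r) \<in> S"
        using subgroup.m_closed[OF S t subgroup.m_inv_closed[OF S apr]] .
      moreover have "t \<star> hw_inv (a, p, r) \<in> evens"
        using \<open>t \<in> odd1\<close> a t123 by simp
      ultimately have "t \<star> hw_inv (a, p, r) \<in> screw_group a b c z p r"
        using ev' screw_group_evens[OF a(2-4), of b c z] by blast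
      moreover have "(a, p, r) \<in> screw_group a b c z p r"
        unfolding screw_group_def by (rule range_eqI[of _ _ "(1, 0, 0)"]) (simp add: screw_elt_def)
      ultimately have "t \<star> hw_inv (a, p, r) \<star> (a, p, r) \<in> screw_group a b c z p r"
        using subgroup.m_closed[OF screw_group_subgroup[OF a(2-4)]] by blast
      moreover have "t \<in> carrier HW" "(a, p, r) \<in> carrier HW" using t apr subgroup.mem_carrier[OF S] by blast+
      ultimately show ?thesis by (simp add: HW.m_assoc del: mult_HW inv_HW one_HW)
    qed
  qed
  then have "S = screw_group a b c z p r" using sub by blast
  moreover have "2 * hw_index S = nat (4 * a * b * c)"
    using screw_card_rcosets[OF S \<open>screw S\<close> ev'] a abc by blast
  ultimately show ?thesis using that a abc by blast
qed

text \<open>Conjugation by a translation changes \<open>(p, r)\<close> by multiples of 4. Hence, writing \<open>p = 2 u\<close> and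
  \<open>r = 2 w + 1\<close>, only the parities of \<open>u\<close> and \<open>w\<close> modulo the lattice matter.\<close>

lemma conj_screw_group_iff:
  fixes a b c z u w a' b' c' z' u' w' :: int
  assumes odd: "odd a" "odd a'"
    and pos: "0 < a" "0 < b" "0 < c" "0 \<le> z" "z < c" "0 < a'" "0 < b'" "0 < c'" "0 \<le> z'" "z' < c'"
  shows "(\<exists>s\<in>carrier HW. screw_group a' b' c' z' (2 * u') (2 * w' + 1) =
      conj_HW_set s (screw_group a b c z (2 * u) (2 * w + 1))) \<longleftrightarrow>
    a' = a \<and> b' = b \<and> c' = c \<and> (\<exists>\<delta>\<in>{0, 1}. z' = (psign \<delta> * z) mod c \<and>
      (\<exists>i j. even (u' - u - \<delta> - b * i) \<and> even (w' - w - \<delta> - z' * i - c * j)))"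
proof
  assume "\<exists>s\<in>carrier HW. screw_group a' b' c' z' (2 * u') (2 * w' + 1) =
      conj_HW_set s (screw_group a b c z (2 * u) (2 * w + 1))"
  then obtain s1 s2 s3 where s: "even (s1 + s2 + s3)"
    and eq: "screw_group a' b' c' z' (2 * u') (2 * w' + 1) =
      conj_HW_set (s1, s2, s3) (screw_group a b c z (2 * u) (2 * w + 1))" by auto
  have "conj_HW_set (s1, s2, s3) (screw_group a b c z (2 * u) (2 * w + 1)) =
      screw_group a b c (psign s2 * z) (2 * s2 + psign s3 * (2 * u)) (2 * s3 + psign s1 * (2 * w + 1))"
    by (rule conj_screw_group[OF odd(1) _ _ s]) simp_all
  with eq have "screw_group a' b' c' z' (2 * u') (2 * w' + 1) =
      screw_group a b c ((psign s2 * z) mod c) (2 * s2 + psign s3 * (2 * u)) (2 * s3 + psign s1 * (2 * w + 1))"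
    unfolding screw_group_mod by (rule trans)
  then have abc: "a' = a" "b' = b" "c' = c" "z' = (psign s2 * z) mod c" and
    ij: "\<exists>i j. 2 * u' = 2 * s2 + psign s3 * (2 * u) + 2 * (b * i) \<and>
      2 * w' + 1 = 2 * s3 + psign s1 * (2 * w + 1) + 2 * (z' * i + c * j)"
    by (subst (asm) screw_group_eq_iff; use odd pos in auto)+
  obtain i j where ij: "2 * u' = 2 * s2 + psign s3 * (2 * u) + 2 * (b * i)"
      "2 * w' + 1 = 2 * s3 + psign s1 * (2 * w + 1) + 2 * (z' * i + c * j)" using ij by blast
  \<comment> \<open>Only the parity of \<open>s2\<close> matters: it decides whether the lattice is
    reflected, and the remaining conditions are congruences modulo 2.\<close>
  define \<delta> where "\<delta> = s2 mod 2"
  have "even (u' - u - s2 mod 2 - X)" if "2 * u' = 2 * s2 + psign s3 * (2 * u) + 2 * X" for X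
    using that by (cases "even s3"; simp; presburger)
  from this[OF ij(1)] have "even (u' - u - \<delta> - b * i)" by (simp add: \<delta>_def)
  moreover have "even (w' - w - s2 mod 2 - X)" if "2 * w' + 1 = 2 * s3 + psign s1 * (2 * w + 1) + 2 * X" for X
    using that s by (cases "even s1"; simp; presburger)
  from this[OF ij(2)] have "even (w' - w - \<delta> - z' * i - c * j)"
    by (simp only: \<delta>_def diff_diff_eq add.assoc)
  moreover have "\<delta> \<in> {0, 1}" "psign \<delta> = (psign s2 :: int)"
    by (auto simp: \<delta>_def psign_def)
  ultimately show "a' = a \<and> b' = b \<and> c' = c \<and> (\<exists>\<delta>\<in>{0, 1}. z' = (psign \<delta> * z) mod c \<and>
      (\<exists>i j. even (u' - u - \<delta> - b * i) \<and> even (w' - w - \<delta> - z' * i - c * j)))"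
    using abc by metis
next
  assume "a' = a \<and> b' = b \<and> c' = c \<and> (\<exists>\<delta>\<in>{0, 1}. z' = (psign \<delta> * z) mod c \<and>
      (\<exists>i j. even (u' - u - \<delta> - b * i) \<and> even (w' - w - \<delta> - z' * i - c * j)))"
  then obtain \<delta> i j where abc: "a' = a" "b' = b" "c' = c" and \<delta>: "\<delta> \<in> {0, 1}" "z' = (psign \<delta> * z) mod c"
    and ev: "even (u' - u - \<delta> - b * i)" "even (w' - w - \<delta> - z' * i - c * j)" by blast
  \<comment> \<open>\<open>s2\<close> solves the equation for \<open>u'\<close> when
    \<open>psign s3\<close> is 1, and \<open>s3\<close> solves the one for \<open>w'\<close> with
    the sign \<open>psign \<delta>\<close>; for \<open>\<delta> = 1\<close> this sign turns
    \<open>2 * w + 1\<close> into its negative, hence the summand \<open>w + 1\<close>. The parity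
    conditions make both choices compatible with the first entry \<open>\<delta>\<close>.\<close>
  define s2 where "s2 = u' - u - b * i"
  define s3 where "s3 = (if \<delta> = 0 then w' - w - z' * i - c * j else w' + w + 1 - z' * i - c * j)"
  have par: "even (\<delta> + s2 + s3)" "psign s2 = (psign \<delta> :: int)" "even s3"
  proof -
    have *: "even (\<delta> + (u' - u - X) + (if \<delta> = 0 then w' - w - Y - Z else w' + w + 1 - Y - Z)) \<and>
        (even (u' - u - X) \<longleftrightarrow> even \<delta>) \<and> even (if \<delta> = 0 then w' - w - Y - Z else w' + w + 1 - Y - Z)"
      if "even (u' - u - \<delta> - X)" "even (w' - w - \<delta> - Y - Z)" for X Y Z
      using that \<delta>(1) by (elim insertE emptyE; simp; presburger)
    show "even (\<delta> + s2 + s3)" "psign s2 = (psign \<delta> :: int)" "even s3"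
      using *[OF ev] by (simp_all add: s2_def s3_def psign_def)
  qed
  have "conj_HW_set (\<delta>, s2, s3) (screw_group a b c z (2 * u) (2 * w + 1)) =
      screw_group a b c z' (2 * s2 + psign s3 * (2 * u)) (2 * s3 + psign \<delta> * (2 * w + 1))"
    using odd par \<delta>(2) by (subst conj_screw_group) (simp_all add: screw_group_mod)
  also have "2 * s2 + psign s3 * (2 * u) = 2 * u' + 2 * (b * - i)" using par(3) by (simp add: s2_def)
  also have "2 * s3 + psign \<delta> * (2 * w + 1) = 2 * w' + 1 + 2 * (z' * - i + c * - j)"
    using \<delta>(1) by (auto simp: s3_def)
  finally have "conj_HW_set (\<delta>, s2, s3) (screw_group a b c z (2 * u) (2 * w + 1)) =
      screw_group a' b' c' z' (2 * u') (2 * w' + 1)"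
    unfolding screw_group_shift abc .
  then show "\<exists>s\<in>carrier HW. screw_group a' b' c' z' (2 * u') (2 * w' + 1) =
      conj_HW_set s (screw_group a b c z (2 * u) (2 * w + 1))"
    using par(1) by (intro bexI[of _ "(\<delta>, s2, s3)"]) simp_all
qed

text \<open>The left side is membership of \<open>(d, e)\<close> in the span of
  \<open>(b, z)\<close> and \<open>(0, c)\<close> over the field with two elements; the parity of
  \<open>d\<close> prescribes whether \<open>(b, z)\<close> is used when \<open>b\<close> is
  odd.\<close>

lemma parity_lattice_iff:
  fixes b c z d e :: int
  shows "(\<exists>i j. even (d - b * i) \<and> even (e - z * i - c * j)) \<longleftrightarrow>
    (if even d then even e \<or> odd c \<or> even b \<and> odd z else odd b \<and> (odd c \<or> even (e - z)))"
    (is "?L \<longleftrightarrow> ?R")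
proof
  assume ?R
  then consider "even d" "even e" | "even d" "odd c" | "even d" "even b" "odd z"
    | "odd d" "odd b" "odd c" | "odd d" "odd b" "even (e - z)" by (auto split: if_splits)
  then show ?L
  proof cases
    case 1
    then show ?thesis by (intro exI[of _ 0]) simp
  next
    case 2
    then show ?thesis by (intro exI[of _ 0] exI[of _ e]) simp
  next
    case 3
    then show ?thesis by (intro exI[of _ e] exI[of _ 0]) simp
  next
    case 4
    then show ?thesis by (intro exI[of _ 1] exI[of _ "e - z"]) simp
  next
    case 5
    then show ?thesis by (intro exI[of _ 1] exI[of _ 0]) simp
  qed
qed (auto split: if_splits)

text \<open>Representatives \<open>(u, w)\<close> of \<open>\<int>\<^sup>2\<close> modulo the even vectors and the plane lattice spanned by
  \<open>(b, z)\<close> and \<open>(0, c)\<close>. Conjugation by the other screw motions reflects the lattice and adds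
  \<open>(1, 1)\<close>; \<open>screw_mirror\<close> below is this operation followed by normalisation.\<close>

definition screw_reps :: "int \<Rightarrow> int \<Rightarrow> int \<Rightarrow> (int \<times> int) set" where
  "screw_reps b c z = {(u, w). u \<in> {0, 1} \<and> w \<in> {0, 1} \<and> (odd b \<longrightarrow> u = 0) \<and> (odd c \<longrightarrow> w = 0) \<and>
     (even b \<and> odd z \<longrightarrow> w = 0)}"

definition screw_mirror :: "int \<Rightarrow> int \<Rightarrow> int \<Rightarrow> int \<Rightarrow> int \<Rightarrow> int \<times> int \<times> int" where
  "screw_mirror b c z u w = ((- z) mod c, if odd b then 0 else 1 - u,
     if odd c then 0 else if odd b then (w + 1 + z) mod 2 else if odd z then 0 else 1 - w)"

lemma even_uminus_mod: "even c \<Longrightarrow> even ((- z) mod c) \<longleftrightarrow> even (z :: int)"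
  by (simp add: dvd_mod_iff)

lemma screw_mirror_reps:
  assumes "(u, w) \<in> screw_reps b c z" "screw_mirror b c z u w = (z', u', w')"
  shows "(u', w') \<in> screw_reps b c z'"
  using assms even_uminus_mod[of c z]
  by (auto simp: screw_reps_def screw_mirror_def split: if_splits)

text \<open>For \<open>\<delta> = 0\<close> the lattice is unchanged, and normalised representatives
  of the same class coincide; for \<open>\<delta> = 1\<close> the normalised image is the
  mirror.\<close>

lemma screw_reps_unique:
  assumes 1: "(u, w) \<in> screw_reps b c z" and 2: "(u', w') \<in> screw_reps b c z'" and z: "0 \<le> z" "z < c" "0 \<le> z'" "z' < c"
  shows "(\<exists>\<delta>\<in>{0, 1}. z' = (psign \<delta> * z) mod c \<and>
      (\<exists>i j. even (u' - u - \<delta> - b * i) \<and> even (w' - w - \<delta> - z' * i - c * j))) \<longleftrightarrow>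
    (z', u', w') = (z, u, w) \<or> (z', u', w') = screw_mirror b c z u w"
proof -
  have eq0: "(\<exists>i j. even (u' - u - b * i) \<and> even (w' - w - z * i - c * j)) \<longleftrightarrow> u' = u \<and> w' = w" if "z' = z"
    unfolding parity_lattice_iff
    using 1 2 unfolding that screw_reps_def mem_Collect_eq prod.case insert_iff empty_iff
    by (elim conjE disjE FalseE) auto
  have eq1: "(\<exists>i j. even (u' - u - 1 - b * i) \<and> even (w' - w - 1 - z' * i - c * j)) \<longleftrightarrow>
      (z', u', w') = screw_mirror b c z u w" if "z' = (- z) mod c"
  proof -
    \<comment> \<open>Reduction modulo an even \<open>c\<close> preserves the parity of
      \<open>- z\<close>. For odd \<open>c\<close> it may not, but then \<open>w\<close> and
      \<open>w'\<close> are both 0.\<close>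
    have zz: "even c \<Longrightarrow> even z' \<longleftrightarrow> even z" using even_uminus_mod that by simp
    have uw: "u = 0 \<or> u = 1" "w = 0 \<or> w = 1" "u' = 0 \<or> u' = 1" "w' = 0 \<or> w' = 1"
      using 1 2 by (auto simp: screw_reps_def)
    have eu: "even (u' - u - 1) \<longleftrightarrow> u' = 1 - u" and ew: "even (w' - w - 1) \<longleftrightarrow> w' = 1 - w"
      using uw by auto
    have ez: "even (w' - w - 1 - z') \<longleftrightarrow> w' = (w + 1 + z) mod 2" if "even c"
      using uw zz[OF that] by (elim disjE; simp; presburger)
    show ?thesis
    proof (cases "even b")
      case True
      then show ?thesis
        using 2 zz that unfolding parity_lattice_iff eu ew by (auto simp: screw_reps_def screw_mirror_def)
    next
      case False
      then have "u = 0" "u' = 0" "odd c \<Longrightarrow> w' = 0" using 1 2 by (auto simp: screw_reps_def)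
      then show ?thesis
        using False ez that unfolding parity_lattice_iff eu ew by (auto simp: screw_mirror_def)
    qed
  qed
  have mirror: "(z', u', w') = screw_mirror b c z u w \<Longrightarrow> z' = (- z) mod c"
    by (simp add: screw_mirror_def)
  let ?Q = "\<lambda>\<delta>. \<exists>i j. even (u' - u - \<delta> - b * i) \<and> even (w' - w - \<delta> - z' * i - c * j)"
  have "(\<exists>\<delta>\<in>{0, 1}. z' = (psign \<delta> * z) mod c \<and> ?Q \<delta>) \<longleftrightarrow>
      z' = (psign 0 * z) mod c \<and> ?Q 0 \<or> z' = (psign 1 * z) mod c \<and> ?Q 1"
    by (simp only: bex_simps simp_thms)
  also have "z' = (psign 0 * z) mod c \<and> ?Q 0 \<longleftrightarrow> (z', u', w') = (z, u, w)"
    using eq0 z by (cases "z' = z") simp_all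
  also have "z' = (psign 1 * z) mod c \<and> ?Q 1 \<longleftrightarrow> (z', u', w') = screw_mirror b c z u w"
  proof -
    have "(psign 1 * z) mod c = (- z) mod c" by simp
    then show ?thesis using eq1 mirror by argo
  qed
  finally show ?thesis .
qed

section \<open>Parameters for conjugacy classes of screw subgroups\<close>

definition screw_params :: "nat \<Rightarrow> (nat \<times> (nat \<times> nat \<times> nat) \<times> int \<times> int \<times> int) set" where
  "screw_params n = (SIGMA i : {0, 1, 2}. SIGMA (a, b, c) : {(a, b, c). (a, b, c) \<in> triples n 2 \<and> odd a}.
     SIGMA z : {0..<int c}. screw_reps (int b) (int c) z)"

text \<open>\<open>i\<close> selects the axis, the triple with \<open>2 * (a * b * c) = n\<close>
  and odd \<open>a\<close> gives the lattice together with \<open>z\<close>, and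
  \<open>2 * u\<close> and \<open>2 * w + 1\<close> are the off-axis entries of the screw motion,
  with the parities they must have.\<close>

definition screw_family :: "nat \<times> (nat \<times> nat \<times> nat) \<times> int \<times> int \<times> int \<Rightarrow> (int \<times> int \<times> int) set" where
  "screw_family = (\<lambda>(i, (a, b, c), z, u, w). (cyc ^^ i) ` screw_group (int a) (int b) (int c) z (2 * u) (2 * w + 1))"

definition screw_flip :: "nat \<times> (nat \<times> nat \<times> nat) \<times> int \<times> int \<times> int \<Rightarrow> nat \<times> (nat \<times> nat \<times> nat) \<times> int \<times> int \<times> int" where
  "screw_flip = (\<lambda>(i, (a, b, c), z, u, w). (i, (a, b, c), screw_mirror (int b) (int c) z u w))"

lemma screw_params_iff:
  "(i, (a, b, c), z, u, w) \<in> screw_params n \<longleftrightarrow> i \<in> {0, 1, 2} \<and> (a, b, c) \<in> triples n 2 \<and> odd a \<and>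
    0 \<le> z \<and> z < int c \<and> (u, w) \<in> screw_reps (int b) (int c) z"
  by (auto simp: screw_params_def)

lemma screw_flip_params: "x \<in> screw_params n \<Longrightarrow> screw_flip x \<in> screw_params n"
proof -
  assume x: "x \<in> screw_params n"
  obtain i a b c z u w where x': "x = (i, (a, b, c), z, u, w)" by (metis prod_cases3)
  obtain z' u' w' where m: "screw_mirror (int b) (int c) z u w = (z', u', w')" by (metis prod_cases3)
  then have "(u', w') \<in> screw_reps (int b) (int c) z'"
    using screw_mirror_reps x unfolding x' screw_params_iff by blast
  moreover have "z' = (- z) mod int c" using m by (simp add: screw_mirror_def)
  moreover have "0 < c" using x unfolding x' screw_params_iff by (simp add: triples_iff)
  ultimately show ?thesis
    using x unfolding x' screw_params_iff by (simp add: screw_flip_def m screw_params_iff)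
qed

lemma funpow_cyc_iso: "cyc ^^ i \<in> iso HW HW"
proof (induction i)
  case (Suc i)
  then show ?case using iso_set_trans[OF Suc cyc_iso] by (simp add: comp_def funpow.simps(2))
qed (simp add: iso_set_refl id_def)

lemma funpow_cyc_conj: "s \<in> carrier HW \<Longrightarrow> (cyc ^^ i) ` conj_HW_set s S = conj_HW_set ((cyc ^^ i) s) ((cyc ^^ i) ` S)"
proof (induction i)
  case (Suc i)
  have "(cyc ^^ i) s \<in> carrier HW" using funpow_cyc_iso[of i] Suc(2) by (auto simp: iso_def hom_def)
  have "(cyc ^^ Suc i) ` conj_HW_set s S = cyc ` (cyc ^^ i) ` conj_HW_set s S" by (simp add: image_comp)
  also have "\<dots> = cyc ` conj_HW_set ((cyc ^^ i) s) ((cyc ^^ i) ` S)" using Suc by simp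
  also have "\<dots> = conj_HW_set (cyc ((cyc ^^ i) s)) (cyc ` (cyc ^^ i) ` S)"
    by (rule cyc_conj) fact
  finally show ?case by (simp add: image_comp)
qed simp

lemma funpow_cyc_conj_iff:
  "(\<exists>s\<in>carrier HW. (cyc ^^ i) ` S' = conj_HW_set s ((cyc ^^ i) ` S)) \<longleftrightarrow> (\<exists>s\<in>carrier HW. S' = conj_HW_set s S)"
proof
  assume "\<exists>s\<in>carrier HW. (cyc ^^ i) ` S' = conj_HW_set s ((cyc ^^ i) ` S)"
  then obtain s where s: "s \<in> carrier HW" "(cyc ^^ i) ` S' = conj_HW_set s ((cyc ^^ i) ` S)" by blast
  obtain s' where s': "s' \<in> carrier HW" "s = (cyc ^^ i) s'"
    using funpow_cyc_iso[of i] s(1) unfolding iso_def bij_betw_def by blast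
  have "(cyc ^^ i) ` S' = (cyc ^^ i) ` conj_HW_set s' S"
    using s(2) funpow_cyc_conj[OF s'(1), of i S] unfolding s'(2) by (rule trans[OF _ sym])
  then have "S' = conj_HW_set s' S" by (simp only: inj_image_eq_iff[OF inj_fn[OF inj_cyc]])
  then show "\<exists>s\<in>carrier HW. S' = conj_HW_set s S" by (rule bexI[OF _ s'(1)])
next
  assume "\<exists>s\<in>carrier HW. S' = conj_HW_set s S"
  then obtain s where s: "s \<in> carrier HW" "S' = conj_HW_set s S" by blast
  moreover have "(cyc ^^ i) s \<in> carrier HW" using funpow_cyc_iso[of i] s(1) by (auto simp: iso_def hom_def)
  ultimately show "\<exists>s\<in>carrier HW. (cyc ^^ i) ` S' = conj_HW_set s ((cyc ^^ i) ` S)"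
    using funpow_cyc_conj[OF s(1), of i S] by (intro bexI[of _ "(cyc ^^ i) s"]) simp_all
qed

text \<open>Encodes the linear part of a motion. Conjugation preserves it because the linear parts
  commute, and it tells the three axes apart.\<close>

definition parity_class :: "int \<times> int \<times> int \<Rightarrow> bool \<times> bool \<times> bool" where
  "parity_class = (\<lambda>(a, b, c). (even a, even b, even c))"

lemma parity_class_conj:
  assumes "s \<in> carrier HW"
  shows "parity_class (s \<star> t \<star> hw_inv s) = parity_class t"
proof -
  obtain s1 s2 s3 where s: "s = (s1, s2, s3)" by (cases s)
  obtain a b c where t: "t = (a, b, c)" by (cases t)
  have "even (s1 + s2 + s3)" using assms s by simp
  have e: "even (1 - psign k :: int)" for k by (simp add: psign_def)
  show ?thesis
    unfolding s t conj_HW[OF \<open>even (s1 + s2 + s3)\<close>] parity_class_def prod.case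
    using e[of a] e[of b] e[of c] by (simp only: even_add even_mult_iff odd_psign) simp
qed

lemma screw_axis_unique:
  assumes "screw S" "screw S'" "s \<in> carrier HW" and eq: "(cyc ^^ i') ` S' = conj_HW_set s ((cyc ^^ i) ` S)"
    and i: "i \<in> {0, 1, 2}" "i' \<in> {0, 1, 2}"
  shows "i' = i"
proof -
  obtain h where h: "h \<in> S" "h \<in> odd1" using \<open>screw S\<close> by (auto simp: screw_def)
  have "s \<star> (cyc ^^ i) h \<star> hw_inv s \<in> (cyc ^^ i') ` S'"
    unfolding eq using h(1) by blast
  then obtain h' where h': "h' \<in> S'" "s \<star> (cyc ^^ i) h \<star> hw_inv s = (cyc ^^ i') h'" by blast
  have "parity_class ((cyc ^^ i') h') = parity_class ((cyc ^^ i) h)"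
    using parity_class_conj[OF assms(3), of "(cyc ^^ i) h"] h'(2) by simp
  moreover have "h' \<in> evens \<union> odd1" using h'(1) assms(2) by (auto simp: screw_def)
  moreover obtain a b c where "h = (a, b, c)" by (cases h)
  moreover obtain a' b' c' where "h' = (a', b', c')" by (cases h')
  ultimately show ?thesis
    using i h(2) by (auto simp: parity_class_def eval_nat_numeral)
qed

text \<open>Combines the invariance of the axis, the conjugacy criterion for a fixed axis and the
  uniqueness of representatives: a class contains one or two parameters.\<close>

lemma screw_family_conj_iff:
  assumes x: "x \<in> screw_params n" and y: "y \<in> screw_params n"
  shows "(\<exists>s\<in>carrier HW. screw_family y = conj_HW_set s (screw_family x)) \<longleftrightarrow> y = x \<or> y = screw_flip x"
proof -
  obtain i a b c z u w where x': "x = (i, (a, b, c), z, u, w)" by (metis prod_cases3)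
  obtain i' a' b' c' z' u' w' where y': "y = (i', (a', b', c'), z', u', w')" by (metis prod_cases3)
  let ?S = "screw_group (int a) (int b) (int c) z (2 * u) (2 * w + 1)"
  let ?S' = "screw_group (int a') (int b') (int c') z' (2 * u') (2 * w' + 1)"
  have xx: "i \<in> {0, 1, 2}" "0 < a" "0 < b" "0 < c" "odd a" "0 \<le> z" "z < int c" "(u, w) \<in> screw_reps (int b) (int c) z"
    using x unfolding x' screw_params_iff triples_iff by blast+
  have yy: "i' \<in> {0, 1, 2}" "0 < a'" "0 < b'" "0 < c'" "odd a'" "0 \<le> z'" "z' < int c'" "(u', w') \<in> screw_reps (int b') (int c') z'"
    using y unfolding y' screw_params_iff triples_iff by blast+
  have scr: "screw ?S" "screw ?S'" using xx yy by (simp_all add: screw_group_screw)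
  have "(\<exists>s\<in>carrier HW. screw_family y = conj_HW_set s (screw_family x)) \<longleftrightarrow>
      (\<exists>s\<in>carrier HW. (cyc ^^ i') ` ?S' = conj_HW_set s ((cyc ^^ i) ` ?S))"
    by (simp only: screw_family_def x' y' prod.case)
  also have "\<dots> \<longleftrightarrow> i' = i \<and> (\<exists>s\<in>carrier HW. (cyc ^^ i) ` ?S' = conj_HW_set s ((cyc ^^ i) ` ?S))"
  proof
    assume "\<exists>s\<in>carrier HW. (cyc ^^ i') ` ?S' = conj_HW_set s ((cyc ^^ i) ` ?S)"
    then obtain s where s: "s \<in> carrier HW" "(cyc ^^ i') ` ?S' = conj_HW_set s ((cyc ^^ i) ` ?S)" ..
    then have "i' = i" by (rule screw_axis_unique[OF scr _ _ xx(1) yy(1)])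
    with s show "i' = i \<and> (\<exists>s\<in>carrier HW. (cyc ^^ i) ` ?S' = conj_HW_set s ((cyc ^^ i) ` ?S))"
      by (intro conjI bexI[of _ s]) simp_all
  qed (elim conjE, simp only:)
  also have "\<dots> \<longleftrightarrow> i' = i \<and> (\<exists>s\<in>carrier HW. ?S' = conj_HW_set s ?S)"
    unfolding funpow_cyc_conj_iff ..
  also have "\<dots> \<longleftrightarrow> i' = i \<and> int a' = int a \<and> int b' = int b \<and> int c' = int c \<and> (\<exists>\<delta>\<in>{0, 1}. z' = (psign \<delta> * z) mod int c \<and>
      (\<exists>k j. even (u' - u - \<delta> - int b * k) \<and> even (w' - w - \<delta> - z' * k - int c * j)))"
    by (subst conj_screw_group_iff) (use xx yy in simp_all)
  also have "\<dots> \<longleftrightarrow> i' = i \<and> a' = a \<and> b' = b \<and> c' = c \<and>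
      ((z', u', w') = (z, u, w) \<or> (z', u', w') = screw_mirror (int b) (int c) z u w)"
  proof -
    have "b' = b \<Longrightarrow> c' = c \<Longrightarrow> (\<exists>\<delta>\<in>{0, 1}. z' = (psign \<delta> * z) mod int c \<and>
      (\<exists>k j. even (u' - u - \<delta> - int b * k) \<and> even (w' - w - \<delta> - z' * k - int c * j))) \<longleftrightarrow>
      (z', u', w') = (z, u, w) \<or> (z', u', w') = screw_mirror (int b) (int c) z u w"
      by (rule screw_reps_unique) (use xx yy in simp_all)
    then show ?thesis unfolding of_nat_eq_iff by argo
  qed
  also have "\<dots> \<longleftrightarrow> y = x \<or> y = screw_flip x"
    by (auto simp: x' y' screw_flip_def)
  finally show ?thesis .
qed

lemma finite_screw_params: "0 < n \<Longrightarrow> finite (screw_params n)"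
proof -
  assume n: "0 < n"
  have "{(a, b, c). (a, b, c) \<in> triples n 2 \<and> odd a} \<subseteq> triples n 2" by auto
  moreover have "finite (screw_reps b c z)" for b c z
    by (rule finite_subset[of _ "{0, 1} \<times> {0, 1}"]) (auto simp: screw_reps_def)
  ultimately show ?thesis
    unfolding screw_params_def
    by (intro finite_SigmaI) (auto intro: finite_subset[OF _ finite_triples[OF n]])
qed

text \<open>For even \<open>b\<close> the mirror moves \<open>u\<close>, so the sum is just the
  number of representatives. For odd \<open>b\<close> a fixed point requires \<open>z = 0\<close> or
  \<open>2 * z = c\<close>. If \<open>c\<close> is even, invariance of \<open>w\<close> also
  requires odd \<open>z\<close>, which excludes \<open>z = 0\<close>; if \<open>c\<close> is odd,
  only \<open>z = 0\<close> remains.\<close>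

lemma screw_reps_sum:
  fixes b c z :: int
  assumes "0 < c" "0 \<le> z" "z < c"
  shows "(\<Sum>(u, w)\<in>screw_reps b c z. 1 + of_bool (screw_mirror b c z u w = (z, u, w))) =
    (if even b then if even c then if even z then 4 else 2 else 2
     else if even c then 2 + 2 * of_bool (2 * z = c \<and> odd z) else 1 + of_bool (z = 0) :: real)"
proof -
  have z: "(- z) mod c = z \<longleftrightarrow> z = 0 \<or> 2 * z = c"
  proof (cases "z = 0")
    case False
    then have "(- z) mod c = c - z" using assms by (simp add: zmod_zminus1_eq_if)
    then show ?thesis using False by auto
  qed simp
  show ?thesis
  proof (cases "even b")
    case True
    have "screw_mirror b c z u w \<noteq> (z, u, w)" for u w
      using True by (auto simp: screw_mirror_def; presburger)
    moreover have "screw_reps b c z = (if even c \<and> even z then {(0, 0), (0, 1), (1, 0), (1, 1)} else {(0, 0), (1, 0)})"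
      using True by (auto simp: screw_reps_def)
    ultimately show ?thesis using True by simp
  next
    case False
    show ?thesis
    proof (cases "even c")
      case True
      have "screw_reps b c z = {(0, 0), (0, 1)}" using False True by (auto simp: screw_reps_def)
      moreover have "screw_mirror b c z 0 w = (z, 0, w) \<longleftrightarrow> 2 * z = c \<and> odd z" if "w \<in> {0, 1}" for w
        using False True that z by (auto simp: screw_mirror_def mod_2_eq_odd)
      ultimately show ?thesis using False True by simp
    next
      case odd: False
      have "screw_reps b c z = {(0, 0)}" using False odd by (auto simp: screw_reps_def)
      moreover have "screw_mirror b c z 0 0 = (z, 0, 0) \<longleftrightarrow> z = 0"
        using False odd z by (auto simp: screw_mirror_def)
      ultimately show ?thesis using False odd by simp
    qed
  qed
qed

lemma sum_parity_interval:
  assumes "0 < c" "even c"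
  shows "(\<Sum>z\<in>{0..<int c}. if even z then 4 else 2 :: real) = 3 * real c"
proof -
  obtain m where m: "c = 2 * m" using assms by (auto elim: evenE)
  have "(\<Sum>z\<in>{0..<int (2 * m)}. if even z then 4 else 2 :: real) = 6 * real m"
  proof (induction m)
    case (Suc m)
    have "{0..<int (2 * Suc m)} = insert (2 * int m) (insert (2 * int m + 1) {0..<int (2 * m)})" by auto
    then show ?case using Suc by simp
  qed simp
  then show ?thesis by (simp add: m)
qed

text \<open>On the right the first summand is the number of parameters with the given
  \<open>b\<close> and \<open>c\<close>, and the other two count those that the mirror
  fixes.\<close>

lemma screw_reps_total:
  fixes b c :: nat
  assumes "0 < c"
  shows "(\<Sum>z\<in>{0..<int c}. \<Sum>(u, w)\<in>screw_reps (int b) (int c) z.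
      1 + of_bool (screw_mirror (int b) (int c) z u w = (z, u, w))) =
    real c * (1 + of_bool (even b) + of_bool (even c)) + of_bool (odd b \<and> odd c)
      + 2 * of_bool (odd b \<and> even c \<and> odd (c div 2))"
proof -
  have "(\<Sum>z\<in>{0..<int c}. \<Sum>(u, w)\<in>screw_reps (int b) (int c) z.
      1 + of_bool (screw_mirror (int b) (int c) z u w = (z, u, w))) =
    (\<Sum>z\<in>{0..<int c}. if even b then if even c then if even z then 4 else 2 else 2
      else if even c then 2 + 2 * of_bool (2 * z = int c \<and> odd z) else 1 + of_bool (z = 0) :: real)"
    by (rule sum.cong[OF refl], subst screw_reps_sum) (use assms in auto)
  also have "\<dots> = real c * (1 + of_bool (even b) + of_bool (even c)) + of_bool (odd b \<and> odd c)
      + 2 * of_bool (odd b \<and> even c \<and> odd (c div 2))"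
  proof (cases "even b")
    case True
    then show ?thesis using sum_parity_interval[OF assms] by simp
  next
    case False
    show ?thesis
    proof (cases "even c")
      case True
      then obtain m where m: "c = 2 * m" by (auto elim: evenE)
      have "{z \<in> {0..<int c}. 2 * z = int c \<and> odd z} = (if odd m then {int m} else {})"
        using assms m by auto
      then have "(\<Sum>z\<in>{0..<int c}. of_bool (2 * z = int c \<and> odd z) :: real) = of_bool (odd m)"
        by (simp add: of_bool_def sum.If_cases Int_def)
      then show ?thesis
        using False True m by (simp add: sum.distrib sum_distrib_left[symmetric])
    next
      case odd: False
      have "(\<Sum>z\<in>{0..<int c}. of_bool (z = 0) :: real) = 1"
        using assms by (simp add: of_bool_def)
      then show ?thesis using False odd by (simp add: sum.distrib)
    qed
  qed
  finally show ?thesis .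
qed

lemma sum_Sigma_pair:
  "finite A \<Longrightarrow> (\<And>x. x \<in> A \<Longrightarrow> finite (B x)) \<Longrightarrow> (\<Sum>p\<in>Sigma A B. h p) = (\<Sum>x\<in>A. \<Sum>y\<in>B x. h (x, y))"
  by (simp add: sum.Sigma)

text \<open>Classes have one or two members, so twice their number is the number of parameters plus
  the number of fixed points of the flip. The three axes contribute equally, hence the factor
  3.\<close>

lemma card_screw_classes:
  assumes n: "0 < n"
  shows "2 * real (card (screw_params n // {(x, y). x \<in> screw_params n \<and> y \<in> screw_params n \<and>
      (\<exists>g\<in>carrier HW. screw_family y = conj_HW_set g (screw_family x))})) =
    3 * (sigma2 (n/2) + 2 * sigma2 (n/4) - 3 * sigma2 (n/8)
      + d3 (n/2) - d3 (n/4) - 3 * d3 (n/8) + 5 * d3 (n/16) - 2 * d3 (n/32))"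
proof -
  let ?X = "screw_params n"
  define E where "E = {(x, y). x \<in> ?X \<and> y \<in> ?X \<and> (\<exists>g\<in>carrier HW. screw_family y = conj_HW_set g (screw_family x))}"
  have E_iff: "(x, y) \<in> E \<longleftrightarrow> x \<in> ?X \<and> y \<in> ?X \<and> (y = x \<or> y = screw_flip x)" for x y
    using screw_family_conj_iff unfolding E_def by blast
  have conj_sym: "\<exists>g\<in>carrier HW. S = conj_HW_set g S'" if "g \<in> carrier HW" "S' = conj_HW_set g S" "S \<subseteq> carrier HW" for S S' g
  proof -
    have "hw_inv g \<star> (g \<star> h \<star> hw_inv g) \<star> hw_inv (hw_inv g) = h" if "h \<in> S" for h
    proof -
      have "h \<in> carrier HW" using that \<open>S \<subseteq> carrier HW\<close> by blast
      then show ?thesis using \<open>g \<in> carrier HW\<close>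
        by (simp add: HW.m_assoc del: mult_HW inv_HW one_HW) (simp add: HW.m_assoc[symmetric] del: mult_HW inv_HW one_HW)
    qed
    then have "conj_HW_set (hw_inv g) S' = S"
      unfolding that(2) image_image by (simp cong: image_cong del: mult_HW inv_HW one_HW)
    then show ?thesis using HW.inv_closed[OF that(1)] by metis
  qed
  have family_carrier: "screw_family x \<subseteq> carrier HW" if "x \<in> ?X" for x
  proof -
    obtain i a b c z u w where x': "x = (i, (a, b, c), z, u, w)" by (metis prod_cases3)
    then have "subgroup (screw_group (int a) (int b) (int c) z (2 * u) (2 * w + 1)) HW"
      using that by (simp add: screw_params_iff screw_group_subgroup)
    then have "subgroup (screw_family x) HW"
      unfolding x' screw_family_def prod.case using HW.card_rcosets_iso[OF funpow_cyc_iso] by blast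
    then show ?thesis by (rule subgroup.subset)
  qed
  \<comment> \<open>That flipping twice leads back is not computed from the formula: conjugacy is
    symmetric and is described by the flip, so \<open>x\<close> must be \<open>y\<close> or the flip
    of \<open>y\<close>.\<close>
  have flip_flip: "x = y \<or> x = screw_flip y" if "x \<in> ?X" "y \<in> ?X" "y = screw_flip x" for x y
    using screw_family_conj_iff[OF that(1,2)] screw_family_conj_iff[OF that(2,1)] that(3)
      conj_sym[OF _ _ family_carrier[OF that(1)], of _ "screw_family y"] by blast
  have E: "equiv ?X E"
  proof (rule equivI)
    show "refl_on ?X E" by (rule refl_onI) (simp add: E_iff)
    show "sym E" by (intro symI) (unfold E_iff, use flip_flip in metis)
    show "trans E"
      by (intro transI) (unfold E_iff, use flip_flip in metis)
  qed (auto simp: E_iff)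
  have "2 * real (card (?X // E)) = (\<Sum>x\<in>?X. 1 + of_bool (screw_flip x = x))"
    by (rule card_quotient_involution[OF finite_screw_params[OF n] E])
      (auto simp: E_iff screw_flip_params)
  also have "\<dots> = (\<Sum>i\<in>{0, 1, 2 :: nat}. \<Sum>(a, b, c)\<in>{(a, b, c). (a, b, c) \<in> triples n 2 \<and> odd a}.
      \<Sum>z\<in>{0..<int c}. \<Sum>(u, w)\<in>screw_reps (int b) (int c) z.
        1 + of_bool (screw_mirror (int b) (int c) z u w = (z, u, w)))"
  proof -
    let ?T = "{(a, b, c). (a, b, c) \<in> triples n 2 \<and> odd a}"
    have fin: "finite ?T" by (rule finite_subset[OF _ finite_triples[OF n, of 2]]) auto
    have fin2: "finite (screw_reps b c z)" for b c z
      by (rule finite_subset[of _ "{0, 1} \<times> {0, 1}"]) (auto simp: screw_reps_def)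
    let ?V = "\<lambda>t :: nat \<times> nat \<times> nat. case t of (a, b, c) \<Rightarrow> SIGMA z : {0..<int c}. screw_reps (int b) (int c) z"
    let ?F = "\<lambda>x. 1 + of_bool (screw_flip x = x) :: real"
    have finV: "finite (?V t)" for t by (cases t) (simp add: fin2)
    have "(\<Sum>x\<in>?X. ?F x) = (\<Sum>i\<in>{0, 1, 2}. \<Sum>y\<in>Sigma ?T ?V. ?F (i, y))"
      unfolding screw_params_def by (rule sum_Sigma_pair) (use fin finV in auto)
    also have "\<dots> = (\<Sum>i\<in>{0, 1, 2}. \<Sum>t\<in>?T. \<Sum>v\<in>?V t. ?F (i, t, v))"
      by (intro sum.cong refl sum_Sigma_pair) (use fin finV in auto)
    also have "\<dots> = (\<Sum>i\<in>{0, 1, 2 :: nat}. \<Sum>(a, b, c)\<in>?T.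
        \<Sum>z\<in>{0..<int c}. \<Sum>(u, w)\<in>screw_reps (int b) (int c) z.
        1 + of_bool (screw_mirror (int b) (int c) z u w = (z, u, w)))"
    proof (intro sum.cong refl)
      fix i :: nat and t :: "nat \<times> nat \<times> nat"
      obtain a b c where t: "t = (a, b, c)" by (cases t)
      have "(\<Sum>v\<in>?V t. ?F (i, t, v)) = (\<Sum>z\<in>{0..<int c}. \<Sum>y\<in>screw_reps (int b) (int c) z. ?F (i, t, z, y))"
        unfolding t prod.case by (rule sum_Sigma_pair) (use fin2 in auto)
      also have "\<dots> = (\<Sum>z\<in>{0..<int c}. \<Sum>(u, w)\<in>screw_reps (int b) (int c) z.
          1 + of_bool (screw_mirror (int b) (int c) z u w = (z, u, w)))"
        by (intro sum.cong refl) (auto simp: t screw_flip_def)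
      finally show "(\<Sum>v\<in>?V t. ?F (i, t, v)) = (case t of (a, b, c) \<Rightarrow>
          \<Sum>z\<in>{0..<int c}. \<Sum>(u, w)\<in>screw_reps (int b) (int c) z.
          1 + of_bool (screw_mirror (int b) (int c) z u w = (z, u, w)))"
        by (simp add: t)
    qed
    finally show ?thesis .
  qed
  also have "\<dots> = 3 * (\<Sum>(a, b, c)\<in>{(a, b, c). (a, b, c) \<in> triples n 2 \<and> odd a}.
      real c * (1 + of_bool (even b) + of_bool (even c)) + of_bool (odd b \<and> odd c)
      + 2 * of_bool (odd b \<and> even c \<and> odd (c div 2)))" (is "_ = 3 * ?s")
  proof -
    have "(\<Sum>(a, b, c)\<in>{(a, b, c). (a, b, c) \<in> triples n 2 \<and> odd a}.
      \<Sum>z\<in>{0..<int c}. \<Sum>(u, w)\<in>screw_reps (int b) (int c) z.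
        1 + of_bool (screw_mirror (int b) (int c) z u w = (z, u, w))) = ?s"
      by (rule sum.cong[OF refl]) (clarsimp simp: screw_reps_total triples_iff)
    then show ?thesis by simp
  qed
  also have "?s = tsum n 2 (\<lambda>a b c. of_bool (odd a) * (real c * (1 + of_bool (even b) + of_bool (even c))
      + of_bool (odd b \<and> odd c) + 2 * of_bool (odd b \<and> even c \<and> odd (c div 2))))"
    unfolding tsum_filter[OF n, symmetric] by (rule tsum_cong) simp
  finally show ?thesis unfolding tsum_mirror_pairs[OF n] E_def .
qed

section \<open>The three types of holonomy\<close>

lemma funpow_cyc_inverse: "(cyc ^^ (2 * i)) ` (cyc ^^ i) ` S = S"
proof -
  have "(cyc ^^ (3 * i)) t = t" for t
  proof (induction i)
    case (Suc i)
    have "3 * Suc i = Suc (Suc (Suc (3 * i)))" by simp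
    then show ?case using Suc by (simp only: funpow.simps comp_apply cyc_cyc_cyc)
  qed simp
  moreover have "(cyc ^^ (2 * i)) ((cyc ^^ i) t) = (cyc ^^ (3 * i)) t" for t
    using funpow_add[of "2 * i" i cyc] by (metis comp_apply mult_2 add.commute numeral_3_eq_3 mult_Suc numeral_2_eq_2)
  ultimately show ?thesis by (simp add: image_image)
qed

definition screw_type :: "(int \<times> int \<times> int) set \<Rightarrow> bool" where
  "screw_type S \<longleftrightarrow> (\<exists>i\<in>{0, 1, 2}. \<exists>S0. screw S0 \<and> S = (cyc ^^ i) ` S0)"

text \<open>The condition \<open>cyc (cyc h) \<in> odd1\<close> says that \<open>h\<close> is a
  screw motion about the second axis. In a subgroup, products with screw motions about the first
  axis then give the third.\<close>

definition full_type :: "(int \<times> int \<times> int) set \<Rightarrow> bool" where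
  "full_type S \<longleftrightarrow> (\<exists>h\<in>S. h \<in> odd1) \<and> (\<exists>h\<in>S. cyc (cyc h) \<in> odd1)"

lemma screw_type_cases:
  assumes S: "subgroup S HW" and "screw_type S"
  obtains i S0 where "i \<in> {0, 1, 2}" "S = (cyc ^^ i) ` S0" "screw S0" "subgroup S0 HW"
    "hw_index S0 = hw_index S"
proof -
  obtain i S0 where i: "i \<in> {0, 1, 2}" "S = (cyc ^^ i) ` S0" "screw S0"
    using assms(2) unfolding screw_type_def by blast
  then have "S0 = (cyc ^^ (2 * i)) ` S" using funpow_cyc_inverse by metis
  then show ?thesis using that[of i S0] i HW.card_rcosets_iso[OF funpow_cyc_iso S, of "2 * i"] by blast
qed

lemma hw_element_cases:
  assumes "t \<in> carrier HW"
  shows "t \<in> evens \<or> t \<in> odd1 \<or> cyc (cyc t) \<in> odd1 \<or> cyc t \<in> odd1"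
  using assms by (cases t) auto

text \<open>The linear parts of \<open>S\<close> form a subgroup of the Klein four-group: the
  trivial one, one of the three of order two, or everything. Two different axes already yield the
  third by taking a product.\<close>

lemma subgroup_types:
  assumes S: "subgroup S HW"
  shows "S \<subseteq> evens \<or> screw_type S \<or> full_type S"
proof -
  have Sc: "t \<in> carrier HW" if "t \<in> S" for t using subgroup.mem_carrier[OF S that] .
  have cyc3: "S = (cyc ^^ 0) ` S" "S = (cyc ^^ 1) ` (cyc ` cyc ` S)" "S = (cyc ^^ 2) ` (cyc ` S)"
    by (simp_all add: image_image eval_nat_numeral)
  have 13: "cyc (cyc (s \<star> t)) \<in> odd1" if "s \<in> odd1" "cyc t \<in> odd1" for s t
    using that by (cases s; cases t) auto
  have 23: "s \<star> t \<in> odd1" if "cyc (cyc s) \<in> odd1" "cyc t \<in> odd1" for s t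
    using that by (cases s; cases t) auto
  have scr: "screw (f ` S)" if "\<And>h. h \<in> S \<Longrightarrow> h \<in> evens \<or> f h \<in> odd1" "\<exists>h\<in>S. f h \<in> odd1"
    "\<And>t. f t \<in> evens \<longleftrightarrow> t \<in> evens" for f
  proof -
    have "t \<notin> evens" if "t \<in> odd1" for t using that by (cases t) simp
    then show ?thesis using that unfolding screw_def by blast
  qed
  consider "\<exists>h\<in>S. h \<in> odd1" "\<exists>h\<in>S. cyc (cyc h) \<in> odd1" | "\<exists>h\<in>S. h \<in> odd1" "\<exists>h\<in>S. cyc h \<in> odd1"
    | "\<exists>h\<in>S. cyc (cyc h) \<in> odd1" "\<exists>h\<in>S. cyc h \<in> odd1"
    | "\<exists>h\<in>S. h \<in> odd1" "\<forall>h\<in>S. cyc (cyc h) \<notin> odd1" "\<forall>h\<in>S. cyc h \<notin> odd1"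
    | "\<forall>h\<in>S. h \<notin> odd1" "\<exists>h\<in>S. cyc (cyc h) \<in> odd1" "\<forall>h\<in>S. cyc h \<notin> odd1"
    | "\<forall>h\<in>S. h \<notin> odd1" "\<forall>h\<in>S. cyc (cyc h) \<notin> odd1" "\<exists>h\<in>S. cyc h \<in> odd1"
    | "\<forall>h\<in>S. h \<notin> odd1" "\<forall>h\<in>S. cyc (cyc h) \<notin> odd1" "\<forall>h\<in>S. cyc h \<notin> odd1"
    by blast
  then show ?thesis
  proof cases
    case 1
    then show ?thesis by (simp add: full_type_def)
  next
    case 2
    then have "full_type S" using 13 subgroup.m_closed[OF S] unfolding full_type_def by blast
    then show ?thesis by simp
  next
    case 3
    then have "full_type S" using 23 subgroup.m_closed[OF S] unfolding full_type_def by blast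
    then show ?thesis by simp
  next
    case 4
    then have "screw ((\<lambda>t. t) ` S)" using hw_element_cases[OF Sc] by (intro scr) blast+
    then have "screw S" by simp
    then show ?thesis using cyc3(1) unfolding screw_type_def by blast
  next
    case 5
    then have "screw ((\<lambda>t. cyc (cyc t)) ` S)" using hw_element_cases[OF Sc] by (intro scr) (blast, blast, simp)
    then have "screw (cyc ` cyc ` S)" by (simp add: image_image)
    then show ?thesis using cyc3(2) unfolding screw_type_def by blast
  next
    case 6
    then have "screw (cyc ` S)" using hw_element_cases[OF Sc] by (intro scr) (blast, blast, simp)
    then show ?thesis using cyc3(3) unfolding screw_type_def by blast
  next
    case 7
    then show ?thesis using hw_element_cases[OF Sc] by blast
  qed
qed

lemma screw_family_properties:
  assumes "x \<in> screw_params n"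
  shows "subgroup (screw_family x) HW \<and> hw_index (screw_family x) = n \<and> screw_type (screw_family x)"
proof -
  obtain i a b c z u w where x: "x = (i, (a, b, c), z, u, w)" by (metis prod_cases3)
  let ?S = "screw_group (int a) (int b) (int c) z (2 * u) (2 * w + 1)"
  have xx: "i \<in> {0, 1, 2}" "0 < a" "0 < b" "0 < c" "2 * (a * b * c) = n" "odd a"
    using assms unfolding x screw_params_iff triples_iff by blast+
  have par: "odd (int a)" "even (2 * u)" "odd (2 * w + 1)" using xx by simp_all
  have S: "subgroup ?S HW" "screw ?S" using screw_group_subgroup[OF par] screw_group_screw[OF par] by blast+
  have "2 * hw_index ?S = nat (4 * int a * int b * int c)"
    using screw_card_rcosets[OF S screw_group_evens[OF par]] xx by simp
  also have "\<dots> = 2 * n" using xx(5) by (auto simp: nat_mult_distrib)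
  finally have "hw_index ?S = n" by simp
  moreover have "screw_family x = (cyc ^^ i) ` ?S" by (simp add: x screw_family_def)
  ultimately show ?thesis
    using HW.card_rcosets_iso[OF funpow_cyc_iso S(1), of i] S(2) xx(1) unfolding screw_type_def by metis
qed

lemma screw_family_complete:
  assumes S: "subgroup S HW" and n: "hw_index S = n" "0 < n" and "screw_type S"
  shows "\<exists>x\<in>screw_params n. \<exists>g\<in>carrier HW. screw_family x = conj_HW_set g S"
proof -
  obtain i S0 where i: "i \<in> {0, 1, 2}" "S = (cyc ^^ i) ` S0" and S0: "screw S0" "subgroup S0 HW"
    "hw_index S0 = n"
    using screw_type_cases[OF S \<open>screw_type S\<close>] n by metis
  obtain a b c z p r where abc: "0 < a" "0 < b" "0 < c" and z: "0 \<le> z" "z < c" and par: "odd a" "even p" "odd r"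
    and S0eq: "S0 = screw_group a b c z p r" and card: "2 * n = nat (4 * a * b * c)"
    using screw_is_screw_group[OF S0(2) _ S0(1)] S0(3) n by metis
  obtain u0 where u0: "p = 2 * u0" using par(2) by (auto elim: evenE)
  obtain w0 where w0: "r = 2 * w0 + 1" using par(3) by (auto elim: oddE)
  \<comment> \<open>The normal form of \<open>(u0, w0)\<close> modulo 2 and the plane lattice. For
    odd \<open>b\<close> the first coordinate is cleared by \<open>u0\<close> copies of
    \<open>(b, z)\<close>, which adds \<open>z * u0\<close> to the second.\<close>
  define u where "u = (if odd b then 0 else u0 mod 2)"
  define w where "w = (if odd c then 0 else if odd b then (w0 + z * u0) mod 2 else if odd z then 0 else w0 mod 2)"
  have reps: "(u, w) \<in> screw_reps b c z"
    by (auto simp: screw_reps_def u_def w_def)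
  have "\<exists>i j. even (u - u0 - 0 - b * i) \<and> even (w - w0 - 0 - z * i - c * j)"
    unfolding parity_lattice_iff diff_zero by (auto simp: u_def w_def)
  moreover have "z = (psign 0 * z) mod c" using z by simp
  ultimately have "\<exists>s\<in>carrier HW. screw_group a b c z (2 * u) (2 * w + 1) = conj_HW_set s (screw_group a b c z (2 * u0) (2 * w0 + 1))"
    by (subst conj_screw_group_iff) (use par abc z in auto)
  then obtain s where s: "s \<in> carrier HW" "screw_group a b c z (2 * u) (2 * w + 1) = conj_HW_set s S0"
    unfolding S0eq u0 w0 by blast
  let ?x = "(i, (nat a, nat b, nat c), z, u, w)"
  have "2 * (nat a * nat b * nat c) = n"
  proof -
    have "nat (4 * a * b * c) = 4 * (nat a * nat b * nat c)" using abc by (simp add: nat_mult_distrib)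
    then show ?thesis using card by simp
  qed
  moreover have "even (nat a) \<longleftrightarrow> even a" using abc by (simp add: even_nat_iff)
  ultimately have "?x \<in> screw_params n"
    using i abc par z reps unfolding screw_params_iff triples_iff by simp
  moreover have "screw_family ?x = conj_HW_set ((cyc ^^ i) s) S"
  proof -
    have "screw_family ?x = (cyc ^^ i) ` conj_HW_set s S0"
      unfolding s(2)[symmetric] using abc by (simp add: screw_family_def)
    then show ?thesis using funpow_cyc_conj[OF s(1), of i S0] i(2) by simp
  qed
  moreover have "(cyc ^^ i) s \<in> carrier HW" using funpow_cyc_iso[of i] s(1) by (auto simp: iso_def hom_def)
  ultimately show ?thesis by blast
qed

section \<open>Subgroups with full holonomy\<close>

text \<open>For odd \<open>a\<close>, \<open>b\<close>, \<open>c\<close> this is the image of the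
  whole group under the diagonal matrix with these entries, since odd factors do not affect
  parities.\<close>

definition scaled_HW :: "int \<Rightarrow> int \<Rightarrow> int \<Rightarrow> (int \<times> int \<times> int) set" where
  "scaled_HW a b c = {(i, j, k). even (i + j + k) \<and> a dvd i \<and> b dvd j \<and> c dvd k}"

lemma subgroup_scaled_HW: "subgroup (scaled_HW a b c) HW"
proof (rule HW.subgroupI)
  show "scaled_HW a b c \<noteq> {}" by (auto simp: scaled_HW_def intro!: exI[of _ 0])
  show "hw_inv t \<in> scaled_HW a b c" if "t \<in> scaled_HW a b c" for t
    using that by (cases t) (auto simp: scaled_HW_def)
  show "s \<star> t \<in> scaled_HW a b c" if "s \<in> scaled_HW a b c" "t \<in> scaled_HW a b c" for s t
  proof -
    have "s \<star> t \<in> carrier HW" using that by (cases s; cases t) (auto simp: scaled_HW_def)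
    then show ?thesis using that by (cases s; cases t) (simp add: scaled_HW_def)
  qed
qed (auto simp: scaled_HW_def)

text \<open>The identity, \<open>h\<close>, \<open>k\<close> and \<open>h \<star> k\<close>
  represent the four cosets of the translations in \<open>S\<close>, which cancels the factor four
  in the index of the lattice.\<close>

lemma full_card_rcosets:
  assumes S: "subgroup S HW" and "full_type S" and ev: "S \<inter> evens = double (lat a b c x y z)"
    and abc: "0 < a" "0 < b" "0 < c"
  shows "hw_index S = nat (a * b * c)"
proof -
  obtain h k where h: "h \<in> S" "h \<in> odd1" and k: "k \<in> S" "cyc (cyc k) \<in> odd1"
    using assms(2) by (auto simp: full_type_def)
  obtain h1 h2 h3 where h123: "h = (h1, h2, h3)" by (cases h)
  obtain k1 k2 k3 where k123: "k = (k1, k2, k3)" by (cases k)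
  have par: "odd h1" "even h2" "odd h3" "odd k1" "odd k2" "even k3" using h k h123 k123 by auto
  let ?T = "{(0, 0, 0), h, k, h \<star> k}"
  have one: "(0, 0, 0) \<in> S" using subgroup.one_closed[OF S] by simp
  have hk: "h \<star> k \<in> S" using subgroup.m_closed[OF S h(1) k(1)] .
  have "hw_index (S \<inter> evens) = card ?T * hw_index S"
  proof (rule card_rcosets_even_part[OF S])
    fix a b c :: int
    show "\<exists>!t. t \<in> ?T \<and> (even (fst t) \<longleftrightarrow> even a) \<and> (even (fst (snd t)) \<longleftrightarrow> even b)"
    proof -
      consider "even a" "even b" | "even a" "odd b" | "odd a" "even b" | "odd a" "odd b" by blast
      then show ?thesis
      proof cases
        case 1
        then show ?thesis using par unfolding h123 k123 by (intro ex1I[of _ "(0, 0, 0)"]) auto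
      next
        case 2
        then show ?thesis using par unfolding h123 k123
          by (intro ex1I[of _ "(h1, h2, h3) \<star> (k1, k2, k3)"]) auto
      next
        case 3
        then show ?thesis using par unfolding h123 k123 by (intro ex1I[of _ "(h1, h2, h3)"]) auto
      next
        case 4
        then show ?thesis using par unfolding h123 k123 by (intro ex1I[of _ "(k1, k2, k3)"]) auto
      qed
    qed
  qed (use one h k hk in auto)
  moreover have "card ?T = 4"
    using par unfolding h123 k123 by (auto simp: card_insert_if)
  ultimately have "4 * hw_index S = nat (4 * a * b * c)"
    using card_rcosets_double_lat[OF abc, of x y z] ev by simp
  also have "\<dots> = 4 * nat (a * b * c)" by (simp add: nat_mult_distrib mult.assoc)
  finally show ?thesis by simp
qed

lemma odd_dvd_double: "odd a \<Longrightarrow> a dvd 2 * i \<longleftrightarrow> a dvd (i :: int)"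
  by (simp add: coprime_dvd_mult_right_iff)

lemma scaled_HW_evens:
  assumes "odd a" "odd b" "odd c"
  shows "scaled_HW a b c \<inter> evens = double (lat a b c 0 0 0)"
proof (rule Set.set_eqI)
  fix t :: "int \<times> int \<times> int"
  obtain i j k where t: "t = (i, j, k)" by (cases t)
  have "t \<in> scaled_HW a b c \<inter> evens \<longleftrightarrow> (\<exists>p q r. i = 2 * (a * p) \<and> j = 2 * (b * q) \<and> k = 2 * (c * r))"
  proof -
    have *: "even i \<and> a dvd i \<longleftrightarrow> (\<exists>p. i = 2 * (a * p))" if "odd a" for a i :: int
    proof
      assume i: "even i \<and> a dvd i"
      then obtain m where m: "i = 2 * m" by (auto elim: evenE)
      then have "a dvd m" using i odd_dvd_double[OF that] by simp
      then show "\<exists>p. i = 2 * (a * p)" using m by (auto elim!: dvdE)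
    qed auto
    have "t \<in> scaled_HW a b c \<inter> evens \<longleftrightarrow> (even i \<and> a dvd i) \<and> (even j \<and> b dvd j) \<and> (even k \<and> c dvd k)"
      by (auto simp: t scaled_HW_def)
    then show ?thesis unfolding *[OF assms(1)] *[OF assms(2)] *[OF assms(3)] by blast
  qed
  then show "t \<in> scaled_HW a b c \<inter> evens \<longleftrightarrow> t \<in> double (lat a b c 0 0 0)"
    by (simp add: mem_double_lat_iff t)
qed

lemma scaled_HW_full_type: "odd a \<Longrightarrow> odd b \<Longrightarrow> odd c \<Longrightarrow> full_type (scaled_HW a b c)"
  unfolding full_type_def
  by (intro conjI bexI[of _ "(a, 0, c)"] bexI[of _ "(a, b, 0)"]) (auto simp: scaled_HW_def)

text \<open>A subgroup with full holonomy is generated by its translations and one screw motion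
  about each of the first two axes: one of the identity, \<open>h\<close>, \<open>k\<close>,
  \<open>h \<star> k\<close> has the linear part of a given element, and the quotient is a
  translation.\<close>

lemma subgroup_eqI:
  assumes A: "subgroup A HW" and B: "subgroup B HW" and ev: "A \<inter> evens = B \<inter> evens"
    and h: "h \<in> A" "h \<in> B" "h \<in> odd1" and k: "k \<in> A" "k \<in> B" "cyc (cyc k) \<in> odd1"
  shows "A = B"
proof -
  have sub: "A \<subseteq> B" if A: "subgroup A HW" and B: "subgroup B HW" and ev: "A \<inter> evens = B \<inter> evens"
    and h: "h \<in> A" "h \<in> B" and k: "k \<in> A" "k \<in> B" for A B
  proof
    fix t assume t: "t \<in> A"
    have c: "t \<in> carrier HW" "h \<in> carrier HW" "k \<in> carrier HW" using t h k subgroup.mem_carrier[OF A] by blast+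
    have "\<exists>g. g \<in> A \<and> g \<in> B \<and> t \<star> hw_inv g \<in> evens"
    proof -
      obtain t1 t2 t3 where t': "t = (t1, t2, t3)" by (cases t)
      obtain h1 h2 h3 where h': "h = (h1, h2, h3)" by (cases h)
      obtain k1 k2 k3 where k': "k = (k1, k2, k3)" by (cases k)
      have hp: "odd h1" "even h2" "odd h3" and kp: "odd k1" "odd k2" "even k3"
        using assms(6) assms(9) h' k' by auto
      have tp: "even (t1 + t2 + t3)" using c t' by simp
      then consider "t \<in> evens" | "odd t1" "even t2" "odd t3" | "odd t1" "odd t2" "even t3" | "even t1" "odd t2" "odd t3"
        using t' by auto
      then show ?thesis
      proof cases
        case 1
        then have "t \<star> hw_inv \<one>\<^bsub>HW\<^esub> \<in> evens" by (simp add: t')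
        then show ?thesis using subgroup.one_closed[OF A] subgroup.one_closed[OF B] by blast
      next
        case 2
        then have "t \<star> hw_inv h \<in> evens" using hp by (simp add: t' h')
        then show ?thesis using h by blast
      next
        case 3
        then have "t \<star> hw_inv k \<in> evens" using kp by (simp add: t' k')
        then show ?thesis using k by blast
      next
        case 4
        then have "t \<star> hw_inv (h \<star> k) \<in> evens" using hp kp by (simp add: t' h' k')
        then show ?thesis using h k subgroup.m_closed[OF A] subgroup.m_closed[OF B] by blast
      qed
    qed
    then obtain g where g: "g \<in> A" "g \<in> B" "t \<star> hw_inv g \<in> evens" by blast
    then have "t \<star> hw_inv g \<in> B"
      using ev subgroup.m_closed[OF A t subgroup.m_inv_closed[OF A g(1)]] by blast
    then have "t \<star> hw_inv g \<star> g \<in> B" using g(2) subgroup.m_closed[OF B] by blast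
    then show "t \<in> B"
      using c(1) subgroup.mem_carrier[OF A g(1)] by (simp add: HW.m_assoc del: mult_HW inv_HW one_HW)
  qed
  show ?thesis using sub[OF A B ev h(1,2) k(1,2)] sub[OF B A ev[symmetric] h(2,1) k(2,1)] by blast
qed

text \<open>4 is invertible modulo an odd number. Shifts by multiples of 4 are what conjugation by
  translations offers.\<close>

lemma exists_shift_dvd: "odd b \<Longrightarrow> \<exists>j. b dvd p + 4 * (j :: int)"
proof -
  assume "odd b"
  then have "coprime 4 b" using coprime_power_left_iff[of 2 2 b] by simp
  then obtain u v where "4 * u + b * v = 1" by (metis bezout_int coprime_iff_gcd_eq_1 mult.commute)
  then have "p + 4 * (- p * u) = b * (p * v)"
    by (metis (no_types, opaque_lifting) add_diff_cancel_left' mult.assoc mult.commute mult.right_neutral mult_minus_left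
        distrib_left diff_conv_add_uminus add.commute)
  then show ?thesis by (metis dvd_triv_left)
qed

text \<open>The orthogonal splitting for each axis shows that the translations form
  \<open>double (lat a b c 0 0 0)\<close> with odd \<open>a\<close>, \<open>b\<close>,
  \<open>c\<close>. A conjugating translation has three free entries, whereas the screw motions
  about the first two axes have four off-axis entries that must become divisible. Three are arranged
  by choice; the fourth follows because the square of the product of the two screw motions is a
  translation along the third axis, hence lies in the lattice.\<close>

lemma full_type_structure:
  assumes S: "subgroup S HW" and fin: "0 < hw_index S" and full: "full_type S"
  obtains a b c s where "0 < a" "0 < b" "0 < c" "odd a" "odd b" "odd c" "s \<in> carrier HW"
    "scaled_HW a b c = conj_HW_set s S" "hw_index S = nat (a * b * c)"
proof -
  obtain h k where h: "h \<in> S" "h \<in> odd1" and k: "k \<in> S" "cyc (cyc k) \<in> odd1"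
    using full by (auto simp: full_type_def)
  have hk: "h \<star> k \<in> S" using subgroup.m_closed[OF S h(1) k(1)] .
  have hk_odd: "cyc (h \<star> k) \<in> odd1" using h(2) k(2) by (cases h; cases k) simp
  obtain a p1 r1 where a: "0 < a" "odd a" "even p1" "odd r1" "(a, p1, r1) \<in> S" "(2 * a, 0, 0) \<in> S"
    and a_dvd: "\<And>i j k. (2 * i, 2 * j, 2 * k) \<in> S \<Longrightarrow> a dvd i"
    using axis_structure[OF S fin h] by metis
  have C1: "subgroup (cyc ` S) HW" "0 < hw_index (cyc ` S)"
    using HW.card_rcosets_iso[OF cyc_iso S] fin by simp_all
  have C2: "subgroup (cyc ` cyc ` S) HW" "0 < hw_index (cyc ` cyc ` S)"
    using HW.card_rcosets_iso[OF cyc_iso C1(1)] C1(2) by simp_all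
  have mem1: "(i, j, k) \<in> cyc ` S \<longleftrightarrow> (j, k, i) \<in> S" for i j k
    by (force simp: cyc_def image_iff)
  have mem2: "(i, j, k) \<in> cyc ` cyc ` S \<longleftrightarrow> (k, i, j) \<in> S" for i j k
    by (force simp: cyc_def image_iff)
  obtain b p2 r2 where b: "0 < b" "odd b" "even p2" "odd r2" "(b, p2, r2) \<in> cyc ` cyc ` S" "(2 * b, 0, 0) \<in> cyc ` cyc ` S"
    and b_dvd: "\<And>i j k. (2 * i, 2 * j, 2 * k) \<in> cyc ` cyc ` S \<Longrightarrow> b dvd i"
    using axis_structure[OF C2, of "cyc (cyc k)"] k by blast
  obtain c p3 r3 where c: "0 < c" "odd c" "even p3" "odd r3" "(c, p3, r3) \<in> cyc ` S" "(2 * c, 0, 0) \<in> cyc ` S"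
    and c_dvd: "\<And>i j k. (2 * i, 2 * j, 2 * k) \<in> cyc ` S \<Longrightarrow> c dvd i"
    using axis_structure[OF C1, of "cyc (h \<star> k)"] hk hk_odd by blast
  have dvds: "a dvd i" "b dvd j" "c dvd k" if "(2 * i, 2 * j, 2 * k) \<in> S" for i j k
    using that a_dvd b_dvd[of j k i] c_dvd[of k i j] mem1 mem2 by blast+
  have gens: "(2 * a, 0, 0) \<in> S" "(0, 2 * b, 0) \<in> S" "(0, 0, 2 * c) \<in> S"
    using a b c mem1 mem2 by blast+
  have ev: "S \<inter> evens = double (lat a b c 0 0 0)"
  proof (intro equalityI subsetI)
    fix t assume t: "t \<in> S \<inter> evens"
    then obtain i j k where ijk: "t = (2 * i, 2 * j, 2 * k)" by (cases t) (auto elim!: evenE)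
    then obtain p q r where "i = a * p" "j = b * q" "k = c * r" using dvds t by (meson IntD1 dvdE)
    then show "t \<in> double (lat a b c 0 0 0)" unfolding mem_double_lat_iff ijk by auto
  next
    fix t assume "t \<in> double (lat a b c 0 0 0)"
    then obtain p q r where t: "t = (2 * (a * p), 2 * (b * q), 2 * (c * r))"
      unfolding mem_double_lat_iff by auto
    have "(2 * (p * a), 2 * (p * 0), 2 * (p * 0)) \<in> S" "(2 * (q * 0), 2 * (q * b), 2 * (q * 0)) \<in> S"
      "(2 * (r * 0), 2 * (r * 0), 2 * (r * c)) \<in> S"
      using even_multiples[OF S, of a 0 0 p] even_multiples[OF S, of 0 b 0 q] even_multiples[OF S, of 0 0 c r] gens by simp_all
    from subgroup.m_closed[OF S subgroup.m_closed[OF S this(1,2)] this(3)] show "t \<in> S \<inter> evens"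
      by (simp add: t mult.commute)
  qed
  \<comment> \<open>\<open>i\<close> adjusts the first entry of the screw motion about the second
    axis, \<open>l\<close> its third entry, and \<open>j\<close> the second entry of the one about
    the first axis; the third entry of the latter is left to \<open>c_r1\<close>.\<close>
  obtain i where i: "a dvd r2 + 4 * i" using exists_shift_dvd[OF a(2)] by blast
  obtain j where j: "b dvd p1 + 4 * j" using exists_shift_dvd[OF b(2)] by blast
  obtain l where l: "c dvd p2 + 4 * l" using exists_shift_dvd[OF c(2)] by blast
  let ?s = "(2 * i, 2 * j, 2 * l)"
  have s: "?s \<in> carrier HW" "even (2 * i + 2 * j + 2 * l)" by simp_all
  define F where "F t = ?s \<star> t \<star> hw_inv ?s" for t
  define S1 where "S1 = F ` S"
  have S1_conj: "S1 = conj_HW_set ?s S"    unfolding S1_def by (rule image_cong) (simp_all only: F_def)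
  have S1: "subgroup S1 HW"
    unfolding S1_conj using HW.card_rcosets_iso[OF HW.conjugation_iso[OF s(1)] S] by blast
  have r2bp2: "(r2, b, p2) \<in> S" using b(5) mem2 by blast
  have "F (a, p1, r1) = (a, p1 + 4 * j, r1 + 4 * l)" "F (r2, b, p2) = (r2 + 4 * i, b, p2 + 4 * l)"
    unfolding F_def conj_HW[OF s(2)] using a b by simp_all
  then have h1: "(a, p1 + 4 * j, r1 + 4 * l) \<in> S1" and k1: "(r2 + 4 * i, b, p2 + 4 * l) \<in> S1"
    using imageI[OF a(5), of F] imageI[OF r2bp2, of F] by (simp_all add: S1_def)
  have fixed: "F t = t" if "t \<in> evens" for t
    using that by (cases t) (simp only: F_def conj_HW[OF s(2)], simp)
  have "F t \<in> evens \<longleftrightarrow> t \<in> evens" for t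
    by (cases t) (simp only: F_def conj_HW[OF s(2)], simp)
  then have ev1: "S1 \<inter> evens = S \<inter> evens"
    using fixed unfolding S1_def by (auto simp: image_iff) metis+
  have c_r1: "c dvd r1 + 4 * l"
  proof -
    let ?g = "(a, p1 + 4 * j, r1 + 4 * l) \<star> (r2 + 4 * i, b, p2 + 4 * l)"
    have gg: "?g \<star> ?g \<in> S1"
      using subgroup.m_closed[OF S1 subgroup.m_closed[OF S1 h1 k1] subgroup.m_closed[OF S1 h1 k1]] .
    have "?g \<star> ?g = (2 * 0, 2 * 0, 2 * (r1 - p2))" using a b by simp
    then have "(2 * 0, 2 * 0, 2 * (r1 - p2)) \<in> S1 \<inter> evens"
      using gg by (simp only: Int_iff evens_iff dvd_triv_left simp_thms)
    then have "(2 * 0, 2 * 0, 2 * (r1 - p2)) \<in> S" unfolding ev1 by blast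
    then have "c dvd r1 - p2" by (rule dvds(3))
    from dvd_add[OF this l] show ?thesis by (simp add: algebra_simps)
  qed
  have "scaled_HW a b c = S1"
  proof (rule subgroup_eqI[OF subgroup_scaled_HW S1 _ _ h1 _ _ k1])
    show "scaled_HW a b c \<inter> evens = S1 \<inter> evens"
      unfolding ev1 ev using scaled_HW_evens a b c by blast
    show "(a, p1 + 4 * j, r1 + 4 * l) \<in> scaled_HW a b c" "(r2 + 4 * i, b, p2 + 4 * l) \<in> scaled_HW a b c"
      using a(2-4) b(2-4) i j l c_r1 by (simp_all add: scaled_HW_def)
    show "(a, p1 + 4 * j, r1 + 4 * l) \<in> odd1" "cyc (cyc (r2 + 4 * i, b, p2 + 4 * l)) \<in> odd1"
      using a(2-4) b(2-4) by simp_all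
  qed
  moreover have "hw_index S = nat (a * b * c)"
    using full_card_rcosets[OF S full ev] a b c by blast
  ultimately show ?thesis
    using that[OF a(1) b(1) c(1) a(2) b(2) c(2) s(1)] unfolding S1_conj by blast
qed

text \<open>Conjugation changes only signs in the translation \<open>(2 * a, 2 * b, 2 * c)\<close>,
  and odd divisors ignore the factor 2. Together with equal indices this forces the diagonals to
  coincide.\<close>

lemma scaled_HW_conj_dvd:
  assumes "0 < a" "0 < b" "0 < c" "odd a'" "odd b'" "odd c'"
    and eq: "scaled_HW a' b' c' = conj_HW_set s (scaled_HW a b c)" and s: "s \<in> carrier HW"
  shows "a' dvd a \<and> b' dvd b \<and> c' dvd c"
proof -
  obtain s1 s2 s3 where s': "s = (s1, s2, s3)" by (cases s)
  then have ev: "even (s1 + s2 + s3)" using s by simp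
  have "(2 * a, 2 * b, 2 * c) \<in> scaled_HW a b c" by (simp add: scaled_HW_def)
  then have "(s1, s2, s3) \<star> (2 * a, 2 * b, 2 * c) \<star> hw_inv (s1, s2, s3) \<in> scaled_HW a' b' c'"
    unfolding eq s' by (rule imageI)
  then have "(psign s2 * (2 * a), psign s3 * (2 * b), psign s1 * (2 * c)) \<in> scaled_HW a' b' c'"
    unfolding conj_HW[OF ev] by simp
  then have "a' dvd psign s2 * (2 * a)" "b' dvd psign s3 * (2 * b)" "c' dvd psign s1 * (2 * c)"
    by (auto simp: scaled_HW_def)
  moreover have "d dvd psign k * (2 * x) \<longleftrightarrow> d dvd x" if "odd d" for d k x :: int
    using odd_dvd_double[OF that, of x] by (cases "even k") simp_all
  ultimately show ?thesis using assms(4-6) by blast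
qed

section \<open>The covering spaces\<close>

text \<open>In the applications \<open>\<phi>\<close> is an affine change of coordinates that
  carries the motion \<open>h\<close> to \<open>e h\<close>. Total spaces are identified with the
  three model manifolds in this way.\<close>

lemma presents_intertwined:
  assumes "presents act' H' N f" and \<phi>: "homeomorphic_map euclidean euclidean \<phi>"
    and e: "e ` H = H'" and "\<And>h x. h \<in> H \<Longrightarrow> \<phi> (act h x) = act' (e h) (\<phi> x)"
  shows "presents act H N (f \<circ> \<phi>)"
proof (rule presents_change[OF assms(1) \<phi>])
  fix x y
  have "inj \<phi>" using \<phi> by (simp add: homeomorphic_map_def)
  then have "(\<exists>h\<in>H. y = act h x) \<longleftrightarrow> (\<exists>h\<in>H. \<phi> y = \<phi> (act h x))" by (simp add: inj_eq)
  also have "\<dots> \<longleftrightarrow> (\<exists>h\<in>H'. \<phi> y = act' h (\<phi> x))" unfolding e[symmetric] using assms(4) by auto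
  finally show "(\<exists>h\<in>H. y = act h x) \<longleftrightarrow> (\<exists>h\<in>H'. \<phi> y = act' h (\<phi> x))" .
qed

lemma continuous_on_vector3:
  assumes "continuous_on S f" "continuous_on S g" "continuous_on S h"
  shows "continuous_on S (\<lambda>x. vector [f x, g x, h x] :: real^3)"
proof -
  have "(vector [a, b, c] :: real^3) = a *\<^sub>R axis 1 1 + b *\<^sub>R axis 2 1 + c *\<^sub>R axis 3 1" for a b c
    by (simp add: vec_eq_iff forall_3 axis_def)
  then show ?thesis using assms by (auto intro!: continuous_intros)
qed

lemma homeomorphic_map_if_inverse:
  assumes "continuous_on UNIV \<phi>" "continuous_on UNIV \<psi>" "\<And>x. \<psi> (\<phi> x) = x" "\<And>x. \<phi> (\<psi> x) = x"
  shows "homeomorphic_map euclidean euclidean \<phi>"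
  unfolding homeomorphic_map_maps using assms by (intro exI[of _ \<psi>]) (simp add: homeomorphic_maps_def)

text \<open>The change of coordinates is the linear map given by the doubled Hermite matrix;
  \<open>u1\<close> and \<open>u2\<close> invert it by forward substitution.\<close>

lemma translations_presented:
  assumes S: "subgroup S HW" "0 < hw_index S" "S \<subseteq> evens" and f: "presents hw_act S N f"
  shows "\<exists>f'. presents torus_act UNIV N f'"
proof -
  obtain a b c x y z where abc: "0 < a" "0 < b" "0 < c" and S_eq: "S = double (lat a b c x y z)"
    using even_part_lat[OF S(1,2)] S(3) by (metis inf.absorb1)
  define \<phi> :: "real^3 \<Rightarrow> real^3" where "\<phi> v = vector [2 * (a * v $ 1), 2 * (x * v $ 1 + b * v $ 2),
      2 * (y * v $ 1 + z * v $ 2 + c * v $ 3)]" for v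
  define u1 where "u1 v = v $ 1 / (2 * a)" for v :: "real^3"
  define u2 where "u2 v = (v $ 2 / 2 - x * u1 v) / b" for v :: "real^3"
  define \<psi> :: "real^3 \<Rightarrow> real^3" where "\<psi> v = vector [u1 v, u2 v, (v $ 3 / 2 - y * u1 v - z * u2 v) / c]" for v
  define e where "e = (\<lambda>(p, q, r). (2 * (a * p), 2 * (x * p + b * q), 2 * (y * p + z * q + c * r)))"
  have "presents torus_act UNIV N (f \<circ> \<phi>)"
  proof (rule presents_intertwined[OF f])
    show "homeomorphic_map euclidean euclidean \<phi>"
    proof (rule homeomorphic_map_if_inverse)
      show "continuous_on UNIV \<phi>" "continuous_on UNIV \<psi>"
        unfolding \<phi>_def \<psi>_def u1_def u2_def using abc
        by (intro continuous_on_vector3 continuous_intros; simp)+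
      show "\<psi> (\<phi> v) = v" for v
        using abc by (simp add: \<phi>_def \<psi>_def u1_def u2_def vec_eq_iff forall_3 del: distrib_left_numeral)
      show "\<phi> (\<psi> v) = v" for v
        using abc by (simp add: \<phi>_def \<psi>_def u1_def u2_def vec_eq_iff forall_3)
    qed
    show "e ` UNIV = S"
    proof (rule Set.set_eqI)
      fix t
      have "t \<in> e ` UNIV \<longleftrightarrow> (\<exists>p q r. t = e (p, q, r))" by auto
      then show "t \<in> e ` UNIV \<longleftrightarrow> t \<in> S" unfolding S_eq mem_double_lat_iff by (simp only: e_def prod.case)
    qed
    show "\<phi> (torus_act h v) = hw_act (e h) (\<phi> v)" for h v
      by (cases h) (simp add: \<phi>_def torus_act_def hw_act_def e_def vec_eq_iff forall_3 algebra_simps)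
  qed
  then show ?thesis by blast
qed

text \<open>The screw axis is the third one in \<open>G2\<close> and the first one here, so the
  coordinates are permuted. The offsets \<open>p / 2\<close> and \<open>r / 2\<close> put the origin
  on the axis of the screw motion \<open>(a, p, r)\<close>, which reflects the last two coordinates
  in the point \<open>(p / 2, r / 2)\<close>.\<close>

lemma screw_group_presented:
  assumes "0 < a" "0 < b" "0 < c" "odd a" "even p" "odd r" and f: "presents hw_act (screw_group a b c z p r) N f"
  shows "\<exists>f'. presents half_turn_act UNIV N f'"
proof -
  define \<phi> :: "real^3 \<Rightarrow> real^3" where "\<phi> v = vector [a * v $ 3, 2 * (b * v $ 1) + p / 2,
      2 * (z * v $ 1 + c * v $ 2) + r / 2]" for v
  define u1 where "u1 v = (v $ 2 - p / 2) / (2 * b)" for v :: "real^3"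
  define \<psi> :: "real^3 \<Rightarrow> real^3" where "\<psi> v = vector [u1 v, ((v $ 3 - r / 2) / 2 - z * u1 v) / c, v $ 1 / a]" for v
  define e where "e = (\<lambda>(i, j, k). screw_elt a b c z p r (k, i, j))"
  have "presents half_turn_act UNIV N (f \<circ> \<phi>)"
  proof (rule presents_intertwined[OF f])
    show "homeomorphic_map euclidean euclidean \<phi>"
    proof (rule homeomorphic_map_if_inverse)
      show "continuous_on UNIV \<phi>" "continuous_on UNIV \<psi>"
        unfolding \<phi>_def \<psi>_def u1_def using assms(1-3)
        by (intro continuous_on_vector3 continuous_intros; simp)+
      show "\<psi> (\<phi> v) = v" for v
        using assms(1-3) by (simp add: \<phi>_def \<psi>_def u1_def vec_eq_iff forall_3 del: distrib_left_numeral)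
      show "\<phi> (\<psi> v) = v" for v
      proof -
        have "2 * (b * u1 v) = v $ 2 - p / 2" using assms(2) by (simp add: u1_def)
        moreover have "z * u1 v + c * (((v $ 3 - r / 2) / 2 - z * u1 v) / c) = (v $ 3 - r / 2) / 2"
          using assms(3) by simp
        ultimately show ?thesis
          using assms(1,3)
          by (simp add: \<phi>_def \<psi>_def vec_eq_iff forall_3 del: distrib_left_numeral)
            (simp add: diff_divide_distrib)
      qed
    qed
    show "e ` UNIV = screw_group a b c z p r"
    proof -
      have "e = screw_elt a b c z p r \<circ> (\<lambda>(i, j, k). (k, i, j))" by (auto simp: e_def)
      then have "e ` UNIV = screw_elt a b c z p r ` range (\<lambda>(i, j, k). (k, i, j))"
        by (simp only: image_comp)
      moreover have "surj (\<lambda>(i :: int, j :: int, k :: int). (k, i, j))"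
        by (rule surjI[of _ "\<lambda>(k, i, j). (i, j, k)"]) auto
      ultimately show ?thesis by (simp only: screw_group_def)
    qed
    show "\<phi> (half_turn_act h v) = hw_act (e h) (\<phi> v)" for h v
      using assms(4-6)
      by (cases h) (auto simp: \<phi>_def half_turn_act_def hw_act_def e_def screw_elt_def vec_eq_iff forall_3 algebra_simps)
  qed
  then show ?thesis by blast
qed

lemma cyc_presented:
  assumes "presents hw_act ((cyc ^^ i) ` S) N f"
  shows "\<exists>f'. presents hw_act S N f'"
proof -
  define \<phi> :: "real^3 \<Rightarrow> real^3" where "\<phi> v = vector [v $ 3, v $ 1, v $ 2]" for v
  have hom: "homeomorphic_map euclidean euclidean \<phi>"
    by (rule homeomorphic_map_if_inverse[of _ "\<lambda>v. vector [v $ 2, v $ 3, v $ 1]"])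
      (auto simp: \<phi>_def vec_eq_iff forall_3 intro!: continuous_on_vector3 continuous_intros)
  have step: "\<exists>f'. presents hw_act S' N f'" if "presents hw_act (cyc ` S') N g" for S' g
  proof -
    have "presents hw_act S' N (g \<circ> \<phi>)"
      by (rule presents_intertwined[OF that hom refl])
        (clarsimp simp: \<phi>_def hw_act_def vec_eq_iff forall_3)
    then show ?thesis by blast
  qed
  show ?thesis using assms
  proof (induction i arbitrary: f)
    case (Suc i)
    have "presents hw_act (cyc ` (cyc ^^ i) ` S) N f" using Suc(2) by (simp add: image_comp)
    then show ?case using step Suc(1) by blast
  qed auto
qed

lemma (in group) conj_cancel:
  "g \<in> carrier G \<Longrightarrow> h \<in> carrier G \<Longrightarrow> inv g \<otimes> (g \<otimes> h \<otimes> inv g) \<otimes> g = h"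
  by (simp add: m_assoc) (simp add: m_assoc[symmetric])

lemma conj_presented:
  assumes s: "s \<in> carrier HW" and S: "S \<subseteq> carrier HW" and f: "presents hw_act S N f"
  shows "\<exists>f'. presents hw_act (conj_HW_set s S) N f'"
proof -
  let ?s' = "hw_inv s"
  have s': "?s' \<in> carrier HW" using s by (rule HW.inv_closed)
  have "presents hw_act (conj_HW_set s S) N (f \<circ> hw_act ?s')"
  proof (rule presents_intertwined[OF f])
    show "homeomorphic_map euclidean euclidean (hw_act ?s')"
      by (rule homeomorphic_map_if_inverse[of _ "hw_act s"])
        (use s s' HW.continuous_on_act in auto)
    have cancel: "?s' \<star> (s \<star> h \<star> ?s') \<star> s = h" if "h \<in> S" for h
      using that S s by (intro HW.conj_cancel) auto
    show "(\<lambda>h. ?s' \<star> h \<star> s) ` conj_HW_set s S = S"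
      unfolding image_image using image_cong[OF refl cancel, of S] by simp
    fix h x assume "h \<in> conj_HW_set s S"
    then have h: "h \<in> carrier HW" using s S by (auto intro!: HW.m_closed)
    show "hw_act ?s' (hw_act h x) = hw_act (?s' \<star> h \<star> s) (hw_act ?s' x)"
      using s s' h by (simp add: HW.act_mult_apply del: mult_HW inv_HW)
  qed
  then show ?thesis by blast
qed

lemma scaled_HW_presented:
  assumes pos: "0 < a" "0 < b" "0 < c" and odd: "odd a" "odd b" "odd c" and f: "presents hw_act (scaled_HW a b c) N f"
  shows "\<exists>f'. presents hw_act (carrier HW) N f'"
proof -
  define \<phi> :: "real^3 \<Rightarrow> real^3" where "\<phi> v = vector [a * v $ 1, b * v $ 2, c * v $ 3]" for v
  have "presents hw_act (carrier HW) N (f \<circ> \<phi>)"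
  proof (rule presents_intertwined[OF f])
    show "homeomorphic_map euclidean euclidean \<phi>"
      by (rule homeomorphic_map_if_inverse[of _ "\<lambda>v. vector [v $ 1 / a, v $ 2 / b, v $ 3 / c]"])
        (use pos in \<open>auto simp: \<phi>_def vec_eq_iff forall_3 intro!: continuous_on_vector3 continuous_intros\<close>)
    show "(\<lambda>(i, j, k). (a * i, b * j, c * k)) ` carrier HW = scaled_HW a b c"
    proof (intro equalityI subsetI)
      fix t assume t_in: "t \<in> scaled_HW a b c"
      obtain i' j' k' where t': "t = (i', j', k')" by (cases t)
      then have "a dvd i'" "b dvd j'" "c dvd k'" and ev: "even (i' + j' + k')"
        using t_in by (simp_all add: scaled_HW_def)
      then obtain i j k where ijk: "i' = a * i" "j' = b * j" "k' = c * k" by (elim dvdE)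
      then have t: "t = (a * i, b * j, c * k)" using t' by simp
      have "(i, j, k) \<in> carrier HW" using ev odd by (simp add: ijk)
      then show "t \<in> (\<lambda>(i, j, k). (a * i, b * j, c * k)) ` carrier HW"
        by (rule rev_image_eqI) (simp add: t)
    next
      fix t assume "t \<in> (\<lambda>(i, j, k). (a * i, b * j, c * k)) ` carrier HW"
      then obtain i j k where "even (i + j + k)" "t = (a * i, b * j, c * k)" by auto
      then show "t \<in> scaled_HW a b c" using odd by (simp add: scaled_HW_def)
    qed
    have "psign (a * k) = (psign k :: real)" "psign (b * k) = (psign k :: real)" "psign (c * k) = (psign k :: real)" for k
      using odd by (simp_all add: psign_def)
    then show "\<phi> (hw_act h v) = hw_act (case h of (i, j, k) \<Rightarrow> (a * i, b * j, c * k)) (\<phi> v)" for h v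
      by (cases h) (simp add: \<phi>_def hw_act_def vec_eq_iff forall_3 algebra_simps)
  qed
  then show ?thesis by blast
qed

lemma screw_type_presented:
  assumes S: "subgroup S HW" "0 < hw_index S" "screw_type S" and f: "presents hw_act S N f"
  shows "\<exists>f'. presents half_turn_act UNIV N f'"
proof -
  obtain i S0 where i: "S = (cyc ^^ i) ` S0" and S0: "screw S0" "subgroup S0 HW" "0 < hw_index S0"
    using screw_type_cases[OF S(1,3)] S(2) by metis
  obtain a b c z p r where "0 < a" "0 < b" "0 < c" "odd a" "even p" "odd r" "S0 = screw_group a b c z p r"
    using screw_is_screw_group[OF S0(2,3,1)] by metis
  then show ?thesis using cyc_presented[of i S0 N f] f screw_group_presented unfolding i by blast
qed

lemma full_type_presented:
  assumes S: "subgroup S HW" "0 < hw_index S" "full_type S" and f: "presents hw_act S N f"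
  shows "\<exists>f'. presents hw_act (carrier HW) N f'"
proof -
  obtain a b c s where "0 < a" "0 < b" "0 < c" "odd a" "odd b" "odd c" "s \<in> carrier HW"
    "scaled_HW a b c = conj_HW_set s S"
    using full_type_structure[OF S] by metis
  then show ?thesis
    using conj_presented[OF _ subgroup.subset[OF S(1)] f] scaled_HW_presented by metis
qed

text \<open>At every base point the fundamental group is isomorphic to the acting group, which
  removes the choice of base points from the definition.\<close>

lemma isomorphic_fundamental_groups_iff:
  assumes A: "isometric_action A actA" and B: "isometric_action B actB"
    and f: "presents actA (carrier A) N f" and q: "presents actB (carrier B) M q"
  shows "isomorphic_fundamental_groups N M \<longleftrightarrow> A \<cong> B"
proof -
  interpret A: isometric_action A actA by (fact A)
  interpret B: isometric_action B actB by (fact B)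
  have iA: "A \<cong> fundamental_group N x" if "x \<in> topspace N" for x
    using that A.fundamental_group_presented[OF f] unfolding presents_range[OF f, symmetric] by auto
  have iB: "B \<cong> fundamental_group M x" if "x \<in> topspace M" for x
    using that B.fundamental_group_presented[OF q] unfolding presents_range[OF q, symmetric] by auto
  show ?thesis
  proof
    assume "isomorphic_fundamental_groups N M"
    then obtain x y where xy: "x \<in> topspace N" "y \<in> topspace M" "fundamental_group N x \<cong> fundamental_group M y"
      by (auto simp: isomorphic_fundamental_groups_def)
    show "A \<cong> B"
      using iso_trans[OF iso_trans[OF iA[OF xy(1)] xy(3)] B.iso_sym[OF iB[OF xy(2)]]] .
  next
    assume "A \<cong> B"
    have "f 0 \<in> topspace N" "q 0 \<in> topspace M" by (rule presents_in_topspace[OF f], rule presents_in_topspace[OF q])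
    then have "fundamental_group N (f 0) \<cong> fundamental_group M (q 0)"
      using iso_trans[OF iso_trans[OF A.iso_sym[OF iA] \<open>A \<cong> B\<close>] iB] by blast
    then show "isomorphic_fundamental_groups N M"
      unfolding isomorphic_fundamental_groups_def using \<open>f 0 \<in> topspace N\<close> \<open>q 0 \<in> topspace M\<close> by blast
  qed
qed

section \<open>Distinguishing the three fundamental groups\<close>

lemma iso_commutative:
  assumes "A \<cong> B" "\<And>x y. x \<in> carrier A \<Longrightarrow> y \<in> carrier A \<Longrightarrow> x \<otimes>\<^bsub>A\<^esub> y = y \<otimes>\<^bsub>A\<^esub> x"
    and "u \<in> carrier B" "v \<in> carrier B"
  shows "u \<otimes>\<^bsub>B\<^esub> v = v \<otimes>\<^bsub>B\<^esub> u"
proof -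
  obtain \<phi> where \<phi>: "\<phi> \<in> iso A B" using assms(1) by (auto simp: is_iso_def)
  then have hom: "\<phi> \<in> hom A B" and surj: "\<phi> ` carrier A = carrier B"
    by (auto simp: iso_def bij_betw_def)
  obtain x y where "x \<in> carrier A" "u = \<phi> x" "y \<in> carrier A" "v = \<phi> y"
    using assms(3,4) unfolding surj[symmetric] by blast
  then show ?thesis using hom_mult[OF hom] assms(2) by metis
qed

lemma ZZ3_not_iso_SZ3: "\<not> ZZ3 \<cong> SZ3"
proof
  assume "ZZ3 \<cong> SZ3"
  then have "(1, 0, 0) \<otimes>\<^bsub>SZ3\<^esub> (0, 0, 1) = (0, 0, 1) \<otimes>\<^bsub>SZ3\<^esub> (1, 0, 0)"
    by (rule iso_commutative) (simp_all add: ZZ3_def SZ3_def)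
  then show False by (simp add: SZ3_def)
qed

lemma ZZ3_not_iso_HW: "\<not> ZZ3 \<cong> HW"
proof
  assume "ZZ3 \<cong> HW"
  then have "(1, 0, 1) \<star> (1, 1, 0) = (1, 1, 0) \<star> (1, 0, 1)"
    by (rule iso_commutative) (simp_all add: ZZ3_def)
  then show False by simp
qed

text \<open>The square of the screw motion is central in the group of the half-turn manifold,
  whereas the Hantzsche--Wendt group has trivial centre.\<close>

lemma SZ3_not_iso_HW: "\<not> SZ3 \<cong> HW"
proof
  assume "SZ3 \<cong> HW"
  then obtain \<phi> where \<phi>: "\<phi> \<in> iso SZ3 HW" by (auto simp: is_iso_def)
  have mult: "\<phi> (x \<otimes>\<^bsub>SZ3\<^esub> y) = \<phi> x \<star> \<phi> y" for x y
    by (rule hom_mult) (use \<phi> in \<open>simp_all add: iso_def SZ3_def\<close>)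
  have inj: "inj \<phi>" and surj: "range \<phi> = carrier HW"
    using \<phi> by (auto simp: iso_def bij_betw_def SZ3_def)
  obtain a b c where u: "\<phi> (0, 0, 2) = (a, b, c)" by (metis prod_cases3)
  have central: "(a, b, c) \<star> v = v \<star> (a, b, c)" if v: "v \<in> carrier HW" for v
  proof -
    obtain x where "v = \<phi> x" using v surj by blast
    moreover have "(0, 0, 2) \<otimes>\<^bsub>SZ3\<^esub> x = x \<otimes>\<^bsub>SZ3\<^esub> (0, 0, 2)" by (cases x) (simp add: SZ3_def)
    ultimately show ?thesis unfolding u[symmetric] by (metis mult)
  qed
  have "b = 0" "c = 0 \<or> odd a" "a = 0"
    using central[of "(1, 0, 1)"] central[of "(1, 1, 0)"] by (auto simp: psign_def split: if_splits)
  moreover have "psign k \<noteq> (0 :: int)" for k by (simp add: psign_def)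
  ultimately have "\<phi> (0, 0, 2) = \<phi> (0, 0, 0)"
    using mult[of "(0, 0, 0)" "(0, 0, 0)"] central[of "(1, 0, 1)"]
      central[of "(0, 1, 1)"] u by (cases "\<phi> (0, 0, 0)") (auto simp: SZ3_def)
  then show False using inj by (simp add: inj_eq)
qed

text \<open>Every subgroup has one of the three types, each type yields the fundamental group of one
  model, and these groups are pairwise non-isomorphic; so the implications from type to group
  reverse.\<close>

lemma isomorphism_types:
  assumes S: "subgroup S HW" "0 < hw_index S" and f: "presents hw_act S N f"
  shows "isomorphic_fundamental_groups N G1 \<longleftrightarrow> S \<subseteq> evens"
    and "isomorphic_fundamental_groups N G2 \<longleftrightarrow> screw_type S"
    and "isomorphic_fundamental_groups N G6 \<longleftrightarrow> full_type S"
proof -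
  have carriers: "carrier ZZ3 = UNIV" "carrier SZ3 = UNIV" by (simp_all add: ZZ3_def SZ3_def)
  note acts = ZZ3.isometric_action_axioms SZ3.isometric_action_axioms HW.isometric_action_axioms
  note G = G1_presented[folded carriers(1)] G2_presented[folded carriers(2)] G6_presented
  have not_iso: "\<not> SZ3 \<cong> ZZ3" "\<not> HW \<cong> ZZ3" "\<not> HW \<cong> SZ3"
    using ZZ3_not_iso_SZ3 ZZ3_not_iso_HW SZ3_not_iso_HW SZ3.iso_sym HW.iso_sym by blast+
  have 1: "isomorphic_fundamental_groups N G1" "\<not> isomorphic_fundamental_groups N G2"
    "\<not> isomorphic_fundamental_groups N G6" if P: "S \<subseteq> evens"
  proof -
    obtain f' where "presents torus_act (carrier ZZ3) N f'"
      using translations_presented[OF S P f] unfolding carriers by blast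
    from isomorphic_fundamental_groups_iff[OF acts(1) _ this]
    show "isomorphic_fundamental_groups N G1" "\<not> isomorphic_fundamental_groups N G2"
      "\<not> isomorphic_fundamental_groups N G6"
      using acts G ZZ3_not_iso_SZ3 ZZ3_not_iso_HW iso_refl by blast+
  qed
  have 2: "\<not> isomorphic_fundamental_groups N G1" "isomorphic_fundamental_groups N G2"
    "\<not> isomorphic_fundamental_groups N G6" if P: "screw_type S"
  proof -
    obtain f' where "presents half_turn_act (carrier SZ3) N f'"
      using screw_type_presented[OF S P f] unfolding carriers by blast
    from isomorphic_fundamental_groups_iff[OF acts(2) _ this]
    show "\<not> isomorphic_fundamental_groups N G1" "isomorphic_fundamental_groups N G2"
      "\<not> isomorphic_fundamental_groups N G6"
      using acts G not_iso SZ3_not_iso_HW iso_refl by blast+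
  qed
  have 6: "\<not> isomorphic_fundamental_groups N G1" "\<not> isomorphic_fundamental_groups N G2"
    "isomorphic_fundamental_groups N G6" if P: "full_type S"
  proof -
    obtain f' where "presents hw_act (carrier HW) N f'"
      using full_type_presented[OF S P f] by blast
    from isomorphic_fundamental_groups_iff[OF acts(3) _ this]
    show "\<not> isomorphic_fundamental_groups N G1" "\<not> isomorphic_fundamental_groups N G2"
      "isomorphic_fundamental_groups N G6"
      using acts G not_iso iso_refl by blast+
  qed
  show "isomorphic_fundamental_groups N G1 \<longleftrightarrow> S \<subseteq> evens"
    "isomorphic_fundamental_groups N G2 \<longleftrightarrow> screw_type S"
    "isomorphic_fundamental_groups N G6 \<longleftrightarrow> full_type S"
    using subgroup_types[OF S(1)] 1 2 6 by blast+
qed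

lemma covering_homeomorphic_types:
  assumes n: "0 < n" and N: "connected_space N" "fold_covering n N G6 p"
  shows "N homeomorphic_space G6 \<or> N homeomorphic_space G2 \<or> N homeomorphic_space G1"
proof -
  have "covering_map N G6 p" using N(2) by (simp add: fold_covering_def)
  then obtain S f where S: "subgroup S HW" and f: "presents hw_act S N f"
    and pf: "\<And>x. p (f x) = orbit_of (hw_act ` carrier HW) x"
    using HW.connected_covering_presented[OF _ N(1) G6_presented] by metis
  have "hw_index S = n" using HW.fold_covering_iff[OF f S G6_presented pf] N(2) by blast
  then have "0 < hw_index S" using n by simp
  then show ?thesis
    using subgroup_types[OF S] translations_presented[OF S _ _ f] screw_type_presented[OF S _ _ f]
      full_type_presented[OF S _ _ f] presents_unique G1_presented G2_presented G6_presented by metis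
qed

lemma mult3_le_eq_imp_eq:
  fixes a b c a' b' c' :: nat
  assumes le: "a' \<le> a" "b' \<le> b" "c' \<le> c" and eq: "a' * b' * c' = a * b * c" and pos: "0 < a" "0 < b" "0 < c"
  shows "a' = a \<and> b' = b \<and> c' = c"
proof -
  have "a' * b' * c' \<le> a' * b * c" "a' * b' * c' \<le> a * b' * c" "a' * b' * c' \<le> a * b * c'"
    using le by (simp_all add: mult_le_mono)
  then have "a * (b * c) \<le> a' * (b * c)" "b * (a * c) \<le> b' * (a * c)" "c * (a * b) \<le> c' * (a * b)"
    unfolding eq by (simp_all add: mult_ac)
  then show ?thesis using le pos by (simp add: le_antisym)
qed

theorem theorem2:
  fixes n :: nat
    and N :: "'b topology" and p :: "'b \<Rightarrow> (real^3) set"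
    and emb :: "real \<Rightarrow> 'a"
  assumes n: "n > 0"
    and large: "inj emb"
  shows
    "(connected_space N \<and> fold_covering n N G6 p \<longrightarrow>
        N homeomorphic_space G6 \<or> N homeomorphic_space G2 \<or> N homeomorphic_space G1) \<and>
     (finite (covering_classes TYPE('a) G1 G6 n) \<and>
      real (card (covering_classes TYPE('a) G1 G6 n)) =
        1/4 * omega (n/4) + 3/4 * sigma2 (n/4) + 9/4 * sigma2 (n/8)) \<and>
     (finite (covering_classes TYPE('a) G2 G6 n) \<and>
      real (card (covering_classes TYPE('a) G2 G6 n)) =
        3/2 * (sigma2 (n/2) + 2 * sigma2 (n/4) - 3 * sigma2 (n/8)
               + d3 (n/2) - d3 (n/4) - 3 * d3 (n/8) + 5 * d3 (n/16) - 2 * d3 (n/32))) \<and>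
     (finite (covering_classes TYPE('a) G6 G6 n) \<and>
      real (card (covering_classes TYPE('a) G6 G6 n)) =
        d3 n - 3 * d3 (n/2) + 3 * d3 (n/4) - d3 (n/8))"
proof (intro conjI impI)
  assume "connected_space N \<and> fold_covering n N G6 p"
  then show "N homeomorphic_space G6 \<or> N homeomorphic_space G2 \<or> N homeomorphic_space G1"
    using covering_homeomorphic_types[OF n] by blast
next
  obtain e :: "real^3 \<Rightarrow> real" where e: "inj e" using exists_inj_real3_real by blast
  \<comment> \<open>\<open>e\<close> and \<open>emb\<close> together name each orbit by an element
    of the prescribed type, so that every subgroup is realised by a covering with points
    there.\<close>
  note card_classes = HW.card_covering_classes[OF G6_presented large e]
  have "finite (covering_classes TYPE('a) G1 G6 n) \<and> card (covering_classes TYPE('a) G1 G6 n) =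
     card (translation_subgroups n // {(S, S'). S \<in> translation_subgroups n \<and>
      S' \<in> translation_subgroups n \<and> (\<exists>g\<in>carrier HW. S' = conj_HW_set g S)})"
  proof (rule card_classes[where P = "\<lambda>S. S \<subseteq> evens"])
    fix S assume S: "subgroup S HW" "hw_index S = n" "S \<subseteq> evens"
    have "conj_HW_set \<one>\<^bsub>HW\<^esub> S = S"
      using subgroup.mem_carrier[OF S(1)] by (simp cong: image_cong del: mult_HW inv_HW one_HW)
    then show "\<exists>S'\<in>translation_subgroups n. \<exists>g\<in>carrier HW. S' = conj_HW_set g S"
      using S HW.one_closed unfolding translation_subgroups_def by blast
  qed (use n isomorphism_types(1) finite_translation_subgroups[OF n] in \<open>auto simp: translation_subgroups_def\<close>)
  then show "finite (covering_classes TYPE('a) G1 G6 n)"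
    "real (card (covering_classes TYPE('a) G1 G6 n)) = 1/4 * omega (n/4) + 3/4 * sigma2 (n/4) + 9/4 * sigma2 (n/8)"
    using card_translation_classes[OF n] by simp_all
  have "finite (covering_classes TYPE('a) G2 G6 n) \<and> card (covering_classes TYPE('a) G2 G6 n) =
     card (screw_params n // {(x, y). x \<in> screw_params n \<and> y \<in> screw_params n \<and>
      (\<exists>g\<in>carrier HW. screw_family y = conj_HW_set g (screw_family x))})"
    by (rule card_classes[where P = screw_type])
      (use n isomorphism_types(2) finite_screw_params[OF n] screw_family_properties screw_family_complete in auto)
  then show "finite (covering_classes TYPE('a) G2 G6 n)"
    "real (card (covering_classes TYPE('a) G2 G6 n)) =
        3/2 * (sigma2 (n/2) + 2 * sigma2 (n/4) - 3 * sigma2 (n/8)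
               + d3 (n/2) - d3 (n/4) - 3 * d3 (n/8) + 5 * d3 (n/16) - 2 * d3 (n/32))"
    using card_screw_classes[OF n] by simp_all
  \<comment> \<open>The diagonals of the scaled copies of the group. Their index is
    \<open>a * b * c\<close> itself, hence the divisor 1.\<close>
  define X where "X = {(a, b, c). (a, b, c) \<in> triples n 1 \<and> odd a \<and> odd b \<and> odd c}"
  define fam where "fam = (\<lambda>(a, b, c). scaled_HW (int a) (int b) (int c))"
  have finX: "finite X"
    by (rule finite_subset[OF _ finite_triples[OF n, of 1]]) (auto simp: X_def)
  have "finite (covering_classes TYPE('a) G6 G6 n) \<and> card (covering_classes TYPE('a) G6 G6 n) =
     card (X // {(x, y). x \<in> X \<and> y \<in> X \<and> (\<exists>g\<in>carrier HW. fam y = conj_HW_set g (fam x))})"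
  proof (rule card_classes[where P = full_type])
    fix x assume "x \<in> X"
    then obtain a b c where x: "x = (a, b, c)" "odd a" "odd b" "odd c" "0 < a" "0 < b" "0 < c" "a * b * c = n"
      by (auto simp: X_def triples_iff)
    then have odd: "odd (int a)" "odd (int b)" "odd (int c)" by simp_all
    have "hw_index (fam x) = nat (int a * int b * int c)"
      unfolding fam_def x(1) prod.case
      by (rule full_card_rcosets[OF subgroup_scaled_HW scaled_HW_full_type[OF odd] scaled_HW_evens[OF odd]])
        (use x in simp_all)
    also have "\<dots> = n" using x(8) by (simp flip: of_nat_mult)
    finally show "subgroup (fam x) HW \<and> hw_index (fam x) = n \<and> full_type (fam x)"
      using subgroup_scaled_HW scaled_HW_full_type[OF odd] by (simp add: fam_def x(1))
  next
    fix S assume S: "subgroup S HW" "hw_index S = n" "full_type S"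
    then obtain a b c s where abc: "0 < a" "0 < b" "0 < c" "odd a" "odd b" "odd c" and s: "s \<in> carrier HW"
      "scaled_HW a b c = conj_HW_set s S" and card: "n = nat (a * b * c)"
      using full_type_structure[OF S(1) _ S(3)] n by metis
    have "(nat a, nat b, nat c) \<in> X"
      using abc card by (simp add: X_def triples_iff even_nat_iff nat_mult_distrib)
    moreover have "fam (nat a, nat b, nat c) = conj_HW_set s S" using s(2) abc by (simp add: fam_def)
    ultimately show "\<exists>x\<in>X. \<exists>g\<in>carrier HW. fam x = conj_HW_set g S" using s(1) by blast
  qed (use n isomorphism_types(3) finX in auto)
  \<comment> \<open>Conjugacy of scaled copies gives divisibility of all three entries. As both
    products of entries equal \<open>n\<close>, the diagonals coincide, and every class has a single
    parameter.\<close>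
  moreover have "{(x, y). x \<in> X \<and> y \<in> X \<and> (\<exists>g\<in>carrier HW. fam y = conj_HW_set g (fam x))} = Id_on X"
  proof -
    have "x = y" if xy: "x \<in> X" "y \<in> X" and g: "g \<in> carrier HW" "fam y = conj_HW_set g (fam x)" for x y g
    proof -
      obtain a b c where x: "x = (a, b, c)" by (cases x)
      obtain a' b' c' where y: "y = (a', b', c')" by (cases y)
      have "int a' dvd int a \<and> int b' dvd int b \<and> int c' dvd int c"
        by (rule scaled_HW_conj_dvd[OF _ _ _ _ _ _ _ g(1)])
          (use xy g(2) in \<open>simp_all add: x y X_def triples_iff fam_def\<close>)
      then have "a' \<le> a" "b' \<le> b" "c' \<le> c"
        using xy by (auto simp: x X_def triples_iff intro: dvd_imp_le)
      moreover have "a' * b' * c' = a * b * c" "0 < a" "0 < b" "0 < c"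
        using xy by (simp_all add: x y X_def triples_iff)
      ultimately show ?thesis unfolding x y using mult3_le_eq_imp_eq by blast
    qed
    moreover have "fam x = conj_HW_set \<one>\<^bsub>HW\<^esub> (fam x)" for x
    proof -
      have "h \<in> carrier HW" if "h \<in> fam x" for h
        using that subgroup.mem_carrier[OF subgroup_scaled_HW] unfolding fam_def by (cases x) auto
      then show ?thesis by (simp cong: image_cong del: mult_HW inv_HW one_HW)
    qed
    ultimately show ?thesis using HW.one_closed unfolding Id_on_def by blast
  qed
  moreover have "card (X // Id_on X) = card X"
  proof -
    have "X // Id_on X = (\<lambda>x. {x}) ` X" by (auto simp: quotient_def)
    then show ?thesis by (simp add: card_image)
  qed
  moreover have "real (card X) = d3 n - 3 * d3 (n/2) + 3 * d3 (n/4) - d3 (n/8)"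
  proof -
    have "real (card X) = tsum n 1 (\<lambda>a b c. if odd a \<and> odd b \<and> odd c then 1 else 0)"
      unfolding tsum_filter[OF n] X_def by simp
    also have "\<dots> = tsum n 1 (\<lambda>a b c. of_bool (odd a \<and> odd b \<and> odd c))" by (rule tsum_cong) simp
    finally show ?thesis using tsum_all_odd[OF n, of 1] by simp
  qed
  ultimately show "finite (covering_classes TYPE('a) G6 G6 n)"
    "real (card (covering_classes TYPE('a) G6 G6 n)) = d3 n - 3 * d3 (n/2) + 3 * d3 (n/4) - d3 (n/8)"
    by simp_all
qed

end
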